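(* For every integer $n\ge0$, all real $a,b\ge0$, and $-1<x<1$, put $D=2n+a+b+1$. Then $$|g_n^{(a,b)}(x)|\le\min\left\{T_{n,a,b},\ \frac{\sqrt2\,C_*\,\mathcal E_n(a+b+1)}{D^{1/2}(1-x^2)^{1/4}}\right\},\qquad C_*=1.2\cdot10^5.$$ At $x=\pm1$, the first branch remains valid, i.e. $|g_n^{(a,b)}(\pm1)|\le T_{n,a,b}$.
   Context: $P_n^{(a,b)}$ is the Jacobi polynomial in the standard normalization, $P_n^{(a,b)}(1)=\frac{\Gamma(n+a+1)}{n!\,\Gamma(a+1)}$, and $$g_n^{(a,b)}(x)=\left[\frac{\Gamma(n+1)\Gamma(n+a+b+1)}{\Gamma(n+a+1)\Gamma(n+b+1)}\right]^{1/2}\left(\frac{1-x}{2}\right)^{a/2}\left(\frac{1+x}{2}\right)^{b/2}P_n^{(a,b)}(x),$$ with $0^0$ at $x=\pm1$ understood by continuous extension (so $0^0=1$). Further, $$T_{n,a,b}=\left[\frac{(n+1)(n+a+b+1)}{(n+a+1)(n+b+1)}\right]^{1/4},\qquad \mathcal E_k(S)=\max\left\{1,S^{1/6},\frac{S^{1/4}}{(k+1)^{1/12}}\right\}\quad(k\in\mathbb N_0,\ S\ge0).$$ *)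

theory Defs
  imports "HOL-Analysis.Analysis"
begin

text \<open>
  The Jacobi polynomial in the standard normalization, given by the classical explicit sum
  that results from expanding Rodrigues' formula with the Leibniz rule. It is a polynomial
  identity in the argument and hence also meaningful at the end points.
\<close>

definition jacobi_P :: "nat \<Rightarrow> real \<Rightarrow> real \<Rightarrow> real \<Rightarrow> real" where
  "jacobi_P n a b x =
     (\<Sum>s\<le>n. ((real n + a) gchoose (n - s)) * ((real n + b) gchoose s)
             * ((x - 1) / 2) ^ s * ((x + 1) / 2) ^ (n - s))"

lemma jacobi_P_one:
  assumes "a \<ge> 0"
  shows "jacobi_P n a b 1 = Gamma (real n + a + 1) / (fact n * Gamma (a + 1))"
proof -
  have "jacobi_P n a b 1 = (\<Sum>s\<in>{0}. ((real n + a) gchoose (n - s)) * ((real n + b) gchoose s)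
             * ((1 - 1) / 2) ^ s * ((1 + 1) / 2) ^ (n - s))"
    unfolding jacobi_P_def by (rule sum.mono_neutral_right) auto
  also have "\<dots> = (real n + a) gchoose n"
    by simp
  also have "\<dots> = pochhammer (a + 1) n / fact n"
    by (simp add: gbinomial_pochhammer')
  also have "pochhammer (a + 1) n = Gamma (real n + a + 1) / Gamma (a + 1)"
  proof -
    have "a + 1 \<notin> \<int>\<^sub>\<le>\<^sub>0"
      using assms nonpos_Ints_nonpos by fastforce
    then show ?thesis
      using pochhammer_Gamma[of "a + 1" n] by (simp add: add_ac)
  qed
  finally show ?thesis
    by (simp add: mult.commute)
qed

text \<open>
  In Isabelle \<^term>\<open>0 powr 0 = (0::real)\<close>, whereas here the convention is \<open>0\<^sup>0 = 1\<close>;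
  for every other nonnegative base and exponent this is just \<^const>\<open>powr\<close>.
\<close>

definition rpow :: "real \<Rightarrow> real \<Rightarrow> real" where
  "rpow t c = (if t = 0 \<and> c = 0 then 1 else t powr c)"

definition jacobi_g :: "nat \<Rightarrow> real \<Rightarrow> real \<Rightarrow> real \<Rightarrow> real" where
  "jacobi_g n a b x =
     sqrt (Gamma (real n + 1) * Gamma (real n + a + b + 1)
           / (Gamma (real n + a + 1) * Gamma (real n + b + 1)))
     * rpow ((1 - x) / 2) (a / 2) * rpow ((1 + x) / 2) (b / 2) * jacobi_P n a b x"

definition T_bound :: "nat \<Rightarrow> real \<Rightarrow> real \<Rightarrow> real" where
  "T_bound n a b =
     ((real n + 1) * (real n + a + b + 1) / ((real n + a + 1) * (real n + b + 1))) powr (1/4)"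

definition E_bound :: "nat \<Rightarrow> real \<Rightarrow> real" where
  "E_bound k S = Max {1, S powr (1/6), S powr (1/4) / (real k + 1) powr (1/12)}"

definition C_star :: real where
  "C_star = 1.2 * 10 ^ 5"

end

theory Submission
  imports Defs
begin

text \<open>
  Write \<open>g\<close> for the normalized function and \<open>g\<^sub>k\<close> for its analogue with parameters \<open>(n - k, a + k, b + k)\<close>.
  The ladder relations between consecutive \<open>g\<^sub>k\<close> make \<open>\<Psi> = g\<^sub>0\<^sup>2 + 2 (g\<^sub>1\<^sup>2 + \<dots> + g\<^sub>n\<^sup>2)\<close> satisfy
  \<open>\<Psi>' = (b / (1 + x) - a / (1 - x)) g\<^sup>2\<close> and vanish at both end points. Hence \<open>2 \<Psi>\<close> is at most the integral of
  \<open>\<bar>b / (1 + x) - a / (1 - x)\<bar> g\<^sup>2\<close>, which is controlled by the exactly known integrals of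
  \<open>g\<^sup>2\<close>, \<open>x g\<^sup>2\<close>, \<open>g\<^sup>2 / (1 - x)\<close> and \<open>g\<^sup>2 / (1 + x)\<close>; this gives the first branch.

  For the second branch let \<open>p = 1 - x\<^sup>2\<close>, so that \<open>(p g')' + (\<Phi> / p) g = 0\<close> with a concave quadratic \<open>\<Phi>\<close>. For any
  multiplier \<open>f\<close> the form \<open>f ((p g')\<^sup>2 + \<Phi> g\<^sup>2) - p f' g (p g') + p (p f')' g\<^sup>2 / 2\<close> has derivative \<open>R g\<^sup>2\<close> with an
  explicit \<open>R\<close>. The choice \<open>f = (x - l)\<^sup>3 / sqrt (r + \<epsilon> - x)\<close>, where \<open>l < r\<close> are the zeros of \<open>\<Phi>\<close> and
  \<open>\<epsilon>\<close> is a multiple of the Airy scale at \<open>r\<close>, makes \<open>R\<close> bounded above and the form bounded below, so integrating from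
  \<open>l\<close> turns the \<open>L\<^sup>2\<close> norm of \<open>g\<close> into a pointwise bound. Where \<open>p\<close> is too small for this, the first
  branch suffices, and beyond the turning point the weighted function decreases.
\<close>

section \<open>Ladder relations\<close>

text \<open>The obstacle in the second branch is the right zero \<open>r\<close> of
  \<open>\<Phi>\<close>: the plain energy \<open>(p g')^2 + \<Phi> g^2\<close> loses control of
  \<open>g\<close> there. The main part of \<open>R\<close> is
  \<open>2 \<Phi> f' + f \<Phi>'\<close>, and \<open>- 1/2\<close> is the exponent for which its
  singular terms at \<open>r\<close> cancel: for \<open>\<Phi> = \<Lambda> (r - x) (x - l)\<close>
  and \<open>f = (x - l)^3 / sqrt (r - x)\<close> it equals
  \<open>7 \<Lambda> (x - l)^3 sqrt (r - x)\<close>. The higher derivatives of \<open>f\<close> in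
  the rest of \<open>R\<close> remain singular, which forces the shift by \<open>\<epsilon>\<close>.
  The cube makes \<open>f\<close>, \<open>f'\<close> and \<open>f''\<close> vanish at
  \<open>l\<close>, so nothing has to be known about \<open>g\<close> at the left zero. The price is
  a loss near \<open>l\<close>; hence the estimate is used only right of the midpoint of the zeros,
  and a reflection handles the other half.

  Strictly positive parameters make \<open>g\<close> vanish at both end points, so all boundary
  terms drop. Zero parameters are reached by continuity, because both branches survive a limit. All
  estimates are for squares: the second branch reads
  \<open>sqrt p * g^2 \<le> 2 * C_star^2 * E^2 / D\<close>, where
  \<open>2 * C_star^2 = 28800000000\<close>.\<close>

lemma gbinomial_Suc_mult: "(real k + 1) * (z gchoose (Suc k)) = (z - real k) * (z gchoose k)" for z :: real

  by (metis add.commute of_nat_Suc gbinomial_absorb_comp gbinomial_absorption)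

definition jcoeff :: "nat \<Rightarrow> real \<Rightarrow> real \<Rightarrow> nat \<Rightarrow> real" where
  "jcoeff n a b k = ((real n + a) gchoose (n - k)) * ((real n + b) gchoose k)"

lemma jacobi_P_jcoeff:
  "jacobi_P n a b x = (\<Sum>k\<le>n. jcoeff n a b k * ((x - 1) / 2) ^ k * ((x + 1) / 2) ^ (n - k))"
  by (simp add: jacobi_P_def jcoeff_def)

text \<open>Absorption rewrites both terms over the same product of binomials, with factors
  \<open>n + 1 + b - k\<close> and \<open>a + 1 + k\<close>. Their sum is free of \<open>k\<close>,
  so differentiation produces a multiple of a single Jacobi polynomial.\<close>

lemma jcoeff_up:
  assumes "k \<le> n"
  shows "real (Suc k) * jcoeff (Suc n) a b (Suc k) + real (Suc n - k) * jcoeff (Suc n) a b k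
    = (real n + a + b + 2) * jcoeff n (a + 1) (b + 1) k"
proof -
  obtain j where n: "n = k + j" using assms nat_le_iff_add by blast
  let ?A = "real (Suc n) + a" let ?B = "real (Suc n) + b"
  have 1: "(real k + 1) * (?B gchoose (Suc k)) = (?B - real k) * (?B gchoose k)"
    by (rule gbinomial_Suc_mult)
  have 2: "(real j + 1) * (?A gchoose (Suc j)) = (?A - real j) * (?A gchoose j)"
    by (rule gbinomial_Suc_mult)
  have d: "Suc n - Suc k = j" "Suc n - k = Suc j" "n - k = j" using n by auto
  have e: "real n + (a + 1) = ?A" "real n + (b + 1) = ?B" by auto
  have "real (Suc k) * jcoeff (Suc n) a b (Suc k) + real (Suc n - k) * jcoeff (Suc n) a b k
     = (?A gchoose j) * ((real k + 1) * (?B gchoose (Suc k))) + ((real j + 1) * (?A gchoose (Suc j))) * (?B gchoose k)"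
    unfolding jcoeff_def d by (simp add: algebra_simps)
  also have "\<dots> = (real n + a + b + 2) * ((?A gchoose j) * (?B gchoose k))"
    unfolding 1 2 by (simp add: n algebra_simps)
  finally show ?thesis unfolding jcoeff_def e d .
qed

text \<open>The two terms of \<open>jcoeff_up\<close> one by one: in the lowering relation they are
  attached to different powers, so their sum is not enough.\<close>

lemma jcoeff_down:
  assumes "k \<le> n"
  shows "real (Suc n - k) * jcoeff (Suc n) a b k = (a + 1 + real k) * jcoeff n (a + 1) (b + 1) k"
    and "real (Suc k) * jcoeff (Suc n) a b (Suc k) = (real n - real k + b + 1) * jcoeff n (a + 1) (b + 1) k"
proof -
  obtain j where n: "n = k + j" using assms nat_le_iff_add by blast
  let ?A = "real (Suc n) + a" let ?B = "real (Suc n) + b"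
  have 1: "(real k + 1) * (?B gchoose (Suc k)) = (?B - real k) * (?B gchoose k)"
    by (rule gbinomial_Suc_mult)
  have 2: "(real j + 1) * (?A gchoose (Suc j)) = (?A - real j) * (?A gchoose j)"
    by (rule gbinomial_Suc_mult)
  have d: "Suc n - Suc k = j" "Suc n - k = Suc j" "n - k = j" using n by auto
  have e: "real n + (a + 1) = ?A" "real n + (b + 1) = ?B" by auto
  have "real (Suc n - k) * jcoeff (Suc n) a b k = ((real j + 1) * (?A gchoose (Suc j))) * (?B gchoose k)"
    unfolding jcoeff_def d by (simp add: algebra_simps)
  also have "\<dots> = (a + 1 + real k) * ((?A gchoose j) * (?B gchoose k))"
    unfolding 2 by (simp add: n algebra_simps)
  finally show "real (Suc n - k) * jcoeff (Suc n) a b k = (a + 1 + real k) * jcoeff n (a + 1) (b + 1) k"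
    unfolding jcoeff_def e d .
  have "real (Suc k) * jcoeff (Suc n) a b (Suc k) = (?A gchoose j) * ((real k + 1) * (?B gchoose (Suc k)))"
    unfolding jcoeff_def d by (simp add: algebra_simps)
  also have "\<dots> = (real n - real k + b + 1) * ((?A gchoose j) * (?B gchoose k))"
    unfolding 1 by (simp add: n algebra_simps)
  finally show "real (Suc k) * jcoeff (Suc n) a b (Suc k) = (real n - real k + b + 1) * jcoeff n (a + 1) (b + 1) k"
    unfolding jcoeff_def e d .
qed

lemma DERIV_bihomogeneous_term:
  "((\<lambda>x. c * ((x - 1) / 2) ^ k * ((x + 1) / 2) ^ m) has_real_derivative
     c * (real k * ((x - 1) / 2) ^ (k - 1) / 2) * ((x + 1) / 2) ^ m
        + c * ((x - 1) / 2) ^ k * (real m * ((x + 1) / 2) ^ (m - 1) / 2)) (at x)"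
proof -
  have p: "((\<lambda>x. ((x + e) / 2) ^ j) has_real_derivative real j * ((x + e) / 2) ^ (j - 1) / 2) (at x)"
    for e :: real and j
    by (auto intro!: derivative_eq_intros)
  have "((\<lambda>x. c * ((x + - 1) / 2) ^ k * ((x + 1) / 2) ^ m) has_real_derivative
     c * (real k * ((x + - 1) / 2) ^ (k - 1) / 2) * ((x + 1) / 2) ^ m
        + (real m * ((x + 1) / 2) ^ (m - 1) / 2) * (c * ((x + - 1) / 2) ^ k)) (at x)"
    by (intro DERIV_mult DERIV_cmult p)
  thus ?thesis by (simp add: mult.commute)
qed

text \<open>Both bases have derivative 1/2, so differentiation sends forms of degree
  \<open>n + 1\<close> in them to forms of degree \<open>n\<close> and acts on coefficients
  only.\<close>

lemma DERIV_bihomogeneous: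
  "((\<lambda>x. (\<Sum>k\<le>Suc n. c k * ((x - 1) / 2) ^ k * ((x + 1) / 2) ^ (Suc n - k))) has_real_derivative
     (\<Sum>k\<le>n. (real (Suc k) * c (Suc k) + real (Suc n - k) * c k) / 2
         * ((x - 1) / 2) ^ k * ((x + 1) / 2) ^ (n - k))) (at x)"
proof -
  let ?y = "(x - 1) / 2" and ?t = "(x + 1) / 2"
  have D: "((\<lambda>x. (\<Sum>k\<le>Suc n. c k * ((x - 1) / 2) ^ k * ((x + 1) / 2) ^ (Suc n - k))) has_real_derivative
     (\<Sum>k\<le>Suc n. c k * (real k * ?y ^ (k - 1) / 2) * ?t ^ (Suc n - k)
        + c k * ?y ^ k * (real (Suc n - k) * ?t ^ (Suc n - k - 1) / 2))) (at x)"
    by (rule DERIV_sum) (rule DERIV_bihomogeneous_term)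
  have "(\<Sum>k\<le>Suc n. c k * (real k * ?y ^ (k - 1) / 2) * ?t ^ (Suc n - k)
        + c k * ?y ^ k * (real (Suc n - k) * ?t ^ (Suc n - k - 1) / 2))
     = (\<Sum>k\<le>Suc n. c k * (real k * ?y ^ (k - 1) / 2) * ?t ^ (Suc n - k))
        + (\<Sum>k\<le>Suc n. c k * ?y ^ k * (real (Suc n - k) * ?t ^ (Suc n - k - 1) / 2))"
    by (rule sum.distrib)
  also have "(\<Sum>k\<le>Suc n. c k * (real k * ?y ^ (k - 1) / 2) * ?t ^ (Suc n - k))
     = (\<Sum>k\<le>n. c (Suc k) * (real (Suc k) * ?y ^ k / 2) * ?t ^ (n - k))"
    by (subst sum.atMost_Suc_shift) simp
  also have "(\<Sum>k\<le>Suc n. c k * ?y ^ k * (real (Suc n - k) * ?t ^ (Suc n - k - 1) / 2))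
     = (\<Sum>k\<le>n. c k * ?y ^ k * (real (Suc n - k) * ?t ^ (n - k) / 2))"
    by simp
  also have "(\<Sum>k\<le>n. c (Suc k) * (real (Suc k) * ?y ^ k / 2) * ?t ^ (n - k)) + \<dots>
     = (\<Sum>k\<le>n. (real (Suc k) * c (Suc k) + real (Suc n - k) * c k) / 2
         * ?y ^ k * ?t ^ (n - k))"
    unfolding sum.distrib[symmetric]
  proof (rule sum.cong[OF refl], goal_cases)
    case (1 k)
    have "c' * (l * y / 2) * z + c0 * y * (m * z / 2) = (l * c' + m * c0) / 2 * y * z" for y m z c' l c0 :: real
      by (simp add: field_simps)
    thus ?case by (simp only:)
  qed
  finally show ?thesis using D by simp
qed

lemma DERIV_jacobi_P_Suc:
  "(jacobi_P (Suc n) a b has_real_derivative (real n + a + b + 2) / 2 * jacobi_P n (a + 1) (b + 1) x) (at x)"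
proof -
  have "(\<Sum>k\<le>n. (real (Suc k) * jcoeff (Suc n) a b (Suc k) + real (Suc n - k) * jcoeff (Suc n) a b k) / 2
         * ((x - 1) / 2) ^ k * ((x + 1) / 2) ^ (n - k)) = (real n + a + b + 2) / 2 * jacobi_P n (a + 1) (b + 1) x"
    unfolding jacobi_P_jcoeff[of n] sum_distrib_left
  proof (rule sum.cong[OF refl], goal_cases)
    case (1 k)
    hence "k \<le> n" by simp
    thus ?case unfolding jcoeff_up[OF \<open>k \<le> n\<close>] by simp
  qed
  moreover have "jacobi_P (Suc n) a b = (\<lambda>x. (\<Sum>k\<le>Suc n. jcoeff (Suc n) a b k * ((x - 1) / 2) ^ k * ((x + 1) / 2) ^ (Suc n - k)))"
    by (rule ext) (rule jacobi_P_jcoeff)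
  ultimately show ?thesis using DERIV_bihomogeneous[where n = n and c = "jcoeff (Suc n) a b" and x = x] by (simp only:)
qed

lemma jacobi_P_0 [simp]: "jacobi_P 0 a b x = 1"
  by (simp add: jacobi_P_def)

text \<open>One step of Rodrigues' formula with the weight divided out. Since
  \<open>1 - x^2 = - 4 y t\<close> for the two bases \<open>y\<close> and \<open>t\<close>, both
  sides are forms of degree \<open>n + 1\<close> in \<open>y\<close> and \<open>t\<close>, and
  \<open>jcoeff_down\<close> matches their coefficients.\<close>

lemma jacobi_P_lowering:
  assumes "(jacobi_P n (a + 1) (b + 1) has_real_derivative d) (at x)"
  shows "(1 - x\<^sup>2) * d + ((b + 1) * (1 - x) - (a + 1) * (1 + x)) * jacobi_P n (a + 1) (b + 1) x
    = - 2 * (real n + 1) * jacobi_P (Suc n) a b x"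
proof -
  let ?y = "(x - 1) / 2" and ?t = "(x + 1) / 2"
  let ?c = "jcoeff n (a + 1) (b + 1)" and ?C = "jcoeff (Suc n) a b"
  have d: "?y * ?t * d = (\<Sum>k\<le>n. ?c k * (real k * ?y ^ k / 2) * ?t ^ (Suc n - k)
        + ?c k * ?y ^ (Suc k) * (real (n - k) * ?t ^ (n - k) / 2))"
  proof -
    have "((\<lambda>x. (\<Sum>k\<le>n. ?c k * ((x - 1) / 2) ^ k * ((x + 1) / 2) ^ (n - k))) has_real_derivative
     (\<Sum>k\<le>n. ?c k * (real k * ?y ^ (k - 1) / 2) * ?t ^ (n - k)
        + ?c k * ?y ^ k * (real (n - k) * ?t ^ (n - k - 1) / 2))) (at x)"
      by (rule DERIV_sum) (rule DERIV_bihomogeneous_term)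
    moreover have "jacobi_P n (a + 1) (b + 1) = (\<lambda>x. (\<Sum>k\<le>n. ?c k * ((x - 1) / 2) ^ k * ((x + 1) / 2) ^ (n - k)))"
      by (rule ext) (rule jacobi_P_jcoeff)
    ultimately have "(jacobi_P n (a + 1) (b + 1) has_real_derivative (\<Sum>k\<le>n. ?c k * (real k * ?y ^ (k - 1) / 2) * ?t ^ (n - k)
        + ?c k * ?y ^ k * (real (n - k) * ?t ^ (n - k - 1) / 2))) (at x)"
      by (simp only:)
    from DERIV_unique[OF assms this] have deq: "d = (\<Sum>k\<le>n. ?c k * (real k * ?y ^ (k - 1) / 2) * ?t ^ (n - k)
        + ?c k * ?y ^ k * (real (n - k) * ?t ^ (n - k - 1) / 2))"
      .
    \<comment> \<open>The factor \<open>k\<close> neutralizes the truncated exponent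
      \<open>k - 1\<close> at \<open>k = 0\<close>.\<close>
    have y: "?y * (real k * ?y ^ (k - 1)) = real k * ?y ^ k" for k
      by (cases k) auto
    have t: "?t * (real k * ?t ^ (k - 1)) = real k * ?t ^ k" for k
      by (cases k) auto
    have "?y * ?t * d = (\<Sum>k\<le>n. ?c k * (real k * ?y ^ k / 2) * ?t ^ (Suc n - k)
        + ?c k * ?y ^ (Suc k) * (real (n - k) * ?t ^ (n - k) / 2))"
      unfolding deq sum_distrib_left
    proof (rule sum.cong[OF refl], goal_cases)
      case (1 k)
      have alg: "y * t * (c * (ky / 2) * tn + c * yk * (nt / 2)) = c * (y * ky) / 2 * (t * tn) + c * (y * yk) * (t * nt) / 2"
        for y t c ky tn yk nt :: real
        by (simp add: field_simps)
      have "?y * ?t * (?c k * (real k * ?y ^ (k - 1) / 2) * ?t ^ (n - k) + ?c k * ?y ^ k * (real (n - k) * ?t ^ (n - k - 1) / 2))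
        = ?c k * (?y * (real k * ?y ^ (k - 1))) / 2 * (?t * ?t ^ (n - k)) + ?c k * (?y * ?y ^ k) * (?t * (real (n - k) * ?t ^ (n - k - 1))) / 2"
        by (rule alg)
      also have "\<dots> = ?c k * (real k * ?y ^ k / 2) * ?t ^ (Suc n - k)
        + ?c k * ?y ^ (Suc k) * (real (n - k) * ?t ^ (n - k) / 2)"
        unfolding y t using 1 by (simp add: Suc_diff_le)
      finally show ?case .
    qed
    thus ?thesis .
  qed
  have S: "(1 - x\<^sup>2) = - 4 * (?y * ?t)" "1 - x = - 2 * ?y" "1 + x = 2 * ?t"
    by (auto simp: field_simps power2_eq_square)
  have "(1 - x\<^sup>2) * d + ((b + 1) * (1 - x) - (a + 1) * (1 + x)) * jacobi_P n (a + 1) (b + 1) x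
     = - 4 * (?y * ?t * d) - 2 * ((b + 1) * ?y + (a + 1) * ?t) * jacobi_P n (a + 1) (b + 1) x"
    unfolding S by (simp only: algebra_simps)
  also have "\<dots> = - 2 * (\<Sum>k\<le>n. (a + 1 + real k) * ?c k * ?y ^ k * ?t ^ (Suc n - k)
       + (real n - real k + b + 1) * ?c k * ?y ^ Suc k * ?t ^ (Suc n - Suc k))"
  proof -
    have "2 * (?y * ?t * d) + ((b + 1) * ?y + (a + 1) * ?t) * jacobi_P n (a + 1) (b + 1) x
      = (\<Sum>k\<le>n. 2 * (?c k * (real k * ?y ^ k / 2) * ?t ^ (Suc n - k)
        + ?c k * ?y ^ (Suc k) * (real (n - k) * ?t ^ (n - k) / 2)) + 
         ((b + 1) * ?y + (a + 1) * ?t) * (?c k * ?y ^ k * ?t ^ (n - k)))"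
      unfolding d jacobi_P_jcoeff[of n] sum_distrib_left sum.distrib[symmetric] by (rule refl)
    also have "\<dots> = (\<Sum>k\<le>n. (a + 1 + real k) * ?c k * ?y ^ k * ?t ^ (Suc n - k)
       + (real n - real k + b + 1) * ?c k * ?y ^ Suc k * ?t ^ (Suc n - Suc k))"
    proof (rule sum.cong[OF refl], goal_cases)
      case (1 k)
      hence e: "real (n - k) = real n - real k" "?t ^ (Suc n - k) = ?t * ?t ^ (n - k)" by (auto simp: Suc_diff_le)
      have alg: "2 * (c * (K * Y / 2) * (T * TT) + c * (y * Y) * ((N - K) * TT / 2)) + ((b + 1) * y + (a + 1) * T) * (c * Y * TT)
        = (a + 1 + K) * c * Y * (T * TT) + (N - K + b + 1) * c * (y * Y) * TT" for c K Y T TT y N :: real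
        by (simp add: field_simps)
      show ?case unfolding e power_Suc diff_Suc_Suc by (rule alg)
    qed
    finally have E: "2 * (?y * ?t * d) + ((b + 1) * ?y + (a + 1) * ?t) * jacobi_P n (a + 1) (b + 1) x
      = (\<Sum>k\<le>n. (a + 1 + real k) * ?c k * ?y ^ k * ?t ^ (Suc n - k)
       + (real n - real k + b + 1) * ?c k * ?y ^ Suc k * ?t ^ (Suc n - Suc k))" .
    have alg: "- 4 * u - 2 * v * P = - 2 * (2 * u + v * P)" for u v P :: real
      by (simp add: algebra_simps)
    show ?thesis unfolding alg E by (rule refl)
  qed
  also have "(\<Sum>k\<le>n. (a + 1 + real k) * ?c k * ?y ^ k * ?t ^ (Suc n - k)
       + (real n - real k + b + 1) * ?c k * ?y ^ Suc k * ?t ^ (Suc n - Suc k))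
     = (\<Sum>k\<le>n. real (Suc n - k) * ?C k * ?y ^ k * ?t ^ (Suc n - k)
       + real (Suc k) * ?C (Suc k) * ?y ^ Suc k * ?t ^ (Suc n - Suc k))"
    by (rule sum.cong[OF refl]) (simp only: jcoeff_down atMost_iff)
  also have "\<dots> = (\<Sum>k\<le>n. real (Suc n - k) * ?C k * ?y ^ k * ?t ^ (Suc n - k))
      + (\<Sum>k\<le>n. real (Suc k) * ?C (Suc k) * ?y ^ Suc k * ?t ^ (Suc n - Suc k))"
    by (rule sum.distrib)
  also have "(\<Sum>k\<le>n. real (Suc n - k) * ?C k * ?y ^ k * ?t ^ (Suc n - k))
     = (\<Sum>k\<le>Suc n. real (Suc n - k) * ?C k * ?y ^ k * ?t ^ (Suc n - k))"
    by simp
  also have "(\<Sum>k\<le>n. real (Suc k) * ?C (Suc k) * ?y ^ Suc k * ?t ^ (Suc n - Suc k))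
     = (\<Sum>k\<le>Suc n. real k * ?C k * ?y ^ k * ?t ^ (Suc n - k))"
    by (subst sum.atMost_Suc_shift) simp
  also have "(\<Sum>k\<le>Suc n. real (Suc n - k) * ?C k * ?y ^ k * ?t ^ (Suc n - k)) + \<dots>
     = (real n + 1) * jacobi_P (Suc n) a b x"
    unfolding sum.distrib[symmetric] jacobi_P_jcoeff sum_distrib_left
  proof (rule sum.cong[OF refl], goal_cases)
    case (1 k)
    hence e: "real (Suc n - k) = real n + 1 - real k" by (simp add: of_nat_diff)
    show ?case unfolding e by (simp only: algebra_simps)
  qed
  finally show ?thesis by (simp only: mult.assoc)
qed

section \<open>The weight, the normalization and the sum of squares along the ladder\<close>

definition jacobi_weight :: "real \<Rightarrow> real \<Rightarrow> real \<Rightarrow> real" where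
  "jacobi_weight a b x = ((1 - x) / 2) powr a * ((1 + x) / 2) powr b"

definition jacobi_nrm :: "nat \<Rightarrow> real \<Rightarrow> real \<Rightarrow> real" where
  "jacobi_nrm n a b = Gamma (real n + 1) * Gamma (real n + a + b + 1)
     / (Gamma (real n + a + 1) * Gamma (real n + b + 1))"

definition jacobi_gsq :: "nat \<Rightarrow> real \<Rightarrow> real \<Rightarrow> real \<Rightarrow> real" where
  "jacobi_gsq n a b x = jacobi_nrm n a b * jacobi_weight a b x * (jacobi_P n a b x)\<^sup>2"

lemma jacobi_weight_nonneg [simp]: "jacobi_weight a b x \<ge> 0"
  by (simp add: jacobi_weight_def)

lemma jacobi_nrm_pos: "a \<ge> 0 \<Longrightarrow> b \<ge> 0 \<Longrightarrow> jacobi_nrm n a b > 0"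
  unfolding jacobi_nrm_def by (intro divide_pos_pos mult_pos_pos Gamma_real_pos) auto

lemma jacobi_gsq_nonneg: "a \<ge> 0 \<Longrightarrow> b \<ge> 0 \<Longrightarrow> jacobi_gsq n a b x \<ge> 0"
  unfolding jacobi_gsq_def using jacobi_nrm_pos[of a b n] by simp

text \<open>Holds even for zero parameters, because \<open>0 powr 0 = 0\<close>. With the convention
  \<open>0^0 = 1\<close> this would fail, so \<open>jacobi_gsq\<close> is compared with
  \<open>jacobi_g\<close> at interior points only.\<close>

lemma jacobi_gsq_end: "jacobi_gsq n a b 1 = 0" "jacobi_gsq n a b (-1) = 0"
  by (simp_all add: jacobi_gsq_def jacobi_weight_def)

lemma DERIV_jacobi_weight:
  assumes "-1 < x" "x < 1"
  shows "(jacobi_weight a b has_real_derivative jacobi_weight a b x * (b / (1 + x) - a / (1 - x))) (at x)"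
proof -
  have chain: "((\<lambda>x. ((1 + e * x) / 2) powr c) has_real_derivative e * c / (1 + e * x) * ((1 + e * x) / 2) powr c) (at x)"
    if "1 + e * x > 0" for c e :: real
  proof -
    have u: "(1 + e * x) / 2 > 0" using that by simp
    have 1: "((\<lambda>x. (1 + e * x) / 2) has_real_derivative (e / 2)) (at x)"
      by (auto intro!: derivative_eq_intros)
    have 2: "((\<lambda>x. ((1 + e * x) / 2) powr c) has_real_derivative c * ((1 + e * x) / 2) powr (c - 1) * (e / 2)) (at x)"
      by (rule DERIV_chain2[where g = "\<lambda>x. (1 + e * x) / 2", OF has_real_derivative_powr[OF u] 1])
    have 3: "((1 + e * x) / 2) powr (c - 1) = ((1 + e * x) / 2) powr c / ((1 + e * x) / 2)"
      using u by (simp only: powr_diff powr_one)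
    have "c * (U / (v / 2)) * (e / 2) = e * c / v * U" for U v :: real
      by simp
    thus ?thesis using 2 unfolding 3 by (simp only:)
  qed
  have 1: "((\<lambda>x. ((1 - x) / 2) powr a) has_real_derivative - (a / (1 - x)) * ((1 - x) / 2) powr a) (at x)"
    using chain[of "-1" a] assms by simp
  have 2: "((\<lambda>x. ((1 + x) / 2) powr b) has_real_derivative (b / (1 + x)) * ((1 + x) / 2) powr b) (at x)"
    using chain[of 1 b] assms by simp
  have "jacobi_weight a b = (\<lambda>x. ((1 - x) / 2) powr a * ((1 + x) / 2) powr b)"
    by (rule ext) (rule jacobi_weight_def)
  moreover have "((\<lambda>x. ((1 - x) / 2) powr a * ((1 + x) / 2) powr b) has_real_derivative
      jacobi_weight a b x * (b / (1 + x) - a / (1 - x))) (at x)"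
    using DERIV_mult[OF 1 2] by (simp add: jacobi_weight_def algebra_simps)
  ultimately show ?thesis by simp
qed

lemma jacobi_weight_Suc:
  assumes "-1 \<le> x" "x \<le> 1"
  shows "jacobi_weight (a + 1) (b + 1) x = jacobi_weight a b x * ((1 - x\<^sup>2) / 4)"
proof -
  have "t powr (c + 1) = t powr c * t" if "t \<ge> 0" for t c :: real
    using that by (cases "t = 0") (auto simp: powr_add)
  hence 1: "((1 - x) / 2) powr (a + 1) = ((1 - x) / 2) powr a * ((1 - x) / 2)"
    and 2: "((1 + x) / 2) powr (b + 1) = ((1 + x) / 2) powr b * ((1 + x) / 2)" using assms by auto
  have "A * ((1 - x) / 2) * (B * ((1 + x) / 2)) = A * B * ((1 - x\<^sup>2) / 4)" for A B
    by (simp add: power2_eq_square field_simps)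
  thus ?thesis unfolding jacobi_weight_def 1 2 .
qed

lemma jacobi_P_has_derivative: "\<exists>d. (jacobi_P n a b has_real_derivative d) (at x)"
proof (cases n)
  case 0
  have "jacobi_P 0 a b = (\<lambda>x. 1)" by auto
  thus ?thesis using 0 by (auto intro!: exI[of _ 0])
next
  case (Suc m)
  thus ?thesis using DERIV_jacobi_P_Suc by blast
qed

lemma continuous_jacobi_P: "continuous_on A (jacobi_P n a b)"
proof (rule continuous_at_imp_continuous_on, rule ballI)
  fix x :: real
  obtain d where "(jacobi_P n a b has_real_derivative d) (at x)"
    using jacobi_P_has_derivative[of n a b x] by (rule exE)
  thus "isCont (jacobi_P n a b) x" by (rule DERIV_isCont)
qed

text \<open>The adjoint of \<open>DERIV_jacobi_P_Suc\<close>: together they are the two sides of an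
  integration by parts that moves one step along the ladder.\<close>

lemma DERIV_jacobi_weight_P:
  assumes "-1 < x" "x < 1"
  shows "((\<lambda>x. jacobi_weight (a + 1) (b + 1) x * jacobi_P n (a + 1) (b + 1) x) has_real_derivative
      - ((real n + 1) / 2) * jacobi_weight a b x * jacobi_P (Suc n) a b x) (at x)"
proof -
  obtain d where d: "(jacobi_P n (a + 1) (b + 1) has_real_derivative d) (at x)"
    using jacobi_P_has_derivative by blast
  let ?P = "jacobi_P n (a + 1) (b + 1) x" and ?W = "jacobi_weight a b x"
  have k: "(1 - x\<^sup>2) * d + ((b + 1) * (1 - x) - (a + 1) * (1 + x)) * ?P
    = - 2 * (real n + 1) * jacobi_P (Suc n) a b x"
    by (rule jacobi_P_lowering[OF d])
  have w: "jacobi_weight (a + 1) (b + 1) x = ?W * ((1 - x\<^sup>2) / 4)"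
    using assms by (intro jacobi_weight_Suc) auto
  have "(1 - x\<^sup>2) * ((b + 1) / (1 + x) - (a + 1) / (1 - x)) = (b + 1) * (1 - x) - (a + 1) * (1 + x)"
    using assms by (simp add: divide_simps power2_eq_square) (simp add: algebra_simps)
  moreover have "W * (q / 4) * k * P + d * (W * (q / 4)) = W / 4 * (q * d + (q * k) * P)" for W q k P :: real
    by (simp add: field_simps)
  ultimately have "jacobi_weight (a + 1) (b + 1) x * ((b + 1) / (1 + x) - (a + 1) / (1 - x)) * ?P + d * jacobi_weight (a + 1) (b + 1) x
     = ?W / 4 * ((1 - x\<^sup>2) * d + ((b + 1) * (1 - x) - (a + 1) * (1 + x)) * ?P)"
    unfolding w by simp
  also have "\<dots> = - ((real n + 1) / 2) * ?W * jacobi_P (Suc n) a b x"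
    unfolding k by (simp add: algebra_simps)
  finally show ?thesis
    using DERIV_mult[OF DERIV_jacobi_weight[OF assms, of "a + 1" "b + 1"] d] by simp
qed

text \<open>The normalizations differ by the ratio of the two ladder constants
  \<open>n + a + b + 2\<close> and \<open>n + 1\<close>; this is what makes the cross terms of
  neighbouring squares cancel.\<close>

lemma jacobi_nrm_Suc:
  assumes "a > 0" "b > 0"
  shows "jacobi_nrm n (a + 1) (b + 1) = jacobi_nrm (Suc n) a b * (real n + a + b + 2) / (real n + 1)"
proof -
  have G: "Gamma (z + 1) = z * Gamma z" if "z > 0" for z :: real
    using that Gamma_plus1[of z] nonpos_Ints_nonpos by fastforce
  have 1: "Gamma (real (Suc n) + 1) = (real n + 1) * Gamma (real n + 1)"
    using G[of "real n + 1"] by (simp add: add_ac)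
  have 2: "Gamma (real n + (a + 1) + (b + 1) + 1) = (real n + a + b + 2) * Gamma (real n + a + b + 2)"
    using G[of "real n + a + b + 2"] assms by (simp add: add_ac)
  have 3: "real (Suc n) + a + b + 1 = real n + a + b + 2" "real n + (a + 1) + 1 = real (Suc n) + a + 1"
     "real n + (b + 1) + 1 = real (Suc n) + b + 1" by auto
  show ?thesis unfolding jacobi_nrm_def 1 2 unfolding 3 by (simp add: divide_simps)
qed

primrec jacobi_tail :: "nat \<Rightarrow> real \<Rightarrow> real \<Rightarrow> real \<Rightarrow> real" where
  "jacobi_tail 0 a b x = jacobi_gsq 0 a b x"
| "jacobi_tail (Suc n) a b x = jacobi_gsq (Suc n) a b x + jacobi_tail n (a + 1) (b + 1) x"

text \<open>The derivative \<open>d\<close> of weight times polynomial stays abstract. In the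
  induction step it is supplied by \<open>DERIV_jacobi_weight_P\<close>, and the derivative of the
  tail then cancels the part of the derivative of the leading square in which the polynomial is
  differentiated. The outermost use inserts the product rule instead.\<close>

lemma DERIV_jacobi_tail:
  assumes "a > 0" "b > 0" "-1 < x" "x < 1"
    and "((\<lambda>x. jacobi_weight a b x * jacobi_P n a b x) has_real_derivative d) (at x)"
  shows "(jacobi_tail n a b has_real_derivative jacobi_nrm n a b * jacobi_P n a b x * d) (at x)"
  using assms
proof (induction n arbitrary: a b d)
  case 0
  have "jacobi_tail 0 a b = (\<lambda>x. jacobi_nrm 0 a b * (jacobi_weight a b x * jacobi_P 0 a b x))"
    by (auto simp: jacobi_gsq_def)
  thus ?case using DERIV_cmult[OF "0.prems"(5), of "jacobi_nrm 0 a b"] by simp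
next
  case (Suc n)
  let ?P = "jacobi_P (Suc n) a b" and ?W = "jacobi_weight a b" and ?N = "jacobi_nrm (Suc n) a b"
  let ?c = "(real n + a + b + 2) / 2 * jacobi_P n (a + 1) (b + 1) x"
  note dW = Suc.prems(5)
  have dP: "(?P has_real_derivative ?c) (at x)"
    by (rule DERIV_jacobi_P_Suc)
  have 1: "(jacobi_tail n (a + 1) (b + 1) has_real_derivative
     jacobi_nrm n (a + 1) (b + 1) * jacobi_P n (a + 1) (b + 1) x * (- ((real n + 1) / 2) * ?W x * ?P x)) (at x)"
    using Suc.prems by (intro Suc.IH DERIV_jacobi_weight_P) auto
  have 2: "((\<lambda>x. ?N * (?W x * ?P x * ?P x)) has_real_derivative ?N * (d * ?P x + ?c * (?W x * ?P x))) (at x)"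
    by (intro DERIV_cmult DERIV_mult dW dP)
  have 3: "jacobi_tail (Suc n) a b = (\<lambda>x. ?N * (?W x * ?P x * ?P x) + jacobi_tail n (a + 1) (b + 1) x)"
    by (auto simp: jacobi_gsq_def power2_eq_square)
  have 4: "jacobi_nrm n (a + 1) (b + 1) * (real n + 1) = ?N * (real n + a + b + 2)"
    unfolding jacobi_nrm_Suc[OF Suc.prems(1,2)] by (simp add: field_simps)
  have "?N * (d * ?P x + ?c * (?W x * ?P x)) + jacobi_nrm n (a + 1) (b + 1) * jacobi_P n (a + 1) (b + 1) x * (- ((real n + 1) / 2) * ?W x * ?P x)
    = ?N * ?P x * d + (?N * (real n + a + b + 2) - jacobi_nrm n (a + 1) (b + 1) * (real n + 1)) / 2 * (jacobi_P n (a + 1) (b + 1) x * ?W x * ?P x)"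
    by (simp add: field_simps)
  hence "?N * (d * ?P x + ?c * (?W x * ?P x)) + jacobi_nrm n (a + 1) (b + 1) * jacobi_P n (a + 1) (b + 1) x * (- ((real n + 1) / 2) * ?W x * ?P x)
    = ?N * ?P x * d"
    unfolding 4 by simp
  thus ?case unfolding 3 using DERIV_add[OF 2 1] by simp
qed

lemma jacobi_gsq_le_tail: "a > 0 \<Longrightarrow> b > 0 \<Longrightarrow> jacobi_gsq n a b x \<le> jacobi_tail n a b x"
proof (induction n arbitrary: a b)
  case (Suc n)
  have "0 \<le> jacobi_gsq n (a + 1) (b + 1) x" using Suc.prems by (intro jacobi_gsq_nonneg) auto
  also have "\<dots> \<le> jacobi_tail n (a + 1) (b + 1) x" using Suc.prems by (intro Suc.IH) auto
  finally show ?case by simp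
qed simp

lemma jacobi_tail_end:
  assumes "x = 1 \<or> x = -1"
  shows "jacobi_tail n a b x = 0"
proof -
  have "\<forall>a b. jacobi_tail n a b x = 0"
    using assms by (induction n) (auto simp: jacobi_gsq_end)
  thus ?thesis by blast
qed

lemma continuous_jacobi_weight:
  assumes "a > 0" "b > 0"
  shows "continuous_on {-1..1} (jacobi_weight a b)"
proof -
  have 1: "continuous_on {-1..1} (\<lambda>x. ((1 - x) / 2) powr a)"
    by (rule continuous_on_powr') (use assms in \<open>auto intro!: continuous_intros\<close>)
  have 2: "continuous_on {-1..1} (\<lambda>x. ((1 + x) / 2) powr b)"
    by (rule continuous_on_powr') (use assms in \<open>auto intro!: continuous_intros\<close>)
  have "jacobi_weight a b = (\<lambda>x. ((1 - x) / 2) powr a * ((1 + x) / 2) powr b)"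
    by (rule ext) (rule jacobi_weight_def)
  thus ?thesis using continuous_on_mult[OF 1 2] by simp
qed

lemma continuous_jacobi_gsq:
  assumes "a > 0" "b > 0"
  shows "continuous_on {-1..1} (jacobi_gsq n a b)"
proof -
  have "jacobi_gsq n a b = (\<lambda>x. jacobi_nrm n a b * jacobi_weight a b x * (jacobi_P n a b x)\<^sup>2)"
    by (rule ext) (rule jacobi_gsq_def)
  thus ?thesis
    using continuous_on_mult[OF continuous_on_mult[OF continuous_on_const continuous_jacobi_weight[OF assms]]
        continuous_on_power[OF continuous_jacobi_P]] by simp
qed

lemma continuous_jacobi_tail:
  assumes "a > 0" "b > 0"
  shows "continuous_on {-1..1} (jacobi_tail n a b)"
proof -
  have "\<forall>a>0. \<forall>b>0. continuous_on {-1..1} (\<lambda>x. jacobi_tail n a b x)"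
  proof (induction n)
    case 0
    show ?case by (simp add: continuous_jacobi_gsq)
  next
    case (Suc n)
    thus ?case by (simp add: continuous_on_add continuous_jacobi_gsq)
  qed
  thus ?thesis using assms by simp
qed

section \<open>Exact moments\<close>

text \<open>Only the primitive has to be continuous up to the ends. The integrands below may be
  unbounded there, as \<open>a / (1 - x) * jacobi_gsq n a b x\<close> is for \<open>a < 1\<close>,
  and their integrability comes with the conclusion.\<close>

lemma has_integral_FTC_interior:
  fixes F f :: "real \<Rightarrow> real"
  assumes "c \<le> d" "continuous_on {c..d} F"
    and "\<And>x. c < x \<Longrightarrow> x < d \<Longrightarrow> (F has_real_derivative f x) (at x)"
  shows "(f has_integral (F d - F c)) {c..d}"
  using assms by (intro fundamental_theorem_of_calculus_interior)
    (auto simp: has_real_derivative_iff_has_vector_derivative)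

lemma has_integral_jacobi_weight:
  assumes "a > 0" "b > 0"
  shows "(jacobi_weight a b has_integral 2 * Beta (b + 1) (a + 1)) {-1..1}"
proof -
  have "((\<lambda>t. t powr (b + 1 - 1) * (1 - t) powr (a + 1 - 1)) has_integral Beta (b + 1) (a + 1)) {0..1}"
    using assms by (intro has_integral_Beta_real) auto
  hence "((\<lambda>t. t powr b * (1 - t) powr a) has_integral Beta (b + 1) (a + 1)) (cbox 0 1)"
    by simp
  from has_integral_affinity[OF this, of "1/2" "1/2"]
  have 1: "((\<lambda>x. (x / 2 + 1 / 2) powr b * (1 - (x / 2 + 1 / 2)) powr a) has_integral 2 * Beta (b + 1) (a + 1))
      ((\<lambda>x. 2 * x - 1) ` {0..1})"
    by simp
  have 2: "(\<lambda>x. 2 * x - 1) ` {0..1} = {-1..1::real}"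
  proof (intro equalityI subsetI)
    fix y :: real assume "y \<in> {-1..1}"
    thus "y \<in> (\<lambda>x. 2 * x - 1) ` {0..1}" by (intro image_eqI[of _ _ "(y + 1) / 2"]) (auto simp: field_simps)
  qed auto
  have 3: "(x / 2 + 1 / 2) powr b * (1 - (x / 2 + 1 / 2)) powr a = jacobi_weight a b x" for x
  proof -
    have e: "x / 2 + 1 / 2 = (1 + x) / 2" "1 - (1 + x) / 2 = (1 - x) / 2" by (simp_all add: field_simps)
    show ?thesis unfolding jacobi_weight_def e by (rule mult.commute)
  qed
  show ?thesis using 1 unfolding 2 3 .
qed

text \<open>The case distinction is needed because for \<open>n = 0\<close> the truncated
  \<open>n - 1\<close> would yield the constant polynomial 1.\<close>

definition jacobi_dP :: "nat \<Rightarrow> real \<Rightarrow> real \<Rightarrow> real \<Rightarrow> real" where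
  "jacobi_dP n a b x = (real n + a + b + 1) / 2 * (if n = 0 then 0 else jacobi_P (n - 1) (a + 1) (b + 1) x)"

lemma DERIV_jacobi_P: "(jacobi_P n a b has_real_derivative jacobi_dP n a b x) (at x)"
proof (cases n)
  case 0
  have "jacobi_P 0 a b = (\<lambda>x. 1)" by (rule ext) simp
  thus ?thesis using 0 by (simp add: jacobi_dP_def)
next
  case (Suc m)
  thus ?thesis using DERIV_jacobi_P_Suc[of m a b x] by (simp add: jacobi_dP_def add_ac)
qed

lemma DERIV_jacobi_weight_times_P:
  assumes "-1 < x" "x < 1"
  shows "((\<lambda>x. jacobi_weight a b x * jacobi_P n a b x) has_real_derivative
     jacobi_weight a b x * ((b / (1 + x) - a / (1 - x)) * jacobi_P n a b x + jacobi_dP n a b x)) (at x)"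
  using DERIV_mult[OF DERIV_jacobi_weight[OF assms] DERIV_jacobi_P]
  by (simp add: algebra_simps)

definition jacobi_cross :: "nat \<Rightarrow> real \<Rightarrow> real \<Rightarrow> real \<Rightarrow> real" where
  "jacobi_cross n a b x = jacobi_nrm n a b * jacobi_weight a b x * jacobi_P n a b x * jacobi_dP n a b x"

lemma DERIV_jacobi_gsq:
  assumes "-1 < x" "x < 1"
  shows "(jacobi_gsq n a b has_real_derivative
     (b / (1 + x) - a / (1 - x)) * jacobi_gsq n a b x + 2 * jacobi_cross n a b x) (at x)"
proof -
  have "jacobi_gsq n a b = (\<lambda>x. jacobi_nrm n a b * (jacobi_weight a b x * jacobi_P n a b x * jacobi_P n a b x))"
    by (rule ext) (simp add: jacobi_gsq_def power2_eq_square)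
  moreover have "((\<lambda>x. jacobi_nrm n a b * (jacobi_weight a b x * jacobi_P n a b x * jacobi_P n a b x)) has_real_derivative
     jacobi_nrm n a b * (jacobi_weight a b x * ((b / (1 + x) - a / (1 - x)) * jacobi_P n a b x + jacobi_dP n a b x) * jacobi_P n a b x
       + jacobi_dP n a b x * (jacobi_weight a b x * jacobi_P n a b x))) (at x)"
    by (intro DERIV_cmult DERIV_mult DERIV_jacobi_weight_times_P DERIV_jacobi_P assms)
  moreover have "N * (W * (K * P + d) * P + d * (W * P)) = K * (N * W * P\<^sup>2) + 2 * (N * W * P * d)" for N W K P d :: real
    by (simp add: power2_eq_square algebra_simps)
  ultimately show ?thesis unfolding jacobi_cross_def jacobi_gsq_def by (simp only:)
qed

text \<open>The shift \<open>(n, a, b)\<close> to \<open>(n - 1, a + 1, b + 1)\<close> preserves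
  \<open>2 n + a + b + 1\<close>. The squares of two neighbours on the ladder differ by an exact
  derivative whose primitive vanishes at both ends, so the norm equals the one of degree 0, which is
  a Beta integral.\<close>

lemma has_integral_jacobi_gsq:
  assumes "a > 0" "b > 0"
  shows "(jacobi_gsq n a b has_integral 2 / (2 * real n + a + b + 1)) {-1..1}"
  using assms
proof (induction n arbitrary: a b)
  case 0
  have G: "Gamma (a + b + 2) = (a + b + 1) * Gamma (a + b + 1)"
    using Gamma_plus1[of "a + b + 1"] 0 nonpos_Ints_nonpos[of "a + b + 1"] by (force simp: add_ac)
  have pos: "Gamma (a + b + 1) > 0" "Gamma (a + 1) > 0" "Gamma (b + 1) > 0"
    using 0 by (auto intro!: Gamma_real_pos)
  have "((\<lambda>x. jacobi_nrm 0 a b * jacobi_weight a b x) has_integral jacobi_nrm 0 a b * (2 * Beta (b + 1) (a + 1))) {-1..1}"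
    using has_integral_mult_right[OF has_integral_jacobi_weight[OF 0]] by simp
  moreover have "jacobi_nrm 0 a b * (2 * Beta (b + 1) (a + 1)) = 2 / (a + b + 1)"
  proof -
    have e: "b + 1 + (a + 1) = a + b + 2" by simp
    have "jacobi_nrm 0 a b * (2 * Beta (b + 1) (a + 1))
      = Gamma (a + b + 1) / (Gamma (a + 1) * Gamma (b + 1)) * (2 * (Gamma (b + 1) * Gamma (a + 1) / ((a + b + 1) * Gamma (a + b + 1))))"
      unfolding jacobi_nrm_def Beta_def e G by simp
    also have "\<dots> = 2 / (a + b + 1)"
      using pos by simp
    finally show ?thesis .
  qed
  moreover have "jacobi_gsq 0 a b = (\<lambda>x. jacobi_nrm 0 a b * jacobi_weight a b x)"
    by (rule ext) (simp add: jacobi_gsq_def)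
  ultimately show ?case by simp
next
  case (Suc n)
  let ?N = "jacobi_nrm n (a + 1) (b + 1)" and ?N' = "jacobi_nrm (Suc n) a b"
  let ?V = "jacobi_weight (a + 1) (b + 1)" and ?W = "jacobi_weight a b"
  let ?Q = "jacobi_P n (a + 1) (b + 1)" and ?P = "jacobi_P (Suc n) a b"
  let ?F = "\<lambda>x. (2 / (real n + a + b + 2) * ?N) * (?V x * ?Q x * ?P x)"
  have pos: "real n + a + b + 2 > 0" using Suc.prems by simp
  have N: "?N = ?N' * (real n + a + b + 2) / (real n + 1)"
    by (rule jacobi_nrm_Suc) (use Suc.prems in auto)
  have "((\<lambda>x. jacobi_gsq n (a + 1) (b + 1) x - jacobi_gsq (Suc n) a b x) has_integral ?F 1 - ?F (-1)) {-1..1}"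
  proof (rule has_integral_FTC_interior)
    show "continuous_on {-1..1} ?F" using Suc.prems
      by (intro continuous_on_mult continuous_on_const continuous_jacobi_weight continuous_jacobi_P) auto
    fix x :: real assume x: "-1 < x" "x < 1"
    have "(?F has_real_derivative (2 / (real n + a + b + 2) * ?N) *
      ((- ((real n + 1) / 2) * ?W x * ?P x) * ?P x + ((real n + a + b + 2) / 2 * ?Q x) * (?V x * ?Q x))) (at x)"
      by (intro DERIV_cmult DERIV_mult[OF DERIV_jacobi_weight_P DERIV_jacobi_P_Suc] x)
    moreover have "(2 / (real n + a + b + 2) * ?N) *
      ((- ((real n + 1) / 2) * ?W x * ?P x) * ?P x + ((real n + a + b + 2) / 2 * ?Q x) * (?V x * ?Q x))
      = jacobi_gsq n (a + 1) (b + 1) x - jacobi_gsq (Suc n) a b x"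
    proof -
      have "(2 / c * N) * ((- (m / 2) * W * P) * P + (c / 2 * Q) * (V * Q)) = N * V * Q\<^sup>2 - N * m / c * W * P\<^sup>2"
        if "c > 0" for c m N W P V Q :: real
        using that by (simp add: field_simps power2_eq_square)
      note A = this[OF pos]
      have B: "?N * (real n + 1) / (real n + a + b + 2) = ?N'"
        unfolding N using pos by simp
      show ?thesis unfolding A jacobi_gsq_def B by (rule refl)
    qed
    ultimately show "(?F has_real_derivative jacobi_gsq n (a + 1) (b + 1) x - jacobi_gsq (Suc n) a b x) (at x)"
      by simp
  qed simp
  hence "((\<lambda>x. jacobi_gsq n (a + 1) (b + 1) x - jacobi_gsq (Suc n) a b x) has_integral 0) {-1..1}"
    by (simp add: jacobi_weight_def)
  moreover have "(jacobi_gsq n (a + 1) (b + 1) has_integral 2 / (2 * real n + (a + 1) + (b + 1) + 1)) {-1..1}"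
    by (rule Suc.IH) (use Suc.prems in auto)
  ultimately have "((\<lambda>x. jacobi_gsq n (a + 1) (b + 1) x - (jacobi_gsq n (a + 1) (b + 1) x - jacobi_gsq (Suc n) a b x)) has_integral
     2 / (2 * real n + (a + 1) + (b + 1) + 1) - 0) {-1..1}"
    by (intro has_integral_diff)
  thus ?case by (simp add: algebra_simps)
qed

text \<open>The same descent with the extra factor \<open>(1 + x) / 2\<close>. Each step picks up
  half a norm, that is \<open>1 / (2 n + a + b + 1)\<close>, from the derivative of this factor;
  after \<open>n\<close> steps the cross term is 0.\<close>

lemma has_integral_jacobi_cross:
  assumes "a > 0" "b > 0"
  shows "((\<lambda>x. (1 + x) / 2 * jacobi_cross n a b x) has_integral real n / (2 * real n + a + b + 1)) {-1..1}"
  using assms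
proof (induction n arbitrary: a b)
  case 0
  show ?case by (simp add: jacobi_cross_def jacobi_dP_def)
next
  case (Suc n)
  let ?N = "jacobi_nrm n (a + 1) (b + 1)" and ?N' = "jacobi_nrm (Suc n) a b"
  let ?V = "jacobi_weight (a + 1) (b + 1)" and ?W = "jacobi_weight a b"
  let ?Q = "jacobi_P n (a + 1) (b + 1)" and ?P = "jacobi_P (Suc n) a b"
  let ?dQ = "jacobi_dP n (a + 1) (b + 1)"
  let ?F = "\<lambda>x. ?N * ((1 + x) / 2 * ?Q x * (?V x * ?Q x))"
  let ?f = "\<lambda>x. 1 / 2 * jacobi_gsq n (a + 1) (b + 1) x + (1 + x) / 2 * jacobi_cross n (a + 1) (b + 1) x
       - (1 + x) / 2 * jacobi_cross (Suc n) a b x"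
  have pos: "real n + a + b + 2 > 0" using Suc.prems by simp
  have N: "?N = ?N' * (real n + a + b + 2) / (real n + 1)"
    by (rule jacobi_nrm_Suc) (use Suc.prems in auto)
  have "(?f has_integral ?F 1 - ?F (-1)) {-1..1}"
  proof (rule has_integral_FTC_interior)
    show "continuous_on {-1..1} ?F" using Suc.prems
      by (intro continuous_on_mult continuous_on_divide continuous_on_add continuous_on_id continuous_on_const
          continuous_jacobi_weight continuous_jacobi_P) auto
    fix x :: real assume x: "-1 < x" "x < 1"
    have "((\<lambda>x. (1 + x) / 2) has_real_derivative (1 / 2)) (at x)" by (auto intro!: derivative_eq_intros)
    hence "(?F has_real_derivative ?N * ((1 / 2 * ?Q x + ?dQ x * ((1 + x) / 2)) * (?V x * ?Q x)
      + (- ((real n + 1) / 2) * ?W x * ?P x) * ((1 + x) / 2 * ?Q x))) (at x)"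
      by (intro DERIV_cmult DERIV_mult[OF DERIV_mult DERIV_jacobi_weight_P] DERIV_jacobi_P x)
    moreover have "?N * ((1 / 2 * ?Q x + ?dQ x * ((1 + x) / 2)) * (?V x * ?Q x)
      + (- ((real n + 1) / 2) * ?W x * ?P x) * ((1 + x) / 2 * ?Q x)) = ?f x"
    proof -
      have "N * ((1 / 2 * Q + dQ * t) * (V * Q) + (- (m / 2) * W * P) * (t * Q))
        = 1 / 2 * (N * V * Q\<^sup>2) + t * (N * V * Q * dQ) - t * (N * m / c * W * P * (c / 2 * Q))"
        if "c > 0" for c m N W P V Q dQ t :: real
        using that by (simp add: field_simps power2_eq_square)
      note A = this[OF pos]
      have B: "?N * (real n + 1) / (real n + a + b + 2) = ?N'"
        unfolding N using pos by simp
      have C: "jacobi_dP (Suc n) a b x = (real n + a + b + 2) / 2 * ?Q x"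
        by (simp add: jacobi_dP_def add_ac)
      show ?thesis unfolding A jacobi_gsq_def jacobi_cross_def B C by (rule refl)
    qed
    ultimately show "(?F has_real_derivative ?f x) (at x)" by simp
  qed simp
  hence f: "(?f has_integral 0) {-1..1}" by (simp add: jacobi_weight_def)
  have D: "2 * real n + (a + 1) + (b + 1) + 1 = 2 * real (Suc n) + a + b + 1" by simp
  have 1: "(jacobi_gsq n (a + 1) (b + 1) has_integral 2 / (2 * real (Suc n) + a + b + 1)) {-1..1}"
    unfolding D[symmetric] by (rule has_integral_jacobi_gsq) (use Suc.prems in auto)
  have 2: "((\<lambda>x. (1 + x) / 2 * jacobi_cross n (a + 1) (b + 1) x) has_integral real n / (2 * real (Suc n) + a + b + 1)) {-1..1}"
    unfolding D[symmetric] by (rule Suc.IH) (use Suc.prems in auto)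
  have "((\<lambda>x. 1 / 2 * jacobi_gsq n (a + 1) (b + 1) x + (1 + x) / 2 * jacobi_cross n (a + 1) (b + 1) x - ?f x) has_integral
     1 / 2 * (2 / (2 * real (Suc n) + a + b + 1)) + real n / (2 * real (Suc n) + a + b + 1) - 0) {-1..1}"
    by (intro has_integral_diff has_integral_add has_integral_mult_right 1 2 f)
  moreover have "1 / 2 * (2 / (2 * real (Suc n) + a + b + 1)) + real n / (2 * real (Suc n) + a + b + 1) - 0
     = real (Suc n) / (2 * real (Suc n) + a + b + 1)"
    by (simp add: add_divide_distrib)
  moreover have "(\<lambda>x. 1 / 2 * jacobi_gsq n (a + 1) (b + 1) x + (1 + x) / 2 * jacobi_cross n (a + 1) (b + 1) x - ?f x)
     = (\<lambda>x. (1 + x) / 2 * jacobi_cross (Suc n) a b x)" by (rule ext) simp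
  ultimately show ?case by (simp only:)
qed

text \<open>Integrate the derivative of \<open>g^2 (1 + x) / 2\<close>, whose boundary values
  vanish. By \<open>a / (1 - x) * (1 + x) / 2 = a / (1 - x) - a / 2\<close> the wanted moment splits
  off, and the known remainder adds up to
  \<open>(2 n + a + b + 1) / (2 n + a + b + 1)\<close>.\<close>

lemma has_integral_jacobi_gsq_left:
  assumes "a > 0" "b > 0"
  shows "((\<lambda>x. a / (1 - x) * jacobi_gsq n a b x) has_integral 1) {-1..1}"
proof -
  let ?g = "jacobi_gsq n a b" and ?k = "jacobi_cross n a b"
  let ?f = "\<lambda>x. ((b / (1 + x) - a / (1 - x)) * ?g x + 2 * ?k x) * ((1 + x) / 2) + 1 / 2 * ?g x"
  have "(?f has_integral ?g 1 * ((1 + 1) / 2) - ?g (-1) * ((1 + -1) / 2)) {-1..1}"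
  proof (rule has_integral_FTC_interior)
    show "continuous_on {-1..1} (\<lambda>x. ?g x * ((1 + x) / 2))"
      by (intro continuous_on_mult continuous_on_divide continuous_on_add continuous_on_id continuous_on_const
          continuous_jacobi_gsq assms) auto
    fix x :: real assume x: "-1 < x" "x < 1"
    have "((\<lambda>x. (1 + x) / 2) has_real_derivative (1 / 2)) (at x)" by (auto intro!: derivative_eq_intros)
    thus "((\<lambda>x. ?g x * ((1 + x) / 2)) has_real_derivative ?f x) (at x)"
      by (intro DERIV_mult DERIV_jacobi_gsq x)
  qed simp
  hence f: "(?f has_integral 0) {-1..1}" by (simp add: jacobi_gsq_end)
  let ?D = "2 * real n + a + b + 1"
  have "((\<lambda>x. (a + b + 1) / 2 * ?g x + 2 * ((1 + x) / 2 * ?k x) - ?f x) has_integral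
    (a + b + 1) / 2 * (2 / ?D) + 2 * (real n / ?D) - 0) {-1..1}"
    by (intro has_integral_diff has_integral_add has_integral_mult_right has_integral_jacobi_gsq has_integral_jacobi_cross assms f)
  moreover have "(a + b + 1) / 2 * (2 / ?D) + 2 * (real n / ?D) - 0 = 1"
  proof -
    have "c / 2 * (2 / D) + 2 * (m / D) - 0 = (2 * m + c) / D" for c D m :: real
      by (simp add: add_divide_distrib)
    moreover have "2 * real n + (a + b + 1) = ?D" "?D \<noteq> 0" using assms by auto
    ultimately show ?thesis by (metis divide_self)
  qed
  ultimately have 1: "((\<lambda>x. (a + b + 1) / 2 * ?g x + 2 * ((1 + x) / 2 * ?k x) - ?f x) has_integral 1) {-1..1}"
    by (simp only:)
  show ?thesis
  proof (rule has_integral_eq[OF _ 1])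
    fix x :: real assume "x \<in> {-1..1}"
    hence c: "x = 1 \<or> x = -1 \<or> (-1 < x \<and> x < 1)" by auto
    have "(a + b + 1) / 2 * g + 2 * ((1 + x) / 2 * k) - (((b / (1 + x) - a / (1 - x)) * g + 2 * k) * ((1 + x) / 2) + 1 / 2 * g)
       = a / (1 - x) * g" if "-1 < x" "x < 1" for g k
      using that by (simp add: divide_simps) (simp add: algebra_simps)
    moreover have "jacobi_cross n a b x = 0" if "x = 1 \<or> x = -1"
      using that by (auto simp: jacobi_cross_def jacobi_weight_def)
    ultimately show "(a + b + 1) / 2 * ?g x + 2 * ((1 + x) / 2 * ?k x) - ?f x = a / (1 - x) * ?g x"
      using c by (auto simp: jacobi_gsq_end)
  qed
qed

definition jacobi_psi :: "nat \<Rightarrow> real \<Rightarrow> real \<Rightarrow> real \<Rightarrow> real" where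
  "jacobi_psi n a b x = 2 * jacobi_tail n a b x - jacobi_gsq n a b x"

lemma jacobi_gsq_le_psi: "a > 0 \<Longrightarrow> b > 0 \<Longrightarrow> jacobi_gsq n a b x \<le> jacobi_psi n a b x"
  using jacobi_gsq_le_tail[of a b n x] by (simp add: jacobi_psi_def)

lemma jacobi_psi_end: "x = 1 \<or> x = -1 \<Longrightarrow> jacobi_psi n a b x = 0"
  using jacobi_tail_end[of x n a b] jacobi_gsq_end by (auto simp: jacobi_psi_def)

lemma has_integral_jacobi_psi:
  assumes "a > 0" "b > 0" "-1 \<le> c" "c \<le> d" "d \<le> 1"
  shows "((\<lambda>x. (b / (1 + x) - a / (1 - x)) * jacobi_gsq n a b x) has_integral jacobi_psi n a b d - jacobi_psi n a b c) {c..d}"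
proof (rule has_integral_FTC_interior)
  have sub: "{c..d} \<subseteq> {-1..1}" using assms by auto
  have eq: "jacobi_psi n a b = (\<lambda>x. 2 * jacobi_tail n a b x - jacobi_gsq n a b x)"
    by (rule ext) (rule jacobi_psi_def)
  show "continuous_on {c..d} (jacobi_psi n a b)" unfolding eq
    by (intro continuous_on_diff continuous_on_mult continuous_on_const
         continuous_on_subset[OF continuous_jacobi_tail sub] continuous_on_subset[OF continuous_jacobi_gsq sub] assms)
  fix x assume "c < x" "x < d"
  hence x: "-1 < x" "x < 1" using assms by auto
  let ?K = "b / (1 + x) - a / (1 - x)" and ?W = "jacobi_weight a b x" and ?P = "jacobi_P n a b x"
    and ?d = "jacobi_dP n a b x" and ?N = "jacobi_nrm n a b"
  have "(jacobi_psi n a b has_real_derivative 2 * (?N * ?P * (?W * (?K * ?P + ?d)))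
     - (?K * jacobi_gsq n a b x + 2 * jacobi_cross n a b x)) (at x)"
    unfolding eq
    by (intro DERIV_diff DERIV_cmult DERIV_jacobi_tail DERIV_jacobi_gsq DERIV_jacobi_weight_times_P assms(1,2) x)
  moreover have "2 * (N * P * (W * (K * P + d))) - (K * (N * W * P\<^sup>2) + 2 * (N * W * P * d)) = K * (N * W * P\<^sup>2)" for N P W K d :: real
    by (simp add: algebra_simps power2_eq_square)
  ultimately show "(jacobi_psi n a b has_real_derivative ?K * jacobi_gsq n a b x) (at x)"
    unfolding jacobi_cross_def jacobi_gsq_def by (simp only:)
qed (use assms in auto)

text \<open>No mirrored computation is required: \<open>jacobi_psi\<close> vanishes at both ends, so
  this moment equals the left one.\<close>

lemma has_integral_jacobi_gsq_right:
  assumes "a > 0" "b > 0"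
  shows "((\<lambda>x. b / (1 + x) * jacobi_gsq n a b x) has_integral 1) {-1..1}"
proof -
  have 1: "((\<lambda>x. (b / (1 + x) - a / (1 - x)) * jacobi_gsq n a b x) has_integral 0) {-1..1}"
    using has_integral_jacobi_psi[OF assms, of "-1" 1 n] by (simp add: jacobi_psi_end)
  show ?thesis
    using has_integral_add[OF 1 has_integral_jacobi_gsq_left[OF assms, of n]] by (simp add: algebra_simps)
qed

section \<open>The differential equation in self-adjoint form\<close>

definition jacobi_Phi :: "nat \<Rightarrow> real \<Rightarrow> real \<Rightarrow> real \<Rightarrow> real" where
  "jacobi_Phi n a b x = ((2 * real n + a + b + 1)\<^sup>2 - 1) / 4 * (1 - x\<^sup>2) - (a\<^sup>2 * (1 + x) + b\<^sup>2 * (1 - x)) / 2"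

definition jacobi_f :: "nat \<Rightarrow> real \<Rightarrow> real \<Rightarrow> real \<Rightarrow> real" where
  "jacobi_f n a b x = sqrt (jacobi_nrm n a b) * (jacobi_weight (a / 2) (b / 2) x * jacobi_P n a b x)"

text \<open>This is \<open>1 - x^2\<close> times the derivative of \<open>jacobi_f\<close>, with
  denominators cleared so that it is continuous up to the end points.\<close>

definition jacobi_f1 :: "nat \<Rightarrow> real \<Rightarrow> real \<Rightarrow> real \<Rightarrow> real" where
  "jacobi_f1 n a b x = sqrt (jacobi_nrm n a b) * (jacobi_weight (a / 2) (b / 2) x *
      ((b * (1 - x) - a * (1 + x)) / 2 * jacobi_P n a b x + (1 - x\<^sup>2) * jacobi_dP n a b x))"

lemma jacobi_f_squared:
  assumes "a > 0" "b > 0" "-1 \<le> x" "x \<le> 1"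
  shows "(jacobi_f n a b x)\<^sup>2 = jacobi_gsq n a b x"
proof -
  have h: "u powr (c / 2) * u powr (c / 2) = u powr c" for u c :: real
    by (simp flip: powr_add)
  have "(jacobi_weight (a / 2) (b / 2) x)\<^sup>2 = jacobi_weight a b x"
  proof -
    have "(jacobi_weight (a / 2) (b / 2) x)\<^sup>2 = (((1 - x) / 2) powr (a / 2) * ((1 - x) / 2) powr (a / 2)) *
       (((1 + x) / 2) powr (b / 2) * ((1 + x) / 2) powr (b / 2))"
      unfolding jacobi_weight_def by (simp only: power2_eq_square mult_ac)
    thus ?thesis unfolding h jacobi_weight_def .
  qed
  moreover have "jacobi_nrm n a b \<ge> 0" using jacobi_nrm_pos[of a b n] assms by simp
  ultimately show ?thesis
    unfolding jacobi_f_def jacobi_gsq_def by (simp add: power_mult_distrib)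
qed

text \<open>Differentiating and then applying \<open>jacobi_P_lowering\<close> goes one step along
  the ladder and back, hence returns a multiple of the same polynomial.\<close>

lemma jacobi_ODE:
  "\<exists>d. (jacobi_dP n a b has_real_derivative d) (at x) \<and>
     (1 - x\<^sup>2) * d + (b - a - (a + b + 2) * x) * jacobi_dP n a b x
       + real n * (real n + a + b + 1) * jacobi_P n a b x = 0"
proof (cases n)
  case 0
  have "jacobi_dP 0 a b = (\<lambda>x. 0)" by (rule ext) (simp add: jacobi_dP_def)
  thus ?thesis using 0 by (intro exI[of _ 0]) simp
next
  case (Suc m)
  let ?c = "(real m + a + b + 2) / 2"
  obtain d where d: "(jacobi_P m (a + 1) (b + 1) has_real_derivative d) (at x)"
    using jacobi_P_has_derivative by blast
  have eq: "jacobi_dP n a b = (\<lambda>x. ?c * jacobi_P m (a + 1) (b + 1) x)"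
    by (rule ext) (simp add: jacobi_dP_def Suc add_ac)
  have 1: "(jacobi_dP n a b has_real_derivative ?c * d) (at x)"
    unfolding eq by (rule DERIV_cmult[OF d])
  have 2: "(1 - x\<^sup>2) * d + ((b + 1) * (1 - x) - (a + 1) * (1 + x)) * jacobi_P m (a + 1) (b + 1) x
    = - 2 * (real m + 1) * jacobi_P n a b x"
    using jacobi_P_lowering[OF d] Suc by simp
  have "p * (c * d) + (b - a - (a + b + 2) * x) * (c * P) = c * (p * d + ((b + 1) * (1 - x) - (a + 1) * (1 + x)) * P)"
    for c p P by (simp add: algebra_simps)
  hence "(1 - x\<^sup>2) * (?c * d) + (b - a - (a + b + 2) * x) * (?c * jacobi_P m (a + 1) (b + 1) x)
     = ?c * ((1 - x\<^sup>2) * d + ((b + 1) * (1 - x) - (a + 1) * (1 + x)) * jacobi_P m (a + 1) (b + 1) x)" .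
  also have "\<dots> = - (real n * (real n + a + b + 1) * jacobi_P n a b x)"
    unfolding 2 by (simp add: Suc field_simps)
  finally show ?thesis using 1 unfolding eq by auto
qed

lemma DERIV_jacobi_f:
  assumes "-1 < x" "x < 1"
  shows "(jacobi_f n a b has_real_derivative jacobi_f1 n a b x / (1 - x\<^sup>2)) (at x)"
proof -
  have eq: "jacobi_f n a b = (\<lambda>x. sqrt (jacobi_nrm n a b) * (jacobi_weight (a / 2) (b / 2) x * jacobi_P n a b x))"
    by (rule ext) (rule jacobi_f_def)
  have p: "1 - x\<^sup>2 = (1 - x) * (1 + x)" by (simp add: power2_eq_square algebra_simps)
  have "(jacobi_f n a b has_real_derivative sqrt (jacobi_nrm n a b) * (jacobi_weight (a / 2) (b / 2) x * ((b / 2) / (1 + x) - (a / 2) / (1 - x)) * jacobi_P n a b x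
      + jacobi_dP n a b x * jacobi_weight (a / 2) (b / 2) x)) (at x)"
    unfolding eq by (intro DERIV_cmult DERIV_mult DERIV_jacobi_weight DERIV_jacobi_P assms)
  moreover have "N * (W * ((b / 2) / (1 + x) - (a / 2) / (1 - x)) * P + d * W)
     = N * (W * ((b * (1 - x) - a * (1 + x)) / 2 * P + (1 - x\<^sup>2) * d)) / (1 - x\<^sup>2)" for N W P d
  proof -
    have k: "(b / 2) / (1 + x) - (a / 2) / (1 - x) = (b * (1 - x) - a * (1 + x)) / 2 / (1 - x\<^sup>2)"
      unfolding p using assms by (simp add: divide_simps) (simp add: algebra_simps)
    have q: "1 - x\<^sup>2 \<noteq> 0" unfolding p using assms by simp
    have "N * (W * (k / q) * P + d * W) = N * (W * (k * P + q * d)) / q" if "q \<noteq> 0" for k q :: real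
      using that by (simp add: field_simps)
    from this[OF q] show ?thesis unfolding k .
  qed
  ultimately show ?thesis unfolding jacobi_f1_def by (simp only:)
qed

lemma DERIV_jacobi_f1:
  assumes "-1 < x" "x < 1"
  shows "(jacobi_f1 n a b has_real_derivative - (jacobi_Phi n a b x / (1 - x\<^sup>2)) * jacobi_f n a b x) (at x)"
proof -
  let ?N = "sqrt (jacobi_nrm n a b)" and ?W = "jacobi_weight (a / 2) (b / 2)" and ?P = "jacobi_P n a b"
    and ?d = "jacobi_dP n a b"
  obtain dd where dd: "(?d has_real_derivative dd) (at x)" and
    ode: "(1 - x\<^sup>2) * dd + (b - a - (a + b + 2) * x) * ?d x + real n * (real n + a + b + 1) * ?P x = 0"
    using jacobi_ODE by blast
  have eq: "jacobi_f1 n a b = (\<lambda>x. ?N * (?W x * ((b * (1 - x) - a * (1 + x)) / 2 * ?P x + (1 - x\<^sup>2) * ?d x)))"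
    by (rule ext) (rule jacobi_f1_def)
  have p: "1 - x\<^sup>2 = (1 - x) * (1 + x)" by (simp add: power2_eq_square algebra_simps)
  have q: "1 - x\<^sup>2 \<noteq> 0" unfolding p using assms by simp
  let ?R = "(b * (1 - x) - a * (1 + x)) / 2 * ?P x + (1 - x\<^sup>2) * ?d x"
  let ?dR = "(- (a + b) / 2 * ?P x + ?d x * ((b * (1 - x) - a * (1 + x)) / 2)) + ((- 2 * x) * ?d x + dd * (1 - x\<^sup>2))"
  have "(jacobi_f1 n a b has_real_derivative ?N * (?W x * ((b / 2) / (1 + x) - (a / 2) / (1 - x)) * ?R + ?dR * ?W x)) (at x)"
    unfolding eq
  proof (intro DERIV_cmult DERIV_mult DERIV_add DERIV_jacobi_weight DERIV_jacobi_P assms dd)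
    show "((\<lambda>x. (b * (1 - x) - a * (1 + x)) / 2) has_real_derivative - (a + b) / 2) (at x)"
      by (auto intro!: derivative_eq_intros)
    show "((\<lambda>x. 1 - x\<^sup>2) has_real_derivative - 2 * x) (at x)"
      by (auto intro!: derivative_eq_intros)
  qed
  moreover have "?N * (?W x * ((b / 2) / (1 + x) - (a / 2) / (1 - x)) * ?R + ?dR * ?W x)
     = - (jacobi_Phi n a b x / (1 - x\<^sup>2)) * jacobi_f n a b x"
  proof -
    let ?k = "(b * (1 - x) - a * (1 + x)) / 2"
    have k: "(b / 2) / (1 + x) - (a / 2) / (1 - x) = ?k / (1 - x\<^sup>2)"
      unfolding p using assms by (simp add: divide_simps) (simp add: algebra_simps)
    have ode': "(1 - x\<^sup>2) * dd = - (b - a - (a + b + 2) * x) * ?d x - real n * (real n + a + b + 1) * ?P x"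
      using ode by (simp add: algebra_simps)
    \<comment> \<open>\<open>?k / (1 - x^2)\<close> is the logarithmic derivative of the half
      weight. After clearing denominators the second derivative occurs only as
      \<open>(1 - x^2) * dd\<close>, which the Jacobi equation eliminates.\<close>
    have "?k * ?R + (1 - x\<^sup>2) * ?dR = - jacobi_Phi n a b x * ?P x"
    proof -
      have "?k * ?R + (1 - x\<^sup>2) * ?dR = ?k * ?R + (1 - x\<^sup>2) * ((- (a + b) / 2 * ?P x + ?d x * ?k) + ((- 2 * x) * ?d x + (1 - x\<^sup>2) * dd))"
        by (simp add: mult.commute)
      also have "\<dots> = - jacobi_Phi n a b x * ?P x"
        unfolding ode' jacobi_Phi_def by (simp add: field_simps power2_eq_square)
      finally show ?thesis .
    qed
    moreover have "N * (W * (k / q) * R + dR * W) = N * W * (k * R + q * dR) / q" if "q \<noteq> 0" for N W k q R dR :: real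
      using that by (simp add: field_simps)
    note this[OF q]
    ultimately have "?N * (?W x * (?k / (1 - x\<^sup>2)) * ?R + ?dR * ?W x) = ?N * ?W x * (- jacobi_Phi n a b x * ?P x) / (1 - x\<^sup>2)"
      by (simp only:)
    thus ?thesis unfolding k jacobi_f_def by simp
  qed
  ultimately show ?thesis by (simp only:)
qed

lemma continuous_jacobi_dP: "continuous_on A (jacobi_dP n a b)"
proof (rule continuous_at_imp_continuous_on, rule ballI)
  fix x :: real
  obtain d where "(jacobi_dP n a b has_real_derivative d) (at x)"
    using jacobi_ODE[of n a b x] by blast
  thus "isCont (jacobi_dP n a b) x" by (rule DERIV_isCont)
qed

lemma continuous_jacobi_f:
  assumes "a > 0" "b > 0"
  shows "continuous_on {-1..1} (jacobi_f n a b)" "continuous_on {-1..1} (jacobi_f1 n a b)"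
proof -
  have w: "continuous_on {-1..1} (jacobi_weight (a / 2) (b / 2))"
    by (rule continuous_jacobi_weight) (use assms in auto)
  have "continuous_on {-1..1} (\<lambda>x. sqrt (jacobi_nrm n a b) * (jacobi_weight (a / 2) (b / 2) x * jacobi_P n a b x))"
    by (intro continuous_on_mult continuous_on_const w continuous_jacobi_P)
  thus "continuous_on {-1..1} (jacobi_f n a b)" unfolding jacobi_f_def[abs_def] .
  have "continuous_on {-1..1} (\<lambda>x. sqrt (jacobi_nrm n a b) * (jacobi_weight (a / 2) (b / 2) x *
      ((b * (1 - x) - a * (1 + x)) / 2 * jacobi_P n a b x + (1 - x\<^sup>2) * jacobi_dP n a b x)))"
    by (intro continuous_on_mult continuous_on_const continuous_on_add continuous_on_diff continuous_on_divide
        continuous_on_power continuous_on_id w continuous_jacobi_P continuous_jacobi_dP) auto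
  thus "continuous_on {-1..1} (jacobi_f1 n a b)" unfolding jacobi_f1_def[abs_def] .
qed

lemma jacobi_f_end:
  assumes "x = 1 \<or> x = -1"
  shows "jacobi_f n a b x = 0" "jacobi_f1 n a b x = 0"
  using assms by (auto simp: jacobi_f_def jacobi_f1_def jacobi_weight_def)

text \<open>The energy \<open>(p g')^2 + \<Phi> g^2\<close> has derivative
  \<open>\<Phi>' g^2\<close> and vanishes at both ends. As \<open>\<Phi>'\<close> is affine in
  \<open>x\<close>, this determines the first moment from the norm.\<close>

lemma has_integral_jacobi_gsq_id:
  assumes "a > 0" "b > 0"
  shows "((\<lambda>x. x * jacobi_gsq n a b x) has_integral
     - 2 * (a + b) * (a - b) / ((2 * real n + a + b + 1) * ((2 * real n + a + b + 1)\<^sup>2 - 1))) {-1..1}"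
proof -
  let ?D = "2 * real n + a + b + 1" and ?f = "jacobi_f n a b" and ?f1 = "jacobi_f1 n a b" and ?Q = "jacobi_Phi n a b"
  let ?L = "(?D\<^sup>2 - 1) / 4"
  let ?F = "\<lambda>x. (?f1 x)\<^sup>2 + ?Q x * (?f x)\<^sup>2"
  let ?dQ = "\<lambda>x. - 2 * ?L * x - (a\<^sup>2 - b\<^sup>2) / 2"
  have dQ: "(?Q has_real_derivative ?dQ x) (at x)" for x
    unfolding jacobi_Phi_def[abs_def] by (auto intro!: derivative_eq_intros simp: field_simps)
  have D1: "?D > 1" using assms by simp
  hence L: "?D\<^sup>2 - 1 > 0" by simp
  have "((\<lambda>x. ?dQ x * (?f x)\<^sup>2) has_integral ?F 1 - ?F (-1)) {-1..1}"
  proof (rule has_integral_FTC_interior)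
    have "continuous_on {-1..1} ?Q"
      using dQ DERIV_isCont by (intro continuous_at_imp_continuous_on) blast
    thus "continuous_on {-1..1} ?F"
      by (intro continuous_on_add continuous_on_mult continuous_on_power continuous_jacobi_f assms)
    fix x :: real assume x: "-1 < x" "x < 1"
    have q: "1 - x\<^sup>2 \<noteq> 0" 
    proof -
      have "1 - x\<^sup>2 = (1 - x) * (1 + x)" by (simp add: power2_eq_square algebra_simps)
      thus ?thesis using x by simp
    qed
    have "((\<lambda>x. ?f1 x * ?f1 x + ?Q x * (?f x * ?f x)) has_real_derivative
       ((- (?Q x / (1 - x\<^sup>2)) * ?f x) * ?f1 x + (- (?Q x / (1 - x\<^sup>2)) * ?f x) * ?f1 x) +
       (?dQ x * (?f x * ?f x) + (?f1 x / (1 - x\<^sup>2) * ?f x + ?f1 x / (1 - x\<^sup>2) * ?f x) * ?Q x)) (at x)"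
      by (intro DERIV_add DERIV_mult DERIV_jacobi_f DERIV_jacobi_f1 dQ x)
    moreover have "((- (Q / q) * f) * g + (- (Q / q) * f) * g) + (dQ * (f * f) + (g / q * f + g / q * f) * Q) = dQ * f\<^sup>2"
      if "q \<noteq> 0" for q Q f g dQ :: real using that by (simp add: field_simps power2_eq_square)
    note this[OF q]
    ultimately show "(?F has_real_derivative ?dQ x * (?f x)\<^sup>2) (at x)"
      by (simp only: power2_eq_square)
  qed simp
  hence "((\<lambda>x. ?dQ x * (?f x)\<^sup>2) has_integral 0) {-1..1}" by (simp add: jacobi_f_end)
  hence 1: "((\<lambda>x. ?dQ x * jacobi_gsq n a b x) has_integral 0) {-1..1}"
    by (rule has_integral_eq[rotated]) (use assms in \<open>simp add: jacobi_f_squared\<close>)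
  have "((\<lambda>x. (- 1 / (2 * ?L)) * (?dQ x * jacobi_gsq n a b x + (a\<^sup>2 - b\<^sup>2) / 2 * jacobi_gsq n a b x)) has_integral
     (- 1 / (2 * ?L)) * (0 + (a\<^sup>2 - b\<^sup>2) / 2 * (2 / ?D))) {-1..1}"
    by (intro has_integral_mult_right has_integral_add 1 has_integral_jacobi_gsq assms)
  moreover have "(- 1 / (2 * ?L)) * (0 + (a\<^sup>2 - b\<^sup>2) / 2 * (2 / ?D)) = - 2 * (a + b) * (a - b) / (?D * (?D\<^sup>2 - 1))"
  proof -
    have "(- 1 / (2 * (M / 4))) * (0 + (a\<^sup>2 - b\<^sup>2) / 2 * (2 / D)) = - 2 * (a + b) * (a - b) / (D * M)"
      if "M > 0" "D > 0" for M D :: real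
      using that by (simp add: field_simps power2_eq_square)
    from this[OF L, of ?D] D1 show ?thesis by simp
  qed
  moreover have "(- 1 / (2 * ?L)) * (?dQ x * g + (a\<^sup>2 - b\<^sup>2) / 2 * g) = x * g" for x g
    using L by (simp add: field_simps)
  ultimately show ?thesis by (simp only:)
qed

section \<open>The uniform bound\<close>

text \<open>\<open>c\<close> is the mean of \<open>(a + b) + (a - b) x\<close> under the probability
  density \<open>D g^2 / 2\<close>, and it serves as point of tangency below. The second inequality
  turns the resulting \<open>4 a b / (c D)\<close> into
  \<open>a b / ((n + a + 1) (n + b + 1))\<close>, which is 1 minus the fourth power of
  \<open>T_bound\<close>.\<close>

lemma jacobi_mean_bound:
  fixes n :: nat and a b :: real
  assumes "a > 0" "b > 0"
  defines "D \<equiv> 2 * real n + a + b + 1"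
  defines "c \<equiv> (a + b) * (1 - (a - b)\<^sup>2 / (D\<^sup>2 - 1))"
  shows "c > 0" "c * D \<le> 4 * (real n + a + 1) * (real n + b + 1)"
proof -
  define s where "s = a + b"
  define e where "e = (a - b)\<^sup>2"
  have s: "s > 0" "D \<ge> s + 1" using assms by (auto simp: s_def)
  have "(a - b)\<^sup>2 = s\<^sup>2 - 4 * (a * b)" unfolding s_def by (simp add: power2_eq_square algebra_simps)
  hence e: "e < s\<^sup>2" using assms by (simp add: e_def)
  have "(s + 1)\<^sup>2 \<le> D\<^sup>2" using s by (intro power_mono) auto
  hence sD: "s\<^sup>2 + 2 * s \<le> D\<^sup>2 - 1" by (simp add: power2_eq_square algebra_simps)
  hence eD: "e < D\<^sup>2 - 1" "D\<^sup>2 - 1 > 0" using e s by (auto simp: add_pos_pos intro: less_le_trans)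
  have c: "c = s * (1 - e / (D\<^sup>2 - 1))" by (simp add: c_def s_def e_def)
  show "c > 0" unfolding c using s eD by (intro mult_pos_pos) (auto simp: divide_simps)
  have "c * D \<le> (D - 1) * (1 - e / (D\<^sup>2 - 1)) * D"
    unfolding c using s eD by (intro mult_right_mono) (auto simp: divide_simps)
  also have "\<dots> = D / (D + 1) * (D\<^sup>2 - 1 - e)"
  proof -
    have f: "D\<^sup>2 - 1 = (D - 1) * (D + 1)" by (simp add: power2_eq_square algebra_simps)
    show ?thesis unfolding f using s by (simp add: divide_simps)
  qed
  also have "\<dots> \<le> 1 * (D\<^sup>2 - 1 - e)"
    using s eD by (intro mult_right_mono) (auto simp: divide_simps)
  also have "\<dots> \<le> (D + 1)\<^sup>2 - e" using s by (simp add: power2_eq_square algebra_simps)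
  also have "\<dots> = 4 * (real n + a + 1) * (real n + b + 1)"
    unfolding D_def e_def by (simp add: power2_eq_square algebra_simps)
  finally show "c * D \<le> 4 * (real n + a + 1) * (real n + b + 1)" .
qed

text \<open>AM--GM with parameter \<open>k\<close> followed by the tangent of \<open>1 / y\<close> at \<open>y = c\<close>; the right-hand side only
  involves moments of the squared function that are known exactly.\<close>

lemma abs_diff_weight_le:
  fixes a b c k x :: real
  assumes "a > 0" "b > 0" "c > 0" "k > 0" "-1 < x" "x < 1"
  shows "\<bar>b / (1 + x) - a / (1 - x)\<bar> \<le> 1 / 2 * ((1 / k + k) * (a / (1 - x) + b / (1 + x))
      - 4 * a * b / k * (2 / c - ((a + b) + (a - b) * x) / c\<^sup>2))"
proof -
  define A where "A = a / (1 - x)"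
  define B where "B = b / (1 + x)"
  define y where "y = (a + b) + (a - b) * x"
  have pos: "A > 0" "B > 0" using assms by (auto simp: A_def B_def)
  have y: "y = a * (1 + x) + b * (1 - x)" by (simp add: y_def algebra_simps)
  have y0: "y > 0" 
  proof -
    have "1 + x > 0" "1 - x > 0" using assms by auto
    thus ?thesis unfolding y using assms by (simp add: add_pos_pos)
  qed
  \<comment> \<open>Since \<open>(B - A)^2 = (A + B)^2 - 4 A B\<close>, this quotient is the only
    term left by AM--GM that is not yet a known moment. Expanding with
    \<open>(1 - x) (1 + x)\<close> makes its denominator the affine function
    \<open>y\<close>.\<close>
  have AB: "4 * A * B / (A + B) = 4 * a * b / y"
  proof -
    have "(A + B) * ((1 - x) * (1 + x)) = y" "A * B * ((1 - x) * (1 + x)) = a * b"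
    proof -
      have "A * (1 - x) = a" "B * (1 + x) = b" unfolding A_def B_def using assms by auto
      moreover have "(A + B) * ((1 - x) * (1 + x)) = (A * (1 - x)) * (1 + x) + (B * (1 + x)) * (1 - x)"
        "A * B * ((1 - x) * (1 + x)) = (A * (1 - x)) * (B * (1 + x))" by (simp_all add: algebra_simps)
      ultimately show "(A + B) * ((1 - x) * (1 + x)) = y" "A * B * ((1 - x) * (1 + x)) = a * b"
        unfolding y by simp_all
    qed
    moreover have "4 * A * B * ((A + B) * q) = 4 * (A * B * q) * (A + B)" for q :: real
      by (simp add: algebra_simps)
    ultimately have "4 * A * B * y = 4 * a * b * (A + B)" by (metis mult.assoc)
    thus ?thesis using pos y0 by (simp add: divide_simps)
  qed
  have "2 * k * z * \<bar>u\<bar> \<le> u\<^sup>2 + k\<^sup>2 * z\<^sup>2" for u z :: real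
    using zero_le_power2[of "\<bar>u\<bar> - k * z"] by (simp add: power2_diff power_mult_distrib algebra_simps)
  from this[where u = "B - A" and z = "A + B"]
  have "\<bar>B - A\<bar> \<le> ((B - A)\<^sup>2 + k\<^sup>2 * (A + B)\<^sup>2) / (2 * k * (A + B))"
    using pos assms by (simp add: pos_le_divide_eq mult.commute)
  also have "\<dots> = 1 / 2 * ((1 / k + k) * (A + B) - 1 / k * (4 * A * B / (A + B)))"
  proof -
    have "(z\<^sup>2 - m + k\<^sup>2 * z\<^sup>2) / (2 * k * z) = 1 / 2 * ((1 / k + k) * z - 1 / k * (m / z))" if "z > 0" for z m
      using that assms by (simp add: field_simps power2_eq_square)
    from this[of "A + B" "4 * A * B"] pos
    have "((A + B)\<^sup>2 - 4 * A * B + k\<^sup>2 * (A + B)\<^sup>2) / (2 * k * (A + B))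
      = 1 / 2 * ((1 / k + k) * (A + B) - 1 / k * (4 * A * B / (A + B)))" by simp
    moreover have "(A + B)\<^sup>2 - 4 * A * B = (B - A)\<^sup>2" by (simp add: power2_eq_square algebra_simps)
    ultimately show ?thesis by (simp only:)
  qed
  also have "\<dots> = 1 / 2 * ((1 / k + k) * (A + B) - 4 * a * b / k * (1 / y))"
    unfolding AB by simp
  also have "\<dots> \<le> 1 / 2 * ((1 / k + k) * (A + B) - 4 * a * b / k * (2 / c - y / c\<^sup>2))"
  proof -
    have "0 \<le> (y - c)\<^sup>2" by simp
    hence "(2 * c - y) * y \<le> c\<^sup>2" by (simp add: power2_eq_square algebra_simps)
    hence "(2 * c - y) / c\<^sup>2 \<le> 1 / y" using y0 assms by (simp add: divide_simps mult.commute)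
    hence "2 / c - y / c\<^sup>2 \<le> 1 / y" using assms by (simp add: diff_divide_distrib power2_eq_square)
    hence "4 * a * b / k * (2 / c - y / c\<^sup>2) \<le> 4 * a * b / k * (1 / y)"
      using assms by (intro mult_left_mono) auto
    thus ?thesis by simp
  qed
  finally show ?thesis unfolding A_def B_def y_def .
qed

text \<open>The AM--GM parameter is the asserted bound \<open>k\<close> itself: because
  \<open>k^2 = 1 - a b / q\<close>, the estimate \<open>k + (1 - a b / q) / k\<close> equals
  \<open>2 k\<close>, its minimum over all positive parameters.\<close>

lemma jacobi_gsq_le:
  assumes "a > 0" "b > 0" "-1 < y" "y < 1"
  shows "jacobi_gsq n a b y \<le> sqrt ((real n + 1) * (real n + a + b + 1) / ((real n + a + 1) * (real n + b + 1)))"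
proof -
  define D where "D = 2 * real n + a + b + 1"
  define c where "c = (a + b) * (1 - (a - b)\<^sup>2 / (D\<^sup>2 - 1))"
  define k where "k = sqrt ((real n + 1) * (real n + a + b + 1) / ((real n + a + 1) * (real n + b + 1)))"
  note c = jacobi_mean_bound[OF assms(1,2), of n, folded D_def, folded c_def]
  have D: "D > 1" using assms by (simp add: D_def)
  have k: "k > 0" unfolding k_def using assms by (intro real_sqrt_gt_zero divide_pos_pos mult_pos_pos) auto
  let ?q = "(real n + a + 1) * (real n + b + 1)"
  have q: "?q > 0" using assms by (intro mult_pos_pos) auto
  have k2: "k\<^sup>2 = 1 - a * b / ?q"
  proof -
    have "k\<^sup>2 = (real n + 1) * (real n + a + b + 1) / ?q"
      unfolding k_def using assms by (intro real_sqrt_pow2 divide_nonneg_nonneg mult_nonneg_nonneg) auto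
    also have "(real n + 1) * (real n + a + b + 1) = ?q - a * b" by (simp add: algebra_simps)
    also have "(?q - a * b) / ?q = 1 - a * b / ?q" 
    proof -
      have "(Q - t) / Q = 1 - t / Q" if "Q > 0" for Q t :: real using that by (simp add: diff_divide_distrib)
      from this[OF q] show ?thesis .
    qed
    finally show ?thesis .
  qed
  let ?g = "jacobi_gsq n a b"
  let ?K = "\<lambda>x. b / (1 + x) - a / (1 - x)"
  let ?H = "\<lambda>x. 1 / 2 * ((1 / k + k) * (a / (1 - x) + b / (1 + x)) - 4 * a * b / k * (2 / c - ((a + b) + (a - b) * x) / c\<^sup>2)) * ?g x"
  let ?m = "- 2 * (a + b) * (a - b) / (D * (D\<^sup>2 - 1))"
  have H: "(?H has_integral 1 / k + k - 4 * a * b / (c * D) / k) {-1..1}"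
  proof -
    have "((\<lambda>x. 1 / 2 * ((1 / k + k) * (a / (1 - x) * ?g x + b / (1 + x) * ?g x)
        - 4 * a * b / k * (2 / c * ?g x - 1 / c\<^sup>2 * ((a + b) * ?g x + (a - b) * (x * ?g x))))) has_integral
       1 / 2 * ((1 / k + k) * (1 + 1) - 4 * a * b / k * (2 / c * (2 / D) - 1 / c\<^sup>2 * ((a + b) * (2 / D) + (a - b) * ?m)))) {-1..1}"
      unfolding D_def
      by (intro has_integral_mult_right has_integral_diff has_integral_add has_integral_jacobi_gsq_left
          has_integral_jacobi_gsq_right has_integral_jacobi_gsq has_integral_jacobi_gsq_id assms)
    moreover have "(a + b) * (2 / D) + (a - b) * ?m = 2 * c / D"
      unfolding c_def using D by (simp add: divide_simps power2_eq_square) (simp add: algebra_simps)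
    moreover have "1 / 2 * ((1 / k + k) * (1 + 1) - 4 * a * b / k * (2 / c * (2 / D) - 1 / c\<^sup>2 * (2 * c / D)))
      = 1 / k + k - 4 * a * b / (c * D) / k"
      using c(1) D k by (simp add: field_simps power2_eq_square)
    moreover have "1 / 2 * ((1 / k + k) * (u * g + v * g) - 4 * a * b / k * (2 / c * g - 1 / c\<^sup>2 * ((a + b) * g + (a - b) * (x * g))))
      = 1 / 2 * ((1 / k + k) * (u + v) - 4 * a * b / k * (2 / c - ((a + b) + (a - b) * x) / c\<^sup>2)) * g" for u v g x
    proof -
      have "1 / 2 * (K * (u * g + v * g) - M * (e * g - 1 / w * ((a + b) * g + (a - b) * (x * g))))
        = 1 / 2 * (K * (u + v) - M * (e - ((a + b) + (a - b) * x) / w)) * g" for K M e w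
        by (simp add: algebra_simps add_divide_distrib diff_divide_distrib)
      thus ?thesis .
    qed
    ultimately show ?thesis by (simp only:)
  qed
  have psi: "jacobi_psi n a b (-1) = 0" "jacobi_psi n a b 1 = 0" by (simp_all add: jacobi_psi_end)
  \<comment> \<open>\<open>jacobi_psi n a b y\<close> is the integral of \<open>?K * ?g\<close> from
    the left end and the negative of the one from the right end. Bounding both by \<open>?H\<close>
    uses every part of the interval exactly once.\<close>
  have 1: "((\<lambda>x. ?K x * ?g x) has_integral jacobi_psi n a b y) {-1..y}"
    using has_integral_jacobi_psi[OF assms(1,2), of "-1" y n] assms psi by simp
  have 2: "((\<lambda>x. ?K x * ?g x) has_integral - jacobi_psi n a b y) {y..1}"
    using has_integral_jacobi_psi[OF assms(1,2), of y 1 n] assms psi by simp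
  have le: "\<bar>?K x * ?g x\<bar> \<le> ?H x" if "x \<in> {-1..1}" for x
  proof -
    have "x = 1 \<or> x = -1 \<or> (-1 < x \<and> x < 1)" using that by auto
    thus ?thesis
    proof (elim disjE conjE)
      assume x: "-1 < x" "x < 1"
      have "\<bar>?K x * ?g x\<bar> = \<bar>?K x\<bar> * ?g x" using jacobi_gsq_nonneg[of a b n x] assms by (simp add: abs_mult)
      also have "\<dots> \<le> ?H x"
        by (intro mult_right_mono abs_diff_weight_le jacobi_gsq_nonneg assms c x k) (use assms in auto)
      finally show ?thesis .
    qed (auto simp: jacobi_gsq_end)
  qed
  have sub: "{-1..y} \<subseteq> {-1..1}" "{y..1} \<subseteq> {-1..1}" using assms by auto
  have Hint: "?H integrable_on {-1..y}" "?H integrable_on {y..1}"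
    using integrable_on_subinterval[OF has_integral_integrable[OF H]] sub by blast+
  have "integral {-1..y} ?H + integral {y..1} ?H = integral {-1..1} ?H"
    using assms by (intro Henstock_Kurzweil_Integration.integral_combine has_integral_integrable[OF H]) auto
  hence sumH: "integral {-1..y} ?H + integral {y..1} ?H = 1 / k + k - 4 * a * b / (c * D) / k"
    using integral_unique[OF H] by simp
  have "jacobi_psi n a b y \<le> integral {-1..y} ?H"
    by (rule has_integral_le[OF 1 integrable_integral[OF Hint(1)]]) (use le sub in \<open>force simp: abs_le_iff\<close>)
  moreover have "jacobi_psi n a b y \<le> integral {y..1} ?H"
  proof -
    have "((\<lambda>x. - (?K x * ?g x)) has_integral jacobi_psi n a b y) {y..1}"
      using has_integral_neg[OF 2] by simp
    thus ?thesis
      by (rule has_integral_le[OF _ integrable_integral[OF Hint(2)]])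
        (intro order_trans[OF abs_ge_minus_self le] subsetD[OF sub(2)])
  qed
  ultimately have "2 * jacobi_psi n a b y \<le> 1 / k + k - 4 * a * b / (c * D) / k"
    using sumH by linarith
  also have "\<dots> \<le> 1 / k + k - a * b / ?q / k"
  proof -
    have "a * b / ?q = 4 * a * b / (4 * ?q)" by simp
    also have "\<dots> \<le> 4 * a * b / (c * D)"
    proof (rule divide_left_mono)
      show "c * D \<le> 4 * ?q" using c(2) by (simp only: mult.assoc)
      have "0 < 4 * ?q" "0 < c * D" using c(1) D q by (linarith, simp)
      thus "0 < 4 * ?q * (c * D)" by (rule mult_pos_pos)
    qed (use assms in simp)
    finally have "a * b / ?q / k \<le> 4 * a * b / (c * D) / k" using k by (intro divide_right_mono) auto
    thus ?thesis by simp
  qed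
  also have "\<dots> = k + k\<^sup>2 / k" unfolding k2 using k by (simp add: diff_divide_distrib)
  also have "\<dots> = 2 * k" using k by (simp add: power2_eq_square)
  finally have "jacobi_psi n a b y \<le> k" by simp
  thus ?thesis using jacobi_gsq_le_psi[OF assms(1,2), of n y] unfolding k_def by linarith
qed

section \<open>A virial inequality\<close>

text \<open>To be read with \<open>\<xi> = x - l\<close>,
  \<open>\<eta> = l + w + \<epsilon> - x\<close> and \<open>f = \<xi>^3 \<sigma>\<close>; the
  polynomials in \<open>\<sigma>\<close> are the derivatives of \<open>f\<close>, and the left side
  is \<open>R\<close>. Its main part is \<open>\<Lambda> \<xi>^3 (7 \<eta>^2 - 7 \<epsilon> \<eta> -
  \<epsilon> \<xi>) / \<eta>^(3/2)\<close>. The rest is at most \<open>q^2\<close> times a cubic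
  form in \<open>\<xi>, \<eta>\<close> over \<open>\<eta>^(3/2)\<close>. For
  \<open>\<eta> \<le> \<xi>\<close> the term \<open>- \<Lambda> \<epsilon> \<xi>^4\<close> absorbs
  it; otherwise it costs at most \<open>1/2\<close> of the final constant
  \<open>15/2 = 7 + 1/2\<close>.\<close>

lemma virial_rate_le:
  fixes x \<xi> \<eta> p q \<Lambda> \<epsilon> w \<sigma> :: real
  assumes q: "2 \<le> q" and p: "0 \<le> p" "p \<le> q * \<eta>" and x: "\<bar>x\<bar> \<le> 1" and \<xi>: "0 \<le> \<xi>" and \<eta>: "0 < \<eta>"
    and L: "\<xi> + \<eta> = w + \<epsilon>" and w: "0 < w" and \<epsilon>: "0 \<le> \<epsilon>" and K: "60 * q\<^sup>2 \<le> \<Lambda> * \<epsilon> * w" and \<Lambda>: "0 < \<Lambda>"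
    and \<sigma>: "\<sigma> = 1 / sqrt \<eta>"
  shows "1 / 2 * (p\<^sup>2 * (6 * \<sigma> + 9 * \<xi> * \<sigma> ^ 3 + 27 / 4 * \<xi>\<^sup>2 * \<sigma> ^ 5 + 15 / 8 * \<xi> ^ 3 * \<sigma> ^ 7)
       - 6 * x * p * (6 * \<xi> * \<sigma> + 3 * \<xi>\<^sup>2 * \<sigma> ^ 3 + 3 / 4 * \<xi> ^ 3 * \<sigma> ^ 5)
       + (6 * x\<^sup>2 - 2) * (3 * \<xi>\<^sup>2 * \<sigma> + 1 / 2 * \<xi> ^ 3 * \<sigma> ^ 3))
     + 2 * (\<Lambda> * (\<eta> - \<epsilon>) * \<xi>) * (3 * \<xi>\<^sup>2 * \<sigma> + 1 / 2 * \<xi> ^ 3 * \<sigma> ^ 3) + \<xi> ^ 3 * \<sigma> * (\<Lambda> * (\<eta> - \<epsilon> - \<xi>))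
    \<le> 15 / 2 * \<Lambda> * (w + \<epsilon>) ^ 3 * sqrt (w + \<epsilon>)" (is "?R \<le> _")
proof -
  define s where "s = sqrt \<eta>"
  define \<rho> where "\<rho> = p / \<eta>"
  have s: "s > 0" "\<eta> = s\<^sup>2" "\<sigma> = 1 / s" using \<eta> \<sigma> by (auto simp: s_def)
  have \<rho>: "0 \<le> \<rho>" "\<rho> \<le> q" "p = \<rho> * s\<^sup>2" using p \<eta> s(2) by (auto simp: \<rho>_def divide_simps)
  define u where "u = 3 * \<eta> ^ 3 + 9 / 2 * \<xi> * \<eta>\<^sup>2 + 27 / 8 * \<xi>\<^sup>2 * \<eta> + 15 / 16 * \<xi> ^ 3"
  define v where "v = 3 * (6 * \<xi> * \<eta>\<^sup>2 + 3 * \<xi>\<^sup>2 * \<eta> + 3 / 4 * \<xi> ^ 3)"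
  define z where "z = 3 * \<xi>\<^sup>2 * \<eta> + 1 / 2 * \<xi> ^ 3"
  have uvz: "0 \<le> u" "0 \<le> v" "0 \<le> z" unfolding u_def v_def z_def using \<xi> \<eta> by simp_all
  define B where "B = \<rho>\<^sup>2 * u - x * \<rho> * v + (3 * x\<^sup>2 - 1) * z + \<Lambda> * \<xi> ^ 3 * (7 * \<eta>\<^sup>2 - 7 * \<epsilon> * \<eta> - \<epsilon> * \<xi>)"
  have R: "?R = B / s ^ 3"
    unfolding B_def u_def v_def z_def \<rho>(3) s(2,3) using s(1)
    by (simp add: field_simps power2_eq_square eval_nat_numeral)
  have "\<rho>\<^sup>2 * u \<le> q\<^sup>2 * u" using \<rho> uvz by (intro mult_right_mono power_mono) auto
  moreover have "- x * \<rho> * v \<le> q\<^sup>2 / 2 * v"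
  proof -
    have "- x * \<rho> \<le> 1 * q" using x \<rho> q by (intro mult_mono) auto
    also have "\<dots> \<le> q\<^sup>2 / 2" using q by (simp add: power2_eq_square)
    finally show ?thesis using uvz by (intro mult_right_mono) auto
  qed
  moreover have "(3 * x\<^sup>2 - 1) * z \<le> q\<^sup>2 / 2 * z"
  proof -
    have "x\<^sup>2 \<le> 1" using x by (simp add: abs_square_le_1)
    moreover have "2\<^sup>2 \<le> q\<^sup>2" using q by (intro power_mono) auto
    ultimately show ?thesis using uvz by (intro mult_right_mono) auto
  qed
  moreover have "\<Lambda> * \<xi> ^ 3 * (7 * \<eta>\<^sup>2 - 7 * \<epsilon> * \<eta> - \<epsilon> * \<xi>) \<le> 7 * \<Lambda> * \<xi> ^ 3 * \<eta>\<^sup>2 - \<Lambda> * \<epsilon> * \<xi> ^ 4"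
  proof -
    have "0 \<le> \<Lambda> * \<xi> ^ 3 * (7 * \<epsilon> * \<eta>)" using \<Lambda> \<xi> \<epsilon> \<eta> by simp
    thus ?thesis by (simp add: algebra_simps eval_nat_numeral)
  qed
  ultimately have B1: "B \<le> q\<^sup>2 * (u + v / 2 + z / 2) + 7 * \<Lambda> * \<xi> ^ 3 * \<eta>\<^sup>2 - \<Lambda> * \<epsilon> * \<xi> ^ 4"
    unfolding B_def by (simp add: algebra_simps)
  define l where "l = w + \<epsilon>"
  have l: "0 < l" "w \<le> l" "\<epsilon> \<le> l" "\<xi> \<le> l" "\<eta> \<le> l" using L \<xi> \<eta> w \<epsilon> by (auto simp: l_def)
  have sl: "0 \<le> s" "s \<le> sqrt l" using s(1) l(5) unfolding s_def by auto
  \<comment> \<open>The four coefficients add up to 451/16 < 30. This is the source of the factor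
    \<open>60 = 2 * 30\<close> in the hypothesis on \<open>\<epsilon>\<close>.\<close>
  have uvz': "u + v / 2 + z / 2 = 3 * \<eta> ^ 3 + 27 / 2 * (\<xi> * \<eta>\<^sup>2) + 75 / 8 * (\<xi>\<^sup>2 * \<eta>) + 37 / 16 * \<xi> ^ 3"
    unfolding u_def v_def z_def by (simp add: field_simps)
  have main: "7 * \<Lambda> * \<xi> ^ 3 * \<eta>\<^sup>2 / s ^ 3 \<le> 7 * \<Lambda> * l ^ 3 * sqrt l"
  proof -
    have "7 * \<Lambda> * \<xi> ^ 3 * \<eta>\<^sup>2 / s ^ 3 = 7 * \<Lambda> * \<xi> ^ 3 * s"
      unfolding s(2) using s(1) by (simp add: field_simps eval_nat_numeral)
    also have "\<dots> \<le> 7 * \<Lambda> * l ^ 3 * sqrt l"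
      using \<Lambda> l(1,4) \<xi> sl by (intro mult_mono power_mono) auto
    finally show ?thesis .
  qed
  have "?R \<le> 15 / 2 * \<Lambda> * l ^ 3 * sqrt l"
  proof (cases "\<eta> \<le> \<xi>")
    case True
    have b: "\<eta> ^ 3 \<le> \<xi> ^ 3" "\<xi> * \<eta>\<^sup>2 \<le> \<xi> ^ 3" "\<xi>\<^sup>2 * \<eta> \<le> \<xi> ^ 3"
    proof -
      show "\<eta> ^ 3 \<le> \<xi> ^ 3" using True \<eta> by (intro power_mono) auto
      have "\<xi> * \<eta>\<^sup>2 \<le> \<xi> * \<xi>\<^sup>2" using True \<eta> \<xi> by (intro mult_left_mono power_mono) auto
      thus "\<xi> * \<eta>\<^sup>2 \<le> \<xi> ^ 3" by (simp add: eval_nat_numeral)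
      have "\<xi>\<^sup>2 * \<eta> \<le> \<xi>\<^sup>2 * \<xi>" using True \<eta> \<xi> by (intro mult_left_mono) auto
      thus "\<xi>\<^sup>2 * \<eta> \<le> \<xi> ^ 3" by (simp add: eval_nat_numeral)
    qed
    have "u + v / 2 + z / 2 \<le> 30 * \<xi> ^ 3" unfolding uvz' using b zero_le_power[OF \<xi>, of 3] by linarith
    hence "q\<^sup>2 * (u + v / 2 + z / 2) \<le> q\<^sup>2 * (30 * \<xi> ^ 3)" by (intro mult_left_mono) auto
    also have "\<dots> = (60 * q\<^sup>2) * \<xi> ^ 3 / 2" by simp
    also have "\<dots> \<le> (\<Lambda> * \<epsilon> * w) * \<xi> ^ 3 / 2" using K \<xi> by (intro divide_right_mono mult_right_mono) auto
    also have "\<dots> = \<Lambda> * \<epsilon> * \<xi> ^ 3 * (w / 2)" by simp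
    also have "\<dots> \<le> \<Lambda> * \<epsilon> * \<xi> ^ 3 * \<xi>"
      using True L \<epsilon> \<Lambda> \<xi> by (intro mult_left_mono) auto
    finally have "B \<le> 7 * \<Lambda> * \<xi> ^ 3 * \<eta>\<^sup>2" using B1 by (simp add: eval_nat_numeral mult_ac)
    hence "?R \<le> 7 * \<Lambda> * \<xi> ^ 3 * \<eta>\<^sup>2 / s ^ 3" unfolding R using s(1) by (intro divide_right_mono) auto
    also note main
    also have "7 * \<Lambda> * l ^ 3 * sqrt l \<le> 15 / 2 * \<Lambda> * l ^ 3 * sqrt l"
      using \<Lambda> l by (intro mult_right_mono) auto
    finally show ?thesis .
  next
    case False
    hence F: "\<xi> \<le> \<eta>" by simp
    have b: "\<xi> ^ 3 \<le> \<eta> ^ 3" "\<xi> * \<eta>\<^sup>2 \<le> \<eta> ^ 3" "\<xi>\<^sup>2 * \<eta> \<le> \<eta> ^ 3"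
    proof -
      show "\<xi> ^ 3 \<le> \<eta> ^ 3" using F \<xi> by (intro power_mono) auto
      have "\<xi> * \<eta>\<^sup>2 \<le> \<eta> * \<eta>\<^sup>2" using F \<eta> \<xi> by (intro mult_right_mono) auto
      thus "\<xi> * \<eta>\<^sup>2 \<le> \<eta> ^ 3" by (simp add: eval_nat_numeral)
      have "\<xi>\<^sup>2 * \<eta> \<le> \<eta>\<^sup>2 * \<eta>" using F \<eta> \<xi> by (intro mult_right_mono power_mono) auto
      thus "\<xi>\<^sup>2 * \<eta> \<le> \<eta> ^ 3" by (simp add: eval_nat_numeral)
    qed
    have "u + v / 2 + z / 2 \<le> 30 * \<eta> ^ 3" unfolding uvz' using b zero_le_power[of \<eta> 3] \<eta> by linarith
    hence "q\<^sup>2 * (u + v / 2 + z / 2) \<le> q\<^sup>2 * (30 * \<eta> ^ 3)" by (intro mult_left_mono) auto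
    also have "\<dots> = (60 * q\<^sup>2) * \<eta> ^ 3 / 2" by simp
    also have "\<dots> \<le> (\<Lambda> * \<epsilon> * w) * \<eta> ^ 3 / 2" using K \<eta> by (intro divide_right_mono mult_right_mono) auto
    finally have "B \<le> \<Lambda> * \<epsilon> * w * \<eta> ^ 3 / 2 + 7 * \<Lambda> * \<xi> ^ 3 * \<eta>\<^sup>2"
    proof -
      assume "q\<^sup>2 * (u + v / 2 + z / 2) \<le> \<Lambda> * \<epsilon> * w * \<eta> ^ 3 / 2"
      moreover have "0 \<le> \<Lambda> * \<epsilon> * \<xi> ^ 4" using \<Lambda> \<epsilon> by simp
      ultimately show ?thesis using B1 by linarith
    qed
    hence "?R \<le> (\<Lambda> * \<epsilon> * w * \<eta> ^ 3 / 2 + 7 * \<Lambda> * \<xi> ^ 3 * \<eta>\<^sup>2) / s ^ 3" unfolding R using s(1) by (intro divide_right_mono) auto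
    also have "\<dots> = \<Lambda> * \<epsilon> * w * \<eta> * s / 2 + 7 * \<Lambda> * \<xi> ^ 3 * \<eta>\<^sup>2 / s ^ 3"
    proof -
      have "\<Lambda> * \<epsilon> * w * \<eta> ^ 3 / 2 / s ^ 3 = \<Lambda> * \<epsilon> * w * \<eta> * s / 2"
        unfolding s(2) using s(1) by (simp add: field_simps eval_nat_numeral)
      thus ?thesis by (simp add: add_divide_distrib)
    qed
    also have "\<Lambda> * \<epsilon> * w * \<eta> * s / 2 \<le> \<Lambda> * l * l * l * sqrt l / 2"
      using \<Lambda> l \<epsilon> w \<eta> sl by (intro divide_right_mono mult_mono) auto
    also have "\<Lambda> * l * l * l * sqrt l / 2 = 1 / 2 * \<Lambda> * l ^ 3 * sqrt l" by (simp add: eval_nat_numeral)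
    also note main
    finally show ?thesis by (simp add: algebra_simps)
  qed
  thus ?thesis unfolding l_def .
qed

lemma cube_mono_imp: "a ^ 3 \<le> b ^ 3 \<Longrightarrow> 0 \<le> b \<Longrightarrow> a \<le> b" for a b :: real
  by (rule power_le_imp_le_base[of a 2]) (auto simp: eval_nat_numeral)

text \<open>Completing the square in \<open>h\<close> leaves \<open>W g^2\<close>. Where
  \<open>2 \<epsilon> \<le> \<eta>\<close>, the term \<open>\<Phi>\<close> is at least
  \<open>\<Lambda> \<eta> \<xi> / 2\<close> and dominates the term linear in
  \<open>m = p / \<eta>\<close>. Closer to the turning point \<open>\<Phi>\<close> may be as low as
  \<open>- 1/2\<close>; there \<open>m\<close> is large and the positive term in \<open>m^2\<close>,
  which stems from \<open>f''\<close>, takes over.\<close>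

lemma virial_form_ge:
  fixes x \<xi> \<eta> p \<Lambda> \<epsilon> w \<sigma> \<Phi> g h :: real
  assumes p: "0 < p" and x: "\<bar>x\<bar> \<le> 1" and \<eta>: "0 < \<eta>" "\<epsilon> / 2 \<le> \<eta>" "\<eta> \<le> w / 2 + \<epsilon>"
    and \<xi>: "w / 2 \<le> \<xi>" and w: "0 < w" and \<epsilon>: "0 < \<epsilon>" and \<Lambda>: "0 < \<Lambda>"
    and \<epsilon>_def: "\<epsilon> ^ 3 * \<Lambda> * w = 240 * p\<^sup>2" and big: "10 ^ 6 \<le> p * \<Lambda> * w"
    and K: "60 * (max 2 (p / \<eta>))\<^sup>2 \<le> \<Lambda> * \<epsilon> * w"
    and \<Phi>: "\<Phi> = \<Lambda> * (\<eta> - \<epsilon>) * \<xi>" "- 1 / 2 \<le> \<Phi>"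
    and \<sigma>: "\<sigma> = 1 / sqrt \<eta>"
  shows "\<Lambda> * w * \<xi> ^ 3 * sqrt \<eta> / 15360 * g\<^sup>2
    \<le> \<xi> ^ 3 * \<sigma> * (h\<^sup>2 + \<Phi> * g\<^sup>2) - p * (3 * \<xi>\<^sup>2 * \<sigma> + 1 / 2 * \<xi> ^ 3 * \<sigma> ^ 3) * g * h
       + 1 / 2 * p * (p * (6 * \<xi> * \<sigma> + 3 * \<xi>\<^sup>2 * \<sigma> ^ 3 + 3 / 4 * \<xi> ^ 3 * \<sigma> ^ 5)
         - 2 * x * (3 * \<xi>\<^sup>2 * \<sigma> + 1 / 2 * \<xi> ^ 3 * \<sigma> ^ 3)) * g\<^sup>2" (is "_ \<le> ?Q")
proof -
  define m where "m = p / \<eta>"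
  define \<rho> where "\<rho> = \<eta> / \<xi>"
  define s where "s = sqrt \<eta>"
  have s: "s > 0" "\<eta> = s\<^sup>2" "\<sigma> = 1 / s" using \<eta> \<sigma> by (auto simp: s_def)
  have \<xi>0: "\<xi> > 0" using \<xi> w by linarith
  have m: "m > 0" "p = m * \<eta>" and \<rho>: "\<rho> > 0" "\<eta> = \<rho> * \<xi>" using p \<eta> \<xi>0 by (auto simp: m_def \<rho>_def)
  define W where "W = \<Phi> + m\<^sup>2 * (3 / 4 * \<rho>\<^sup>2 + 3 / 4 * \<rho> + 5 / 16) - x * m * (3 * \<rho> + 1 / 2)"
  have Q: "?Q = \<xi> ^ 3 * \<sigma> * ((h - m * (3 * \<rho> + 1 / 2) * g / 2)\<^sup>2 + W * g\<^sup>2)"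
  proof -
    have \<sigma>2: "\<sigma>\<^sup>2 * \<eta> = 1" using s by (simp add: field_simps power2_eq_square)
    have r: "\<rho> * \<xi> = \<eta>" using \<rho> by simp
    have f1: "p * (3 * \<xi>\<^sup>2 * \<sigma> + 1 / 2 * \<xi> ^ 3 * \<sigma> ^ 3) = \<xi> ^ 3 * \<sigma> * (m * (3 * \<rho> + 1 / 2))"
    proof -
      have "p * (3 * \<xi>\<^sup>2 * \<sigma> + 1 / 2 * \<xi> ^ 3 * \<sigma> ^ 3) = m * (3 * \<xi>\<^sup>2 * \<sigma> * \<eta> + 1 / 2 * \<xi> ^ 3 * \<sigma> * (\<sigma>\<^sup>2 * \<eta>))"
        unfolding m(2) by (simp add: algebra_simps eval_nat_numeral)
      also have "\<dots> = m * (3 * \<xi>\<^sup>2 * \<sigma> * (\<rho> * \<xi>) + 1 / 2 * \<xi> ^ 3 * \<sigma>)" unfolding \<sigma>2 r by simp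
      finally show ?thesis by (simp add: algebra_simps eval_nat_numeral)
    qed
    have f2: "p\<^sup>2 * (6 * \<xi> * \<sigma> + 3 * \<xi>\<^sup>2 * \<sigma> ^ 3 + 3 / 4 * \<xi> ^ 3 * \<sigma> ^ 5) = \<xi> ^ 3 * \<sigma> * (m\<^sup>2 * (6 * \<rho>\<^sup>2 + 3 * \<rho> + 3 / 4))"
    proof -
      have "p\<^sup>2 * (6 * \<xi> * \<sigma> + 3 * \<xi>\<^sup>2 * \<sigma> ^ 3 + 3 / 4 * \<xi> ^ 3 * \<sigma> ^ 5)
        = m\<^sup>2 * (6 * \<xi> * \<sigma> * \<eta>\<^sup>2 + 3 * \<xi>\<^sup>2 * \<sigma> * \<eta> * (\<sigma>\<^sup>2 * \<eta>) + 3 / 4 * \<xi> ^ 3 * \<sigma> * (\<sigma>\<^sup>2 * \<eta>)\<^sup>2)"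
        unfolding m(2) by (simp add: algebra_simps eval_nat_numeral)
      also have "\<dots> = m\<^sup>2 * (6 * \<xi> * \<sigma> * (\<rho> * \<xi>)\<^sup>2 + 3 * \<xi>\<^sup>2 * \<sigma> * (\<rho> * \<xi>) + 3 / 4 * \<xi> ^ 3 * \<sigma>)" unfolding \<sigma>2 r by simp
      finally show ?thesis by (simp add: algebra_simps eval_nat_numeral)
    qed
    have "?Q = \<xi> ^ 3 * \<sigma> * (h\<^sup>2 + \<Phi> * g\<^sup>2) - (p * (3 * \<xi>\<^sup>2 * \<sigma> + 1 / 2 * \<xi> ^ 3 * \<sigma> ^ 3)) * g * h
       + 1 / 2 * (p\<^sup>2 * (6 * \<xi> * \<sigma> + 3 * \<xi>\<^sup>2 * \<sigma> ^ 3 + 3 / 4 * \<xi> ^ 3 * \<sigma> ^ 5)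
         - 2 * x * (p * (3 * \<xi>\<^sup>2 * \<sigma> + 1 / 2 * \<xi> ^ 3 * \<sigma> ^ 3))) * g\<^sup>2"
      by (simp add: algebra_simps power2_eq_square)
    also have "\<dots> = \<xi> ^ 3 * \<sigma> * ((h - m * (3 * \<rho> + 1 / 2) * g / 2)\<^sup>2 + W * g\<^sup>2)"
      unfolding f1 f2 W_def by (simp add: field_simps power2_eq_square)
    finally show ?thesis .
  qed
  have W: "\<Lambda> * \<eta> * w / 15360 \<le> W"
  proof (cases "2 * \<epsilon> \<le> \<eta>")
    case True
    define q where "q = max 2 m"
    have q: "2 \<le> q" "m \<le> q" "60 * q\<^sup>2 \<le> \<Lambda> * \<epsilon> * w" using K by (auto simp: q_def m_def)
    have "x * m \<le> 1 * q" using x q m by (intro mult_mono) auto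
    also have "\<dots> \<le> q\<^sup>2 / 2" using q by (simp add: power2_eq_square)
    also have "\<dots> \<le> \<Lambda> * \<epsilon> * w / 120" using q by simp
    finally have "x * m * (3 * \<rho> + 1 / 2) \<le> \<Lambda> * \<epsilon> * w / 120 * (3 * \<rho> + 1 / 2)"
      using \<rho> by (intro mult_right_mono) auto
    also have "\<Lambda> * \<epsilon> * w / 120 * (3 * \<rho> + 1 / 2) = \<Lambda> * (3 * \<epsilon> * (\<rho> * w) + \<epsilon> * w / 2) / 120"
      by (simp add: field_simps)
    also have "\<dots> \<le> \<Lambda> * (7 * (\<eta> * \<xi>)) / 120"
    proof -
      have \<eta>w: "\<eta> \<le> w" using True \<eta> by linarith
      have "\<rho> * w \<le> \<rho> * (2 * \<xi>)" using \<rho> \<xi> by (intro mult_left_mono) auto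
      also have "\<dots> = 2 * \<eta>" using \<rho> by simp
      finally have "3 * \<epsilon> * (\<rho> * w) \<le> 3 * \<epsilon> * (2 * \<eta>)" using \<epsilon> by (intro mult_left_mono) auto
      also have "\<dots> = (6 * \<epsilon>) * \<eta>" by simp
      also have "\<dots> \<le> (6 * \<xi>) * \<eta>" using True \<eta>w \<xi> \<eta> by (intro mult_right_mono) auto
      finally have "3 * \<epsilon> * (\<rho> * w) \<le> 6 * (\<eta> * \<xi>)" by simp
      moreover have "\<epsilon> * w \<le> (\<eta> / 2) * (2 * \<xi>)" using True \<xi> \<epsilon> w by (intro mult_mono) auto
      ultimately have "3 * \<epsilon> * (\<rho> * w) + \<epsilon> * w / 2 \<le> 7 * (\<eta> * \<xi>)" 
        using mult_pos_pos[OF \<eta>(1) \<xi>0] by simp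
      thus ?thesis using \<Lambda> by (intro divide_right_mono mult_left_mono) auto
    qed
    finally have 1: "x * m * (3 * \<rho> + 1 / 2) \<le> 7 / 120 * (\<Lambda> * (\<eta> * \<xi>))" by simp
    have 2: "\<Phi> \<ge> 1 / 2 * (\<Lambda> * (\<eta> * \<xi>))"
    proof -
      have "\<Lambda> * (\<eta> / 2) * \<xi> \<le> \<Lambda> * (\<eta> - \<epsilon>) * \<xi>" using True \<Lambda> \<xi>0 by (intro mult_right_mono mult_left_mono) auto
      thus ?thesis unfolding \<Phi> by simp
    qed
    have 3: "0 \<le> m\<^sup>2 * (3 / 4 * \<rho>\<^sup>2 + 3 / 4 * \<rho> + 5 / 16)" using \<rho> by simp
    have "\<Lambda> * \<eta> * w \<le> \<Lambda> * \<eta> * (2 * \<xi>)" using \<Lambda> \<eta> \<xi> by (intro mult_left_mono) auto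
    hence "\<Lambda> * \<eta> * w \<le> 2 * (\<Lambda> * (\<eta> * \<xi>))" by simp
    moreover have "0 < \<Lambda> * (\<eta> * \<xi>)" using \<Lambda> \<eta> \<xi>0 by simp
    ultimately show ?thesis unfolding W_def using 1 2 3 by linarith
  next
    case False
    \<comment> \<open>\<open>(10 \<epsilon>)^3 \<Lambda> w = 240000 p^2\<close>, and
      \<open>p \<Lambda> w\<close> exceeds 240000. With \<open>\<eta> < 2 \<epsilon>\<close> this
      gives \<open>m \<ge> 5\<close>, so the linear term costs at most a fifth of \<open>m^2\<close>
      per unit of its factor and leaves the coefficient \<open>5/16 - 1/10 = 17/80\<close>.\<close>
    have "10 * \<epsilon> \<le> p"
    proof (rule cube_mono_imp)
      have "240 * 1000 * p\<^sup>2 \<le> (p * \<Lambda> * w) * p\<^sup>2" using big by (intro mult_right_mono) auto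
      also have "\<dots> = (\<Lambda> * w) * p ^ 3" by (simp add: eval_nat_numeral)
      finally have "1000 * (\<epsilon> ^ 3 * \<Lambda> * w) \<le> (\<Lambda> * w) * p ^ 3"
        unfolding \<epsilon>_def by simp
      moreover have "1000 * (\<epsilon> ^ 3 * \<Lambda> * w) = (\<Lambda> * w) * (10 * \<epsilon>) ^ 3"
        by (simp add: power_mult_distrib)
      ultimately have "(\<Lambda> * w) * (10 * \<epsilon>) ^ 3 \<le> (\<Lambda> * w) * p ^ 3" by (simp only:)
      moreover have "0 < \<Lambda> * w" using \<Lambda> w by simp
      ultimately show "(10 * \<epsilon>) ^ 3 \<le> p ^ 3" by (simp only: mult_le_cancel_left_pos)
    qed (use p in simp)
    hence m5: "5 \<le> m" using False \<eta> by (simp add: m_def divide_simps)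
    have "x * m * (3 * \<rho> + 1 / 2) \<le> m\<^sup>2 / 5 * (3 * \<rho> + 1 / 2)"
    proof (rule mult_right_mono)
      have "x * m \<le> 1 * m" using x m by (intro mult_right_mono) auto
      also have "\<dots> \<le> m\<^sup>2 / 5" using m5 by (simp add: power2_eq_square)
      finally show "x * m \<le> m\<^sup>2 / 5" .
    qed (use \<rho> in simp)
    hence "W \<ge> \<Phi> + m\<^sup>2 * (3 / 4 * \<rho>\<^sup>2 + 3 / 4 * \<rho> + 5 / 16) - m\<^sup>2 / 5 * (3 * \<rho> + 1 / 2)" unfolding W_def by simp
    also have "\<Phi> + m\<^sup>2 * (3 / 4 * \<rho>\<^sup>2 + 3 / 4 * \<rho> + 5 / 16) - m\<^sup>2 / 5 * (3 * \<rho> + 1 / 2)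
      = \<Phi> + m\<^sup>2 * (3 / 4 * \<rho>\<^sup>2 + 3 / 20 * \<rho>) + 17 / 80 * m\<^sup>2" by (simp add: field_simps)
    finally have "W \<ge> \<Phi> + m\<^sup>2 * (3 / 4 * \<rho>\<^sup>2 + 3 / 20 * \<rho>) + 17 / 80 * m\<^sup>2" .
    moreover have "0 \<le> m\<^sup>2 * (3 / 4 * \<rho>\<^sup>2 + 3 / 20 * \<rho>)" using \<rho> by simp
    ultimately have "W \<ge> - 1 / 2 + 17 / 80 * m\<^sup>2" using \<Phi>(2) by linarith
    moreover have "5\<^sup>2 \<le> m\<^sup>2" using m5 by (intro power_mono) auto
    ultimately have W8: "W \<ge> m\<^sup>2 / 8" by simp
    \<comment> \<open>Here the denominator \<open>15360 = 8 * (8 * 240)\<close> arises: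
      \<open>8\<close> from \<open>W \<ge> m^2 / 8\<close>, \<open>8\<close> from
      \<open>\<eta> \<le> 2 \<epsilon>\<close>, and \<open>240\<close> from the choice of
      \<open>\<epsilon>\<close>.\<close>
    have "\<eta> ^ 3 \<le> (2 * \<epsilon>) ^ 3" using False \<eta> by (intro power_mono) auto
    hence "\<eta> ^ 3 * (\<Lambda> * w) \<le> 8 * \<epsilon> ^ 3 * (\<Lambda> * w)" using \<Lambda> w by (intro mult_right_mono) (auto simp: power_mult_distrib)
    also have "\<dots> = 8 * (\<epsilon> ^ 3 * \<Lambda> * w)" by simp
    also have "\<dots> = 1920 * p\<^sup>2" unfolding \<epsilon>_def by simp
    also have "\<dots> = 1920 * m\<^sup>2 * \<eta>\<^sup>2" unfolding m(2) by (simp add: power_mult_distrib)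
    finally have "(\<Lambda> * \<eta> * w) * \<eta>\<^sup>2 \<le> (1920 * m\<^sup>2) * \<eta>\<^sup>2" by (simp add: eval_nat_numeral mult_ac)
    moreover have "0 < \<eta>\<^sup>2" using \<eta> by simp
    ultimately have "\<Lambda> * \<eta> * w \<le> 1920 * m\<^sup>2" by (simp only: mult_le_cancel_right_pos)
    thus ?thesis using W8 by simp
  qed
  have F: "0 \<le> \<xi> ^ 3 * \<sigma>" using \<xi>0 s by simp
  have "\<Lambda> * w * \<xi> ^ 3 * sqrt \<eta> / 15360 * g\<^sup>2 = \<xi> ^ 3 * \<sigma> * (\<Lambda> * \<eta> * w / 15360 * g\<^sup>2)"
    unfolding s(2,3) using s(1) by (simp add: field_simps power2_eq_square)
  also have "\<dots> \<le> \<xi> ^ 3 * \<sigma> * ((h - m * (3 * \<rho> + 1 / 2) * g / 2)\<^sup>2 + W * g\<^sup>2)"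
    using mult_right_mono[OF W, of "g\<^sup>2"] F by (intro mult_left_mono add_increasing) auto
  finally show ?thesis unfolding Q .
qed

text \<open>The two correction terms are chosen for cancellation: \<open>- p f' g h\<close> removes
  \<open>f' h^2\<close>, and half of \<open>p (p f')' g^2\<close> removes the product
  \<open>g h\<close> which that creates. Only a multiple of \<open>g^2\<close>, whose integral is
  known, survives.\<close>

lemma DERIV_virial_form:
  fixes f f1 f2 g h \<Phi> :: "real \<Rightarrow> real"
  assumes "(f has_real_derivative f1 x) (at x)" "(f1 has_real_derivative f2 x) (at x)"
    and "(f2 has_real_derivative f3) (at x)" "(\<Phi> has_real_derivative d) (at x)"
    and "(g has_real_derivative h x / (1 - x\<^sup>2)) (at x)" "(h has_real_derivative - (\<Phi> x / (1 - x\<^sup>2)) * g x) (at x)"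
    and "-1 < x" "x < 1"
  shows "((\<lambda>x. f x * ((h x)\<^sup>2 + \<Phi> x * (g x)\<^sup>2) - (1 - x\<^sup>2) * f1 x * g x * h x
       + 1 / 2 * (1 - x\<^sup>2) * ((1 - x\<^sup>2) * f2 x - 2 * x * f1 x) * (g x)\<^sup>2) has_real_derivative
     (1 / 2 * ((1 - x\<^sup>2)\<^sup>2 * f3 - 6 * x * (1 - x\<^sup>2) * f2 x + (6 * x\<^sup>2 - 2) * f1 x)
       + 2 * \<Phi> x * f1 x + f x * d) * (g x)\<^sup>2) (at x)"
proof -
  have q: "1 - x\<^sup>2 \<noteq> 0"
  proof -
    have "1 - x\<^sup>2 = (1 - x) * (1 + x)" by (simp add: power2_eq_square algebra_simps)
    thus ?thesis using assms by simp
  qed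
  define g' where "g' = h x / (1 - x\<^sup>2)"
  define h' where "h' = - (\<Phi> x / (1 - x\<^sup>2)) * g x"
  have D: "(f has_real_derivative f1 x) (at x)" "(f1 has_real_derivative f2 x) (at x)"
    "(f2 has_real_derivative f3) (at x)" "(\<Phi> has_real_derivative d) (at x)"
    "(g has_real_derivative g') (at x)" "(h has_real_derivative h') (at x)"
    "((\<lambda>x. 1 - x\<^sup>2) has_real_derivative - 2 * x) (at x)" "((\<lambda>x. x) has_real_derivative 1) (at x)"
    using assms by (auto simp: g'_def h'_def intro!: derivative_eq_intros)
  have k: "(1 - x\<^sup>2) * g' = h x" "(1 - x\<^sup>2) * h' = - \<Phi> x * g x" using q by (simp_all add: g'_def h'_def)
  have 1: "((\<lambda>x. f x * (h x * h x + \<Phi> x * (g x * g x)) - (1 - x\<^sup>2) * f1 x * (g x * h x)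
       + 1 / 2 * ((1 - x\<^sup>2) * ((1 - x\<^sup>2) * f2 x - 2 * (x * f1 x)) * (g x * g x))) has_real_derivative
     (f1 x * (h x * h x + \<Phi> x * (g x * g x)) + ((h' * h x + h' * h x) + (d * (g x * g x) + (g' * g x + g' * g x) * \<Phi> x)) * f x)
      - ((- 2 * x * f1 x + f2 x * (1 - x\<^sup>2)) * (g x * h x) + (g' * h x + h' * g x) * ((1 - x\<^sup>2) * f1 x))
      + 1 / 2 * ((- 2 * x * ((1 - x\<^sup>2) * f2 x - 2 * (x * f1 x))
            + ((- 2 * x * f2 x + f3 * (1 - x\<^sup>2)) - 2 * (1 * f1 x + f2 x * x)) * (1 - x\<^sup>2)) * (g x * g x)
          + (g' * g x + g' * g x) * ((1 - x\<^sup>2) * ((1 - x\<^sup>2) * f2 x - 2 * (x * f1 x))))) (at x)"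
    by (intro DERIV_add DERIV_diff DERIV_mult DERIV_cmult D)
  have alg: "(F1 * (H * H + P * (G * G)) + ((h' * H + h' * H) + (d * (G * G) + (g' * G + g' * G) * P)) * F)
      - ((- 2 * x * F1 + F2 * q) * (G * H) + (g' * H + h' * G) * (q * F1))
      + 1 / 2 * ((- 2 * x * (q * F2 - 2 * (x * F1))
            + ((- 2 * x * F2 + f3 * q) - 2 * (1 * F1 + F2 * x)) * q) * (G * G)
          + (g' * G + g' * G) * (q * (q * F2 - 2 * (x * F1))))
    = (1 / 2 * (q\<^sup>2 * f3 - 6 * x * q * F2 + (4 * x\<^sup>2 - 2 * q) * F1) + 2 * P * F1 + F * d) * G\<^sup>2"
    if "H = q * g'" "q * h' = - P * G" for F F1 F2 H P G q :: real
  proof -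
    have h'1: "h' * H = - P * G * g'" unfolding that(1) using that(2) by (metis mult.assoc mult.commute)
    have h'2: "h' * G * (q * F1) = - P * G * G * F1" using that(2) by (metis mult.assoc mult.commute)
    have "(F1 * (H * H + P * (G * G)) + ((h' * H + h' * H) + (d * (G * G) + (g' * G + g' * G) * P)) * F)
      - ((- 2 * x * F1 + F2 * q) * (G * H) + (g' * H + h' * G) * (q * F1))
      + 1 / 2 * ((- 2 * x * (q * F2 - 2 * (x * F1))
            + ((- 2 * x * F2 + f3 * q) - 2 * (1 * F1 + F2 * x)) * q) * (G * G)
          + (g' * G + g' * G) * (q * (q * F2 - 2 * (x * F1))))
     = (F1 * (H * H + P * (G * G)) + ((- P * G * g' + - P * G * g') + (d * (G * G) + (g' * G + g' * G) * P)) * F)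
      - ((- 2 * x * F1 + F2 * q) * (G * H) + g' * H * (q * F1) + - P * G * G * F1)
      + 1 / 2 * ((- 2 * x * (q * F2 - 2 * (x * F1))
            + ((- 2 * x * F2 + f3 * q) - 2 * (1 * F1 + F2 * x)) * q) * (G * G)
          + (g' * G + g' * G) * (q * (q * F2 - 2 * (x * F1))))"
      unfolding h'1[symmetric] h'2[symmetric] by (simp add: algebra_simps)
    also have "\<dots> = (1 / 2 * (q\<^sup>2 * f3 - 6 * x * q * F2 + (4 * x\<^sup>2 - 2 * q) * F1) + 2 * P * F1 + F * d) * G\<^sup>2"
      unfolding that(1) by (simp add: field_simps power2_eq_square)
    finally show ?thesis .
  qed
  have e: "6 * x\<^sup>2 - 2 = 4 * x\<^sup>2 - 2 * (1 - x\<^sup>2)" by simp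
  have f: "(\<lambda>x. f x * (h x * h x + \<Phi> x * (g x * g x)) - (1 - x\<^sup>2) * f1 x * (g x * h x)
       + 1 / 2 * ((1 - x\<^sup>2) * ((1 - x\<^sup>2) * f2 x - 2 * (x * f1 x)) * (g x * g x)))
    = (\<lambda>x. f x * ((h x)\<^sup>2 + \<Phi> x * (g x)\<^sup>2) - (1 - x\<^sup>2) * f1 x * g x * h x
       + 1 / 2 * (1 - x\<^sup>2) * ((1 - x\<^sup>2) * f2 x - 2 * x * f1 x) * (g x)\<^sup>2)"
    by (rule ext) (simp only: power2_eq_square mult.assoc)
  show ?thesis using 1 unfolding alg[OF k(1)[symmetric] k(2)] f e .
qed

text \<open>For \<open>c < 1\<close> both \<open>1 + x\<close> and \<open>(1 - x) / (c - x)\<close>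
  increase with \<open>x\<close>, so the quotient is largest at \<open>y\<close>. For
  \<open>c \<ge> 1\<close> it is at most \<open>1 + x\<close>, hence at most 2.\<close>

lemma one_minus_sq_ratio:
  fixes x y c :: real
  assumes "-1 \<le> x" "x \<le> y" "y < 1" "y < c"
  shows "1 - x\<^sup>2 \<le> max 2 ((1 - y\<^sup>2) / (c - y)) * (c - x)"
proof (cases "c \<ge> 1")
  case True
  have "1 - x\<^sup>2 = (1 + x) * (1 - x)" by (simp add: power2_eq_square algebra_simps)
  also have "\<dots> \<le> 2 * (c - x)" using assms True by (intro mult_mono) auto
  also have "\<dots> \<le> max 2 ((1 - y\<^sup>2) / (c - y)) * (c - x)" using assms by (intro mult_right_mono) auto
  finally show ?thesis .
next
  case False
  have "(1 - x\<^sup>2) * (c - y) = (1 + x) * ((1 - x) * (c - y))" by (simp add: power2_eq_square algebra_simps)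
  also have "\<dots> \<le> (1 + x) * ((1 - y) * (c - x))"
  proof (rule mult_left_mono)
    have "0 \<le> (y - x) * (1 - c)" using assms False by simp
    thus "(1 - x) * (c - y) \<le> (1 - y) * (c - x)" by (simp add: algebra_simps)
  qed (use assms in simp)
  also have "\<dots> \<le> (1 + y) * ((1 - y) * (c - x))" using assms by (intro mult_right_mono) auto
  also have "\<dots> = (1 - y\<^sup>2) * (c - x)" by (simp add: power2_eq_square algebra_simps)
  finally have "1 - x\<^sup>2 \<le> (1 - y\<^sup>2) / (c - y) * (c - x)" using assms by (simp add: pos_le_divide_eq)
  also have "\<dots> \<le> max 2 ((1 - y\<^sup>2) / (c - y)) * (c - x)" using assms by (intro mult_right_mono) auto
  finally show ?thesis .
qed

lemma DERIV_virial_multiplier: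
  fixes c l x :: real
  assumes "x < c"
  defines "\<sigma> \<equiv> \<lambda>x. 1 / sqrt (c - x)"
  shows "((\<lambda>x. (x - l) ^ 3 * \<sigma> x) has_real_derivative
      3 * (x - l)\<^sup>2 * \<sigma> x + 1 / 2 * (x - l) ^ 3 * \<sigma> x ^ 3) (at x)" (is ?A)
    and "((\<lambda>x. 3 * (x - l)\<^sup>2 * \<sigma> x + 1 / 2 * (x - l) ^ 3 * \<sigma> x ^ 3) has_real_derivative
      6 * (x - l) * \<sigma> x + 3 * (x - l)\<^sup>2 * \<sigma> x ^ 3 + 3 / 4 * (x - l) ^ 3 * \<sigma> x ^ 5) (at x)" (is ?B)
    and "((\<lambda>x. 6 * (x - l) * \<sigma> x + 3 * (x - l)\<^sup>2 * \<sigma> x ^ 3 + 3 / 4 * (x - l) ^ 3 * \<sigma> x ^ 5) has_real_derivative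
      6 * \<sigma> x + 9 * (x - l) * \<sigma> x ^ 3 + 27 / 4 * (x - l)\<^sup>2 * \<sigma> x ^ 5 + 15 / 8 * (x - l) ^ 3 * \<sigma> x ^ 7) (at x)" (is ?C)
proof -
  have s: "sqrt (c - x) > 0" using assms by simp
  have "(\<sigma> has_real_derivative 1 / 2 * \<sigma> x ^ 3) (at x)"
  proof -
    have "((\<lambda>x. inverse (sqrt (c - x))) has_real_derivative
       - (inverse (sqrt (c - x)) * (- 1 * (inverse (sqrt (c - x)) / 2)) * inverse (sqrt (c - x)))) (at x)"
      using assms by (auto intro!: derivative_eq_intros)
    thus ?thesis unfolding \<sigma>_def by (simp add: inverse_eq_divide eval_nat_numeral mult_ac)
  qed
  note [derivative_intros] = this
  show ?A ?B ?C
    by (auto intro!: derivative_eq_intros simp: eval_nat_numeral field_simps)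
qed

text \<open>The shift \<open>\<epsilon>\<close> of the right turning point \<open>l + w\<close> produces in \<open>R\<close> a negative term
  \<open>- \<Lambda> \<epsilon> f (x - l) / (l + w + \<epsilon> - x)\<close>, which absorbs the third derivative of \<open>f\<close>.\<close>

lemma virial_bound:
  fixes g h :: "real \<Rightarrow> real"
  assumes l: "-1 < l" and w: "0 < w" and \<Lambda>: "0 < \<Lambda>"
    and dg: "\<And>x. -1 < x \<Longrightarrow> x < 1 \<Longrightarrow> (g has_real_derivative h x / (1 - x\<^sup>2)) (at x)"
    and dh: "\<And>x. -1 < x \<Longrightarrow> x < 1 \<Longrightarrow> (h has_real_derivative - (\<Lambda> * (l + w - x) * (x - l) / (1 - x\<^sup>2)) * g x) (at x)"
    and I: "((\<lambda>x. (g x)\<^sup>2) has_integral I) {-1..1}"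
    and y: "l + w / 2 \<le> y" "y < 1" "- 1 / 2 \<le> \<Lambda> * (l + w - y) * (y - l)"
    and \<epsilon>: "0 < \<epsilon>" "\<epsilon> ^ 3 * \<Lambda> * w = 240 * (1 - y\<^sup>2)\<^sup>2" "\<epsilon> \<le> 9 * w"
    and big: "10 ^ 6 \<le> (1 - y\<^sup>2) * \<Lambda> * w"
  defines "\<eta> \<equiv> l + w + \<epsilon> - y"
  shows "\<epsilon> / 2 \<le> \<eta>" "(g y)\<^sup>2 * sqrt (w * \<eta>) \<le> 2920000000 * I"
proof -
  define p where "p = 1 - y\<^sup>2"
  have ly: "l < y" using y w by linarith
  have p: "0 < p"
  proof -
    have "p = (1 - y) * (1 + y)" by (simp add: p_def power2_eq_square algebra_simps)
    thus ?thesis using y ly l by simp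
  qed
  have \<Lambda>w: "0 < \<Lambda> * w" using \<Lambda> w by simp
  have e1: "1000 \<le> \<epsilon> * \<Lambda> * w"
  proof (rule cube_mono_imp)
    have "(10 ^ 6)\<^sup>2 \<le> (p * \<Lambda> * w)\<^sup>2" using big by (intro power_mono) (auto simp: p_def)
    hence "1000 ^ 3 \<le> 240 * (p * \<Lambda> * w)\<^sup>2" by (rule order_trans[rotated, OF mult_left_mono]) auto
    also have "\<dots> = 240 * p\<^sup>2 * (\<Lambda> * w)\<^sup>2" by (simp add: power_mult_distrib)
    also have "\<dots> = (\<epsilon> * \<Lambda> * w) ^ 3" unfolding p_def \<epsilon>(2)[symmetric] by (simp add: eval_nat_numeral)
    finally show "1000 ^ 3 \<le> (\<epsilon> * \<Lambda> * w) ^ 3" .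
  qed (use \<epsilon> \<Lambda>w in \<open>simp add: mult.assoc\<close>)
  show \<eta>\<epsilon>: "\<epsilon> / 2 \<le> \<eta>"
  proof (cases "y \<le> l + w")
    case True
    thus ?thesis using \<epsilon> by (simp add: \<eta>_def)
  next
    case False
    hence F: "0 < y - (l + w)" by simp
    \<comment> \<open>Beyond the turning point the lower bound on the potential limits the overshoot
      to \<open>1 / (2 \<Lambda> w)\<close>, which is below \<open>\<epsilon> / 2\<close>.\<close>
    have "(\<Lambda> * w) * (y - (l + w)) \<le> \<Lambda> * (y - l) * (y - (l + w))"
      using False \<Lambda> by (intro mult_right_mono mult_left_mono) auto
    also have "\<dots> \<le> 1 / 2" using y(3) by (simp add: algebra_simps)
    also have "\<dots> \<le> (\<Lambda> * w) * (\<epsilon> / 2)" using e1 by (simp add: mult_ac)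
    finally have "y - (l + w) \<le> \<epsilon> / 2" using \<Lambda>w by (simp only: mult_le_cancel_left_pos)
    thus ?thesis by (simp add: \<eta>_def)
  qed
  hence \<eta>0: "0 < \<eta>" using \<epsilon> by linarith
  define q where "q = max 2 (p / \<eta>)"
  \<comment> \<open>The constant \<open>240 = 60 * 2^2\<close> is made for this:
    \<open>\<eta> \<ge> \<epsilon> / 2\<close> gives
    \<open>p / \<eta> \<le> 2 p / \<epsilon>\<close>, and the square of the latter times 60 is
    exactly \<open>\<Lambda> \<epsilon> w\<close>.\<close>
  have K: "60 * q\<^sup>2 \<le> \<Lambda> * \<epsilon> * w"
  proof (cases "p / \<eta> \<le> 2")
    case True
    hence "q = 2" by (simp add: q_def)
    thus ?thesis using e1 by (simp add: mult_ac)
  next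
    case False
    hence "q = p / \<eta>" by (simp add: q_def)
    also have "\<dots> \<le> p / (\<epsilon> / 2)" using p \<epsilon> \<eta>\<epsilon> \<eta>0 by (intro divide_left_mono) auto
    finally have "q\<^sup>2 \<le> (p / (\<epsilon> / 2))\<^sup>2" by (intro power_mono) (auto simp: q_def)
    hence "60 * q\<^sup>2 \<le> 240 * p\<^sup>2 / \<epsilon>\<^sup>2" by (simp add: power_divide)
    also have "\<dots> = \<Lambda> * \<epsilon> * w" unfolding p_def \<epsilon>(2)[symmetric] using \<epsilon>(1) by (simp add: field_simps eval_nat_numeral)
    finally show ?thesis .
  qed
  define c where "c = l + w + \<epsilon>"
  define \<sigma> where "\<sigma> = (\<lambda>x. 1 / sqrt (c - x))"
  define f where "f = (\<lambda>x. (x - l) ^ 3 * \<sigma> x)"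
  define f1 where "f1 = (\<lambda>x. 3 * (x - l)\<^sup>2 * \<sigma> x + 1 / 2 * (x - l) ^ 3 * \<sigma> x ^ 3)"
  define f2 where "f2 = (\<lambda>x. 6 * (x - l) * \<sigma> x + 3 * (x - l)\<^sup>2 * \<sigma> x ^ 3 + 3 / 4 * (x - l) ^ 3 * \<sigma> x ^ 5)"
  define f3 where "f3 = (\<lambda>x. 6 * \<sigma> x + 9 * (x - l) * \<sigma> x ^ 3 + 27 / 4 * (x - l)\<^sup>2 * \<sigma> x ^ 5 + 15 / 8 * (x - l) ^ 3 * \<sigma> x ^ 7)"
  define \<Phi> where "\<Phi> = (\<lambda>x. \<Lambda> * (l + w - x) * (x - l))"
  define d\<Phi> where "d\<Phi> = (\<lambda>x. \<Lambda> * (l + w - x - (x - l)))"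
  define Q where "Q = (\<lambda>x. f x * ((h x)\<^sup>2 + \<Phi> x * (g x)\<^sup>2) - (1 - x\<^sup>2) * f1 x * g x * h x
       + 1 / 2 * (1 - x\<^sup>2) * ((1 - x\<^sup>2) * f2 x - 2 * x * f1 x) * (g x)\<^sup>2)"
  define R where "R = (\<lambda>x. 1 / 2 * ((1 - x\<^sup>2)\<^sup>2 * f3 x - 6 * x * (1 - x\<^sup>2) * f2 x + (6 * x\<^sup>2 - 2) * f1 x)
       + 2 * \<Phi> x * f1 x + f x * d\<Phi> x)"
  define M where "M = 15 / 2 * \<Lambda> * (w + \<epsilon>) ^ 3 * sqrt (w + \<epsilon>)"
  have yc: "y < c" using \<eta>0 by (simp add: c_def \<eta>_def)
  have dQ: "(Q has_real_derivative R x * (g x)\<^sup>2) (at x)" if x: "l \<le> x" "x \<le> y" for x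
  proof -
    have xc: "x < c" "-1 < x" "x < 1" using x yc l y by auto
    have d: "(\<Phi> has_real_derivative d\<Phi> x) (at x)"
      unfolding \<Phi>_def d\<Phi>_def by (auto intro!: derivative_eq_intros simp: algebra_simps)
    note fs = DERIV_virial_multiplier[OF xc(1), of l]
    show ?thesis unfolding Q_def R_def
    proof (rule DERIV_virial_form[where f = f and ?f1.0 = f1 and ?f2.0 = f2 and ?f3.0 = "f3 x" and \<Phi> = \<Phi>
          and d = "d\<Phi> x" and g = g and h = h and x = x])
      show "(f has_real_derivative f1 x) (at x)"
        unfolding f_def f1_def \<sigma>_def by (rule fs(1))
      show "(f1 has_real_derivative f2 x) (at x)"
        unfolding f1_def f2_def \<sigma>_def by (rule fs(2))
      show "(f2 has_real_derivative f3 x) (at x)"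
        unfolding f2_def f3_def \<sigma>_def by (rule fs(3))
      show "(h has_real_derivative - (\<Phi> x / (1 - x\<^sup>2)) * g x) (at x)"
        unfolding \<Phi>_def by (rule dh[OF xc(2,3)])
    qed (rule d dg xc(2,3))+
  qed
  have RM: "R x \<le> M" if x: "l \<le> x" "x \<le> y" for x
  proof -
    have xc: "x < c" "-1 \<le> x" "x \<le> 1" using x yc l y by auto
    have q': "1 - x\<^sup>2 \<le> q * (c - x)"
      using one_minus_sq_ratio[of x y c] x yc l y xc by (simp add: q_def p_def \<eta>_def c_def)
    have "0 \<le> 1 - x\<^sup>2" using xc by (simp add: abs_square_le_1 abs_le_iff)
    hence "1 / 2 * ((1 - x\<^sup>2)\<^sup>2 * f3 x - 6 * x * (1 - x\<^sup>2) * f2 x + (6 * x\<^sup>2 - 2) * f1 x)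
       + 2 * (\<Lambda> * ((c - x) - \<epsilon>) * (x - l)) * f1 x + f x * (\<Lambda> * ((c - x) - \<epsilon> - (x - l))) \<le> M"
      unfolding M_def f_def f1_def f2_def f3_def
      by (intro virial_rate_le[where q = q]) (use q' xc x w \<epsilon> K \<Lambda> in \<open>auto simp: q_def c_def \<sigma>_def\<close>)
    thus ?thesis unfolding R_def \<Phi>_def d\<Phi>_def c_def by (simp add: algebra_simps)
  qed
  \<comment> \<open>The cube in \<open>f\<close> is the least integer power for which
    \<open>f\<close>, \<open>f1\<close> and \<open>f2\<close> all vanish at
    \<open>l\<close>.\<close>
  have Ql: "Q l = 0" by (simp add: Q_def f_def f1_def f2_def)
  have sub: "{l..y} \<subseteq> {-1..1}" using l y by auto
  have "((\<lambda>x. R x * (g x)\<^sup>2) has_integral Q y - Q l) {l..y}"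
  proof (rule has_integral_FTC_interior)
    show "continuous_on {l..y} Q"
      by (rule continuous_at_imp_continuous_on) (auto intro: DERIV_isCont[OF dQ])
  qed (use ly dQ in auto)
  hence 1: "((\<lambda>x. R x * (g x)\<^sup>2) has_integral Q y) {l..y}" using Ql by simp
  have gi: "(\<lambda>x. (g x)\<^sup>2) integrable_on {l..y}"
    using integrable_on_subinterval[OF has_integral_integrable[OF I] sub] .
  have "Q y \<le> M * integral {l..y} (\<lambda>x. (g x)\<^sup>2)"
    by (rule has_integral_le[OF 1 has_integral_mult_right[OF integrable_integral[OF gi]]])
      (use RM in \<open>auto intro!: mult_right_mono\<close>)
  also have "\<dots> \<le> M * I"
  proof (rule mult_left_mono)
    show "integral {l..y} (\<lambda>x. (g x)\<^sup>2) \<le> I"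
      using integral_subset_le[OF sub gi has_integral_integrable[OF I]] integral_unique[OF I] by simp
    show "0 \<le> M" unfolding M_def using \<Lambda> w \<epsilon> by simp
  qed
  finally have QM: "Q y \<le> M * I" .
  have I0: "0 \<le> I" using has_integral_nonneg[OF I] by simp
  have "\<Lambda> * w * (y - l) ^ 3 * sqrt \<eta> / 15360 * (g y)\<^sup>2 \<le> Q y"
    unfolding Q_def f_def f1_def f2_def p_def[symmetric]
    by (rule virial_form_ge[where \<epsilon> = \<epsilon>])
      (use p l y ly \<eta>0 \<eta>\<epsilon> w \<epsilon> \<Lambda> big K in \<open>auto simp: \<eta>_def c_def \<sigma>_def \<Phi>_def q_def p_def\<close>)
  also note QM
  finally have 2: "\<Lambda> * w * (y - l) ^ 3 * sqrt \<eta> / 15360 * (g y)\<^sup>2 \<le> M * I" .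
  have "(w / 2) ^ 3 \<le> (y - l) ^ 3" using y w by (intro power_mono) auto
  hence "\<Lambda> * w * (w / 2) ^ 3 * sqrt \<eta> / 15360 * (g y)\<^sup>2 \<le> \<Lambda> * w * (y - l) ^ 3 * sqrt \<eta> / 15360 * (g y)\<^sup>2"
    using \<Lambda> w \<eta>0 by (intro mult_right_mono divide_right_mono mult_left_mono) auto
  also note 2
  \<comment> \<open>\<open>\<epsilon> \<le> 9 w\<close> gives
    \<open>w + \<epsilon> \<le> 10 w\<close>. With \<open>122880 = 8 * 15360\<close>,
    \<open>7500 = 15/2 * 10^3\<close> and \<open>sqrt 10 \<le> 3.163\<close> the final factor is
    \<open>122880 * 7500 * 3.163 < 2920000000\<close>.\<close>
  also have "M * I \<le> 15 / 2 * \<Lambda> * (10 * w) ^ 3 * sqrt (10 * w) * I"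
    unfolding M_def using \<Lambda> w \<epsilon> I0 by (intro mult_right_mono mult_mono power_mono) auto
  also have "sqrt (10 * w) \<le> 3.163 * sqrt w"
  proof -
    have "sqrt 10 \<le> (3.163::real)" by (rule real_le_lsqrt) (auto simp: power2_eq_square)
    thus ?thesis using w by (simp add: real_sqrt_mult mult_right_mono)
  qed
  hence "15 / 2 * \<Lambda> * (10 * w) ^ 3 * sqrt (10 * w) * I \<le> 15 / 2 * \<Lambda> * (10 * w) ^ 3 * (3.163 * sqrt w) * I"
    using \<Lambda> w I0 by (intro mult_right_mono mult_left_mono) auto
  finally have 3: "\<Lambda> * w * (w / 2) ^ 3 * sqrt \<eta> / 15360 * (g y)\<^sup>2 \<le> 15 / 2 * \<Lambda> * (10 * w) ^ 3 * (3.163 * sqrt w) * I" .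
  have "(\<Lambda> * w ^ 3 / 122880 * sqrt w) * ((g y)\<^sup>2 * sqrt (w * \<eta>)) = \<Lambda> * w * (w / 2) ^ 3 * sqrt \<eta> / 15360 * (g y)\<^sup>2"
  proof -
    have "sqrt w * (G * (sqrt w * E)) = w * G * E" for G E
    proof -
      have "sqrt w * (G * (sqrt w * E)) = (sqrt w * sqrt w) * G * E" by (simp only: mult_ac)
      thus ?thesis using w by simp
    qed
    note k = this[of "(g y)\<^sup>2" "sqrt \<eta>"]
    have "(\<Lambda> * w ^ 3 / 122880 * sqrt w) * ((g y)\<^sup>2 * sqrt (w * \<eta>)) = \<Lambda> * w ^ 3 / 122880 * (sqrt w * ((g y)\<^sup>2 * (sqrt w * sqrt \<eta>)))"
      by (simp add: real_sqrt_mult)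
    also have "\<dots> = \<Lambda> * w * (w / 2) ^ 3 * sqrt \<eta> / 15360 * (g y)\<^sup>2"
      unfolding k by (simp add: field_simps eval_nat_numeral)
    finally show ?thesis .
  qed
  also note 3
  also have "15 / 2 * \<Lambda> * (10 * w) ^ 3 * (3.163 * sqrt w) * I = (\<Lambda> * w ^ 3 / 122880 * sqrt w) * (122880 * 7500 * 3.163 * I)"
    by (simp add: field_simps eval_nat_numeral)
  finally have "(g y)\<^sup>2 * sqrt (w * \<eta>) \<le> 122880 * 7500 * 3.163 * I"
    using \<Lambda> w by (subst (asm) mult_le_cancel_left_pos) auto
  thus "(g y)\<^sup>2 * sqrt (w * \<eta>) \<le> 2920000000 * I" using I0 by simp
qed

section \<open>The turning point\<close>

text \<open>The expression assumed nonpositive is \<open>1 - x\<^sup>2\<close> times the potential \<open>q\<close> in the Liouville normal form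
  \<open>u'' + q u = 0\<close> of the equation in the variable \<open>arccos x\<close>; its sign makes \<open>u u'\<close> monotone.\<close>

lemma decreasing_beyond_turning_point:
  fixes g h \<Phi> :: "real \<Rightarrow> real"
  assumes "-1 < y" "y \<le> x" "x < 1"
    and dg: "\<And>z. -1 < z \<Longrightarrow> z < 1 \<Longrightarrow> (g has_real_derivative h z / (1 - z\<^sup>2)) (at z)"
    and dh: "\<And>z. -1 < z \<Longrightarrow> z < 1 \<Longrightarrow> (h has_real_derivative - (\<Phi> z / (1 - z\<^sup>2)) * g z) (at z)"
    and cont: "continuous_on {-1..1} g" "continuous_on {-1..1} h" and g1: "g 1 = 0"
    and neg: "\<And>z. y \<le> z \<Longrightarrow> z < 1 \<Longrightarrow> \<Phi> z + (1 - z\<^sup>2) / 4 + 1 / 4 \<le> 0"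
  shows "sqrt (1 - x\<^sup>2) * (g x)\<^sup>2 \<le> sqrt (1 - y\<^sup>2) * (g y)\<^sup>2"
proof -
  have p: "1 - z\<^sup>2 > 0" if "-1 < z" "z < 1" for z :: real
  proof -
    have "1 - z\<^sup>2 = (1 - z) * (1 + z)" by (simp add: power2_eq_square algebra_simps)
    thus ?thesis using that by simp
  qed
  \<comment> \<open>Up to sign, \<open>Z\<close> is \<open>u u'\<close> in the variable
    \<open>arccos x\<close>, with \<open>u = (1 - x^2)^(1/4) g\<close>. It increases to its value 0
    at 1, and the derivative of \<open>u^2\<close> in \<open>x\<close> is
    \<open>2 Z / sqrt (1 - x^2)\<close>.\<close>
  define Z where "Z = (\<lambda>z. h z * g z - 1 / 2 * (z * (g z * g z)))"
  have Z: "Z z \<le> 0" if z: "y \<le> z" "z < 1" for z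
  proof -
    have "Z z \<le> Z 1"
    proof (rule DERIV_nonneg_imp_increasing_open[where f = Z])
      show "continuous_on {z..1} Z"
        unfolding Z_def using assms(1) z
        by (intro continuous_on_diff continuous_on_mult continuous_on_const continuous_on_id
            continuous_on_subset[OF cont(1)] continuous_on_subset[OF cont(2)]) auto
      fix u assume u: "z < u" "u < 1"
      hence u1: "-1 < u" "y \<le> u" using assms(1) z by auto
      have pu: "1 - u\<^sup>2 > 0" using p u u1 by blast
      have "(Z has_real_derivative (- (\<Phi> u / (1 - u\<^sup>2)) * g u * g u + h u / (1 - u\<^sup>2) * h u)
         - 1 / 2 * (1 * (g u * g u) + (h u / (1 - u\<^sup>2) * g u + h u / (1 - u\<^sup>2) * g u) * u)) (at u)"
        unfolding Z_def by (intro DERIV_diff DERIV_mult DERIV_cmult DERIV_ident dg dh u u1)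
      moreover have "(- (\<Phi> u / q) * G * G + H / q * H) - 1 / 2 * (1 * (G * G) + (H / q * G + H / q * G) * u)
         = ((H - u * G / 2)\<^sup>2 - (\<Phi> u + q / 4 + 1 / 4) * G\<^sup>2) / q"
        if "q = 1 - u\<^sup>2" "q > 0" for q G H :: real
      proof -
        have u2: "u * u = 1 - q" using that by (simp add: power2_eq_square)
        have "(H - u * G / 2)\<^sup>2 = H * H - u * (H * G) + (u * u) * (G * G) / 4"
          by (simp add: power2_eq_square algebra_simps)
        also have "\<dots> = H * H - u * (H * G) + (1 - q) * (G * G) / 4" unfolding u2 ..
        finally have A: "(H - u * G / 2)\<^sup>2 - (\<Phi> u + q / 4 + 1 / 4) * G\<^sup>2
          = H * H - u * (H * G) - \<Phi> u * (G * G) - q * (G * G) / 2"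
          by (simp add: power2_eq_square field_simps)
        show ?thesis unfolding A using that(2) by (simp add: field_simps)
      qed
      moreover have "0 \<le> ((h u - u * g u / 2)\<^sup>2 - (\<Phi> u + (1 - u\<^sup>2) / 4 + 1 / 4) * (g u)\<^sup>2) / (1 - u\<^sup>2)"
      proof -
        have "(\<Phi> u + (1 - u\<^sup>2) / 4 + 1 / 4) * (g u)\<^sup>2 \<le> 0"
          using neg[of u] u u1 by (intro mult_nonpos_nonneg) auto
        thus ?thesis using pu by (intro divide_nonneg_pos) (auto intro: order_trans)
      qed
      ultimately show "\<exists>v. (Z has_real_derivative v) (at u) \<and> 0 \<le> v"
        using pu by metis
    qed (use z in simp)
    thus ?thesis by (simp add: Z_def g1)
  qed
  show ?thesis
  proof (rule DERIV_nonpos_imp_nonincreasing[where f = "\<lambda>z. sqrt (1 - z\<^sup>2) * (g z)\<^sup>2", OF assms(2)])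
    fix z assume z: "y \<le> z" "z \<le> x"
    hence z1: "-1 < z" "z < 1" using assms by auto
    note pz = p[OF z1]
    have "((\<lambda>z. 1 - z\<^sup>2) has_real_derivative - 2 * z) (at z)" by (auto intro!: derivative_eq_intros)
    from DERIV_chain2[OF DERIV_real_sqrt[OF pz] this]
    have ds: "((\<lambda>z. sqrt (1 - z\<^sup>2)) has_real_derivative (inverse (sqrt (1 - z\<^sup>2)) / 2) * (- 2 * z)) (at z)" .
    have "((\<lambda>z. sqrt (1 - z\<^sup>2) * (g z * g z)) has_real_derivative
       (inverse (sqrt (1 - z\<^sup>2)) / 2) * (- 2 * z) * (g z * g z)
        + (h z / (1 - z\<^sup>2) * g z + h z / (1 - z\<^sup>2) * g z) * sqrt (1 - z\<^sup>2)) (at z)"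
      by (intro DERIV_mult ds dg z1)
    moreover have "(inverse s / 2) * (- 2 * z) * (G * G) + (H / q * G + H / q * G) * s = 2 * (H * G - 1 / 2 * (z * (G * G))) / s"
      if "s > 0" "q = s * s" for s q G H :: real
      using that by (simp add: field_simps)
    note this[of "sqrt (1 - z\<^sup>2)" "1 - z\<^sup>2" "g z" "h z"]
    ultimately have "((\<lambda>z. sqrt (1 - z\<^sup>2) * (g z)\<^sup>2) has_real_derivative 2 * Z z / sqrt (1 - z\<^sup>2)) (at z)"
      using pz by (simp add: Z_def power2_eq_square)
    moreover have "2 * Z z / sqrt (1 - z\<^sup>2) \<le> 0"
      using Z[OF z(1) z1(2)] pz by (intro divide_nonpos_pos) auto
    ultimately show "\<exists>v. ((\<lambda>z. sqrt (1 - z\<^sup>2) * (g z)\<^sup>2) has_real_derivative v) (at z) \<and> v \<le> 0" by blast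
  qed
qed

section \<open>The zeros of the quadratic \<open>\<Phi>\<close>\<close>

lemma jacobi_Phi_alt:
  fixes n :: nat and a b :: real
  defines "\<Lambda> \<equiv> ((2 * real n + a + b + 1)\<^sup>2 - 1) / 4"
  defines "m \<equiv> (a + b) / 2" and "d \<equiv> (a - b) / 2"
  shows "jacobi_Phi n a b x = (\<Lambda> - m\<^sup>2) * (1 - x\<^sup>2) - (d + m * x)\<^sup>2"
  unfolding jacobi_Phi_def assms by (simp add: field_simps power2_eq_square)

text \<open>In terms of \<open>m\<close> and \<open>d\<close> a quarter of the discriminant of
  \<open>\<Phi>\<close> factors as \<open>(\<Lambda> - m^2) (\<Lambda> - d^2) = X Y\<close>, which
  gives the distance \<open>w\<close> of the zeros. As \<open>m^2 - d^2 = a b > 0\<close>,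
  \<open>X \<le> Y\<close>. Both zeros lie inside the interval because their midpoint does and
  \<open>\<Phi>\<close> takes the negative values \<open>- b^2\<close> and \<open>- a^2\<close> at
  its ends.\<close>

lemma jacobi_parameters:
  fixes n :: nat and a b :: real
  assumes "a > 0" "b > 0"
  defines "\<Lambda> \<equiv> ((2 * real n + a + b + 1)\<^sup>2 - 1) / 4"
  defines "m \<equiv> (a + b) / 2" and "d \<equiv> (a - b) / 2"
  defines "X \<equiv> \<Lambda> - m\<^sup>2" and "Y \<equiv> \<Lambda> - d\<^sup>2"
  defines "w \<equiv> 2 * sqrt (X * Y) / \<Lambda>"
  defines "l \<equiv> - m * d / \<Lambda> - w / 2"
  shows "0 < \<Lambda>" "m \<le> X" "(real n + 1) * (real n + a + b) / 2 \<le> X" "X \<le> Y" "X \<le> \<Lambda>"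
    and "\<Lambda> = (real n + m) * (real n + m + 1)"
    and "0 < w" "w\<^sup>2 * \<Lambda>\<^sup>2 = 4 * X * Y" "2 * X / \<Lambda> \<le> w"
    and "\<And>x. jacobi_Phi n a b x = \<Lambda> * (l + w - x) * (x - l)"
    and "-1 < l" "l + w < 1"
proof -
  have m: "0 < m" using assms(1,2) by (simp add: m_def)
  show \<Lambda>: "\<Lambda> = (real n + m) * (real n + m + 1)"
    unfolding \<Lambda>_def m_def by (simp add: field_simps power2_eq_square)
  show \<Lambda>0: "0 < \<Lambda>" unfolding \<Lambda> using m by (intro mult_pos_pos) auto
  have "m\<^sup>2 - d\<^sup>2 = a * b" unfolding m_def d_def by (simp add: field_simps power2_eq_square)
  hence dm: "d\<^sup>2 \<le> m\<^sup>2" using assms(1,2) by (smt (verit) mult_pos_pos)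
  have X: "X = real n * real n + 2 * (real n * m) + real n + m" unfolding X_def \<Lambda> by (simp add: algebra_simps power2_eq_square)
  show mX: "m \<le> X" unfolding X using m by simp
  show "(real n + 1) * (real n + a + b) / 2 \<le> X"
  proof -
    have e: "real n + a + b = real n + 2 * m" by (simp add: m_def)
    have "X - (real n + 1) * (real n + 2 * m) / 2 = (real n * real n + 2 * (real n * m) + real n) / 2"
      unfolding X by (simp add: field_simps)
    moreover have "0 \<le> (real n * real n + 2 * (real n * m) + real n) / 2" using m by simp
    ultimately show ?thesis unfolding e by linarith
  qed
  show XY: "X \<le> Y" using dm by (simp add: X_def Y_def)
  show "X \<le> \<Lambda>" by (simp add: X_def)
  have XY0: "0 < X" "0 < Y" using m mX XY by linarith+
  show w: "0 < w" unfolding w_def using XY0 \<Lambda>0 by simp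
  show w2: "w\<^sup>2 * \<Lambda>\<^sup>2 = 4 * X * Y"
    unfolding w_def using XY0 \<Lambda>0 by (simp add: power_divide power_mult_distrib)
  show "2 * X / \<Lambda> \<le> w"
  proof -
    have "sqrt (X * X) \<le> sqrt (X * Y)" using XY XY0 by (intro real_sqrt_le_mono mult_left_mono) auto
    thus ?thesis unfolding w_def using XY0 \<Lambda>0 by (intro divide_right_mono) auto
  qed
  show P: "jacobi_Phi n a b x = \<Lambda> * (l + w - x) * (x - l)" for x
  proof -
    define k where "k = m * d / \<Lambda>"
    have k: "\<Lambda> * k = m * d" using \<Lambda>0 by (simp add: k_def)
    have "\<Lambda> * (\<Lambda> * (l + w - x) * (x - l)) = \<Lambda>\<^sup>2 * w\<^sup>2 / 4 - (\<Lambda> * (x + k))\<^sup>2"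
    proof -
      have lk: "l = - k - w / 2" by (simp add: l_def k_def)
      show ?thesis unfolding lk by (simp add: field_simps power2_eq_square)
    qed
    also have "\<dots> = X * Y - (\<Lambda> * x + m * d)\<^sup>2" using w2 k by (simp add: algebra_simps)
    also have "\<dots> = \<Lambda> * ((\<Lambda> - m\<^sup>2) * (1 - x\<^sup>2) - (d + m * x)\<^sup>2)"
      unfolding X_def Y_def by (simp add: algebra_simps power2_eq_square)
    also have "\<dots> = \<Lambda> * jacobi_Phi n a b x"
      unfolding jacobi_Phi_alt \<Lambda>_def m_def d_def ..
    finally show ?thesis using \<Lambda>0 by simp
  qed
  have c: "\<bar>m * d / \<Lambda>\<bar> < 1"
  proof -
    have "\<bar>m * d\<bar> \<le> m * m" using dm m by (simp add: abs_mult abs_le_square_iff[symmetric])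
    also have "\<dots> < \<Lambda>" unfolding \<Lambda> using m by (simp add: algebra_simps add_pos_nonneg)
    finally show ?thesis using \<Lambda>0 by (simp add: abs_divide)
  qed
  have c1: "\<bar>l + w / 2\<bar> < 1"
  proof -
    have "l + w / 2 = - (m * d / \<Lambda>)" by (simp add: l_def)
    thus ?thesis using c by (simp only: abs_minus_cancel)
  qed
  have e: "jacobi_Phi n a b (-1) < 0" "jacobi_Phi n a b 1 < 0" using assms(1,2) by (auto simp: jacobi_Phi_def)
  show "-1 < l"
  proof (rule ccontr)
    assume "\<not> -1 < l"
    moreover have "l + w / 2 > -1" using c1 by linarith
    ultimately have "0 \<le> \<Lambda> * (l + w - (-1)) * (-1 - l)" using w \<Lambda>0 by (intro mult_nonneg_nonneg) auto
    thus False using e(1) P[of "-1"] by simp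
  qed
  show "l + w < 1"
  proof (rule ccontr)
    assume "\<not> l + w < 1"
    moreover have "l + w / 2 < 1" using c1 by linarith
    ultimately have "0 \<le> \<Lambda> * (l + w - 1) * (1 - l)" using w \<Lambda>0 by (intro mult_nonneg_nonneg) auto
    thus False using e(2) P[of 1] by simp
  qed
qed

text \<open>Here \<open>e\<close> plays the role of the square of \<open>E_bound\<close>. Unless
  \<open>sqrt p * D\<close> is so small that \<open>g^2 \<le> 1\<close> suffices,
  \<open>virial_bound\<close> applies and bounds \<open>g^2 sqrt (w \<eta>)\<close>. It remains to
  pay for \<open>V = p / (w \<eta>)\<close>; the two growth assumptions on \<open>e\<close> are what
  makes \<open>V \<le> 16 e^2\<close>. The constants multiply to
  \<open>2920000000 * 2 * 4 < 28800000000\<close>.\<close>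

lemma sqrt_weight_bound_oscillatory:
  fixes n :: nat and a b e y :: real and g h :: "real \<Rightarrow> real"
  assumes ab: "a > 0" "b > 0"
  defines "D \<equiv> 2 * real n + a + b + 1" and "S \<equiv> a + b + 1"
  assumes dg: "\<And>x. -1 < x \<Longrightarrow> x < 1 \<Longrightarrow> (g has_real_derivative h x / (1 - x\<^sup>2)) (at x)"
    and dh: "\<And>x. -1 < x \<Longrightarrow> x < 1 \<Longrightarrow> (h has_real_derivative - (jacobi_Phi n a b x / (1 - x\<^sup>2)) * g x) (at x)"
    and I: "((\<lambda>x. (g x)\<^sup>2) has_integral 2 / D) {-1..1}"
    and g1: "(g y)\<^sup>2 \<le> 1"
    and e: "1 \<le> e" "S\<^sup>2 \<le> e ^ 6" "S ^ 3 / (real n + 1) \<le> e ^ 6"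
    and y: "- ((a + b) / 2 * ((a - b) / 2) / ((D\<^sup>2 - 1) / 4)) \<le> y" "y < 1"
    and osc: "0 \<le> jacobi_Phi n a b y + (1 - y\<^sup>2) / 4 + 1 / 4"
  shows "sqrt (1 - y\<^sup>2) * (g y)\<^sup>2 \<le> 28800000000 * e / D"
proof -
  define p where "p = 1 - y\<^sup>2"
  define \<Lambda> where "\<Lambda> = (D\<^sup>2 - 1) / 4"
  define m where "m = (a + b) / 2"
  define d where "d = (a - b) / 2"
  define X where "X = \<Lambda> - m\<^sup>2"
  define Y where "Y = \<Lambda> - d\<^sup>2"
  define w where "w = 2 * sqrt (X * Y) / \<Lambda>"
  define l where "l = - m * d / \<Lambda> - w / 2"
  note q = jacobi_parameters[OF ab, of n, folded D_def, folded \<Lambda>_def, folded m_def d_def, folded X_def Y_def,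
      folded w_def, folded l_def]
  have "m\<^sup>2 - d\<^sup>2 = a * b" unfolding m_def d_def by (simp add: field_simps power2_eq_square)
  hence md: "0 < m" "d\<^sup>2 \<le> m\<^sup>2" using mult_pos_pos[OF ab] ab by (linarith | simp add: m_def)+
  note par = q(1) md q(2-)
  have N: "0 \<le> real n" by simp
  have D1: "1 < D" "D = 2 * real n + 2 * m + 1" "S = 2 * m + 1" using ab by (auto simp: D_def S_def m_def)
  have S1: "1 \<le> S" using par(2) D1 by simp
  have yl: "l + w / 2 \<le> y" using y(1) unfolding l_def \<Lambda>_def m_def d_def by simp
  have y1: "-1 < y" using yl par(9,13) by linarith
  have p: "0 < p" "p \<le> 1"
  proof -
    have "p = (1 - y) * (1 + y)" by (simp add: p_def power2_eq_square algebra_simps)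
    thus "0 < p" using y y1 by simp
  qed (simp add: p_def)
  show ?thesis
  proof (cases "sqrt p \<le> 28800000000 * e / D")
    case True
    have "sqrt p * (g y)\<^sup>2 \<le> sqrt p * 1" using g1 p by (intro mult_left_mono) auto
    thus ?thesis using True by (simp add: p_def)
  next
    case False
    hence "28800000000 * e / D < sqrt p" by simp
    hence nt: "28800000000 * e < sqrt p * D" using D1 by (simp add: pos_divide_less_eq)
    have "(28800000000 * e)\<^sup>2 \<le> (sqrt p * D)\<^sup>2" using nt e by (intro power_mono) auto
    also have "(sqrt p * D)\<^sup>2 = p * D\<^sup>2" using p by (simp add: power_mult_distrib)
    finally have pD: "829440000000000000000 * e\<^sup>2 \<le> p * D\<^sup>2" by (simp add: power_mult_distrib)
    have "sqrt p \<le> 1" using p by simp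
    hence "sqrt p * D \<le> 1 * D" using D1 by (intro mult_right_mono) auto
    hence Dbig: "28800000000 \<le> D" using nt e by simp
    have "D * 28800000000 \<le> D * D" using Dbig by (intro mult_left_mono) auto
    hence "5 \<le> D * D" using Dbig by linarith
    hence \<Lambda>D: "D\<^sup>2 \<le> 5 * \<Lambda>" using Dbig unfolding \<Lambda>_def by (simp add: power2_eq_square)
    have "p * D\<^sup>2 \<le> p * (5 * \<Lambda>)" using \<Lambda>D p by (intro mult_left_mono) auto
    hence "100000000000000000000 * e\<^sup>2 \<le> p * \<Lambda>" using pD zero_le_power2[of e] by linarith
    hence pL: "10 ^ 20 * e\<^sup>2 \<le> p * \<Lambda>" by simp
    have e2: "1 \<le> e\<^sup>2" using e by simp
    have X0: "0 < X" "0 < Y" using par by linarith+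

    \<comment> \<open>Ties \<open>p\<close> to \<open>Y\<close>, which may be far below
      \<open>\<Lambda>\<close> when one parameter dominates. Oscillation at \<open>y\<close> bounds
      \<open>z = d + m y\<close> by \<open>z^2 \<le> X p + 1/2\<close>, and AM--GM with weight
      \<open>2 X\<close> splits the cross term \<open>2 d z\<close>.\<close>
    have Xm: "(\<Lambda> * p \<le> 13 / 2 * Y)"
    proof -
      define z where "z = d + m * y"
      have Phi: "jacobi_Phi n a b y = X * p - z\<^sup>2"
        unfolding jacobi_Phi_alt X_def \<Lambda>_def D_def m_def d_def p_def z_def ..
      have z2: "z\<^sup>2 \<le> X * p + 1 / 2" using osc p unfolding Phi p_def[symmetric] by linarith
      have "\<Lambda> * p = X * p + m\<^sup>2 - (m * y)\<^sup>2" unfolding X_def p_def by (simp add: algebra_simps power_mult_distrib)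
      also have "m * y = z - d" by (simp add: z_def)
      also have "X * p + m\<^sup>2 - (z - d)\<^sup>2 = X * p + m\<^sup>2 - d\<^sup>2 + 2 * (d * z) - z\<^sup>2"
        by (simp add: power2_eq_square algebra_simps)
      finally have 1: "\<Lambda> * p \<le> X * p + m\<^sup>2 - d\<^sup>2 + 2 * (d * z)" by simp
      have 2: "2 * (d * z) \<le> d\<^sup>2 * z\<^sup>2 / (2 * X) + 2 * X"
      proof -
        have "0 \<le> (d * z - 2 * X)\<^sup>2 / (2 * X)" using X0 by simp
        also have "\<dots> = d\<^sup>2 * z\<^sup>2 / (2 * X) + 2 * X - 2 * (d * z)"
          using X0 by (simp add: field_simps power2_eq_square)
        finally show ?thesis by simp
      qed
      have "d\<^sup>2 * z\<^sup>2 \<le> m\<^sup>2 * (X * p + 1 / 2)" using par(3) z2 by (intro mult_mono) auto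
      hence "d\<^sup>2 * z\<^sup>2 / (2 * X) \<le> m\<^sup>2 * (X * p + 1 / 2) / (2 * X)" using X0 by (intro divide_right_mono) auto
      also have "\<dots> = m\<^sup>2 * p / 2 + m\<^sup>2 / (4 * X)" using X0 by (simp add: field_simps)
      also have "m\<^sup>2 / (4 * X) \<le> X / 4"
      proof -
        have "m\<^sup>2 \<le> X\<^sup>2" using par(2,4) by (intro power_mono) auto
        thus ?thesis using X0 by (simp add: field_simps power2_eq_square)
      qed
      also have "m\<^sup>2 * p / 2 \<le> \<Lambda> * p / 2" using p X0 unfolding X_def by (intro divide_right_mono mult_right_mono) auto
      finally have 3: "d\<^sup>2 * z\<^sup>2 / (2 * X) \<le> \<Lambda> * p / 2 + X / 4" by simp
      have "X * p \<le> X * 1" using p X0 by (intro mult_left_mono) auto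
      hence "\<Lambda> * p / 2 \<le> 13 / 4 * X + (m\<^sup>2 - d\<^sup>2)" using 1 2 3 by linarith
      moreover have "m\<^sup>2 - d\<^sup>2 = Y - X" by (simp add: X_def Y_def)
      ultimately show ?thesis using par(6) by linarith
    qed

    \<comment> \<open>Two regimes from here on: for \<open>2 m \<le> n\<close> the zeros of
      \<open>\<Phi>\<close> are nearly the whole interval apart, whereas for \<open>n < 2 m\<close>
      every quantity is measured by \<open>S\<close> and \<open>n + 1\<close>.\<close>
    have wn: "16 / 9 \<le> w" if "2 * m \<le> real n"
    proof -
      have "9 * m\<^sup>2 = (3 * m) * (3 * m)" by (simp add: power2_eq_square)
      also have "\<dots> \<le> (real n + m) * (real n + m + 1)" using that par(2) by (intro mult_mono) auto
      finally have "8 / 9 * \<Lambda> \<le> X" unfolding X_def par(8) by simp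
      hence "8 / 9 \<le> X / \<Lambda>" using par(1) by (simp add: pos_le_divide_eq)
      thus ?thesis using par(11) by simp
    qed
    have mbig: "8 \<le> m" if "real n < 2 * m" using that Dbig D1(2) by simp
    have S2: "real n + 2 * m \<le> 2 * S" "\<Lambda> \<le> 4 * S\<^sup>2" "(real n + 1) * S / 4 \<le> X" if "real n < 2 * m"
    proof -
      show "real n + 2 * m \<le> 2 * S" using that D1(3) by simp
      have "\<Lambda> \<le> (2 * S) * (2 * S)" unfolding par(8) using that D1(3) par(2) N by (intro mult_mono) auto
      thus "\<Lambda> \<le> 4 * S\<^sup>2" by (simp add: power2_eq_square)
      have "real n + a + b = real n + 2 * m" by (simp add: m_def)
      hence "S / 2 \<le> real n + a + b" using mbig[OF that] N D1(3) by linarith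
      hence "(real n + 1) * (S / 2) / 2 \<le> (real n + 1) * (real n + a + b) / 2"
        by (intro divide_right_mono mult_left_mono) auto
      moreover have "(real n + 1) * (S / 2) / 2 = (real n + 1) * S / 4" by simp
      ultimately show "(real n + 1) * S / 4 \<le> X" using par(5) by linarith
    qed
    \<comment> \<open>For \<open>n < 2 m\<close> the zeros may be close, but
      \<open>w \<ge> 2 X / \<Lambda> \<ge> (n + 1) / (8 S)\<close>, and
      \<open>S \<le> e^2 (n + 1)\<close> shows \<open>e^2 w \<ge> 1/8\<close>. The factor
      \<open>e^2\<close> in \<open>pL\<close> compensates for the small \<open>w\<close>.\<close>
    have pLw: "10 ^ 6 \<le> p * \<Lambda> * w"
    proof (cases "real n < 2 * m")
      case True
      have "S / (real n + 1) \<le> e\<^sup>2"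
      proof (rule cube_mono_imp)
        have "(S / (real n + 1)) ^ 3 = S ^ 3 / (real n + 1) / (real n + 1)\<^sup>2"
          by (simp add: power_divide eval_nat_numeral)
        also have "\<dots> \<le> S ^ 3 / (real n + 1) / 1"
          using S1 N one_le_power[of "real n + 1" 2] by (intro divide_left_mono) auto
        also have "\<dots> \<le> e ^ 6" using e by simp
        also have "\<dots> = (e\<^sup>2) ^ 3" by (simp flip: power_mult)
        finally show "(S / (real n + 1)) ^ 3 \<le> (e\<^sup>2) ^ 3" .
      qed simp
      hence eS: "S \<le> e\<^sup>2 * (real n + 1)" by (simp add: pos_divide_le_eq)
      have "1 / 8 \<le> e\<^sup>2 * (2 * X / \<Lambda>)"
      proof -
        have "\<Lambda> \<le> 4 * (S * S)" using S2(2)[OF True] by (simp add: power2_eq_square)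
        also have "4 * (S * S) \<le> 4 * ((e\<^sup>2 * (real n + 1)) * S)" using eS S1 by (intro mult_left_mono mult_right_mono) auto
        also have "\<dots> = 16 * (e\<^sup>2 * ((real n + 1) * S / 4))" by simp
        also have "\<dots> \<le> 16 * (e\<^sup>2 * X)" using S2(3)[OF True] by (intro mult_left_mono) auto
        finally have "\<Lambda> \<le> 16 * (e\<^sup>2 * X)" .
        thus ?thesis using par(1) by (simp add: field_simps)
      qed
      also have "\<dots> \<le> e\<^sup>2 * w" using par(11) by (intro mult_left_mono) auto
      finally have "10 ^ 20 * (1 / 8) \<le> 10 ^ 20 * (e\<^sup>2 * w)" by (rule mult_left_mono) simp
      also have "\<dots> = (10 ^ 20 * e\<^sup>2) * w" by simp
      also have "\<dots> \<le> (p * \<Lambda>) * w" using pL par(9) by (intro mult_right_mono) auto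
      finally show ?thesis by simp
    next
      case False
      have "10 ^ 20 * 1 * 1 \<le> 10 ^ 20 * e\<^sup>2 * w" using e2 wn False by (intro mult_mono) auto
      also have "\<dots> \<le> (p * \<Lambda>) * w" using pL par(9) by (intro mult_right_mono) auto
      finally show ?thesis by simp
    qed
    \<comment> \<open>Near the right zero the equation is roughly
      \<open>g'' = - (\<Lambda> w / p^2) (l + w - x) g\<close>, so its Airy length is the cube root
      of \<open>p^2 / (\<Lambda> w)\<close>.\<close>
    define \<epsilon> where "\<epsilon> = root 3 (240 * p\<^sup>2 / (\<Lambda> * w))"
    have \<Lambda>w: "0 < \<Lambda> * w" using par by simp
    have \<epsilon>0: "0 < \<epsilon>" unfolding \<epsilon>_def using p \<Lambda>w by (intro real_root_gt_zero) auto
    have \<epsilon>_cube: "\<epsilon> ^ 3 = 240 * p\<^sup>2 / (\<Lambda> * w)" unfolding \<epsilon>_def using p \<Lambda>w by (intro real_root_pow_pos2) auto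
    hence \<epsilon>3: "\<epsilon> ^ 3 * \<Lambda> * w = 240 * p\<^sup>2" using par(1,9) by simp
    \<comment> \<open>\<open>\<Lambda> = X + m^2\<close>. Degree 0 is the critical case, with
      \<open>X = m\<close> and \<open>\<Lambda> = m^2 + m\<close>; for \<open>n \<ge> 1\<close>
      already \<open>m \<le> X / 3\<close>.\<close>
    have X\<Lambda>: "\<Lambda> \<le> 23 / 20 * X\<^sup>2"
    proof (cases "n = 0")
      case True
      hence "8 \<le> m" using mbig par(2) by simp
      hence "m * 8 \<le> m * m" by (intro mult_left_mono) auto
      moreover have "\<Lambda> = m * m + m" unfolding par(8) using True by (simp add: algebra_simps)
      ultimately have "\<Lambda> \<le> 23 / 20 * m\<^sup>2" unfolding power2_eq_square using zero_le_square[of m] by linarith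
      also have "\<dots> \<le> 23 / 20 * X\<^sup>2" using par(2,4) by (intro mult_left_mono power_mono) auto
      finally show ?thesis .
    next
      case False
      hence n1: "1 \<le> real n" by simp
      have X: "X = real n * real n + 2 * (real n * m) + real n + m"
        unfolding X_def par(8) by (simp add: algebra_simps power2_eq_square)
      have "real n * m \<ge> 1 * m" using n1 par(2) by (intro mult_right_mono) auto
      hence nn: "real n * m \<ge> m" "0 \<le> real n * real n" by simp_all
      have "m \<le> (v + 2 * u + real n + m) / 3" if "m \<le> u" "0 \<le> v" for u v :: real
        using that n1 by simp
      hence "m \<le> X / 3" unfolding X using nn by blast
      hence "m\<^sup>2 \<le> (X / 3)\<^sup>2" using par(2) by (intro power_mono) auto
      hence 1: "m\<^sup>2 \<le> X\<^sup>2 / 9" by (simp add: power_divide)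
      have "20 \<le> X" unfolding X using nn n1 par(2) Dbig D1(2) by linarith
      hence "20 * X \<le> X * X" by (intro mult_right_mono) auto
      hence "\<Lambda> \<le> X\<^sup>2 / 20 + X\<^sup>2 / 9" using 1 unfolding X_def[symmetric] by (simp add: X_def power2_eq_square)
      also have "\<dots> \<le> 23 / 20 * X\<^sup>2" using zero_le_power2[of X] by linarith
      finally show ?thesis .
    qed
    \<comment> \<open>After cubing and multiplying by powers of \<open>\<Lambda>\<close> both sides
      are multiples of \<open>X^2 Y^2\<close>. The factors 13/2 and 23/20 are barely good enough:
      \<open>240 * 3887/80 = 11661\<close> against \<open>729 * 16 = 11664\<close>.\<close>
    have \<epsilon>w: "\<epsilon> \<le> 9 * w"
    proof (rule cube_mono_imp)
      have "(\<Lambda> * p)\<^sup>2 \<le> (13 / 2 * Y)\<^sup>2" using Xm p par(1) by (intro power_mono) auto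
      hence "\<Lambda> * (\<Lambda> * p)\<^sup>2 \<le> (23 / 20 * X\<^sup>2) * (13 / 2 * Y)\<^sup>2"
        using X\<Lambda> par(1) by (intro mult_mono) auto
      moreover have "(23 / 20 * X\<^sup>2) * (13 / 2 * Y)\<^sup>2 = 3887 / 80 * (X\<^sup>2 * Y\<^sup>2)"
        by (simp add: power_mult_distrib power_divide)
      moreover have "0 \<le> X\<^sup>2 * Y\<^sup>2" "16 * X\<^sup>2 * Y\<^sup>2 = 16 * (X\<^sup>2 * Y\<^sup>2)" by simp_all
      ultimately have "240 * (\<Lambda> * (\<Lambda> * p)\<^sup>2) \<le> 729 * (16 * X\<^sup>2 * Y\<^sup>2)"
        by linarith
      also have "16 * X\<^sup>2 * Y\<^sup>2 = (w\<^sup>2 * \<Lambda>\<^sup>2)\<^sup>2" unfolding par(10) by (simp add: power_mult_distrib)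
      finally have "(240 * p\<^sup>2) * \<Lambda> ^ 3 \<le> (729 * w ^ 3 * \<Lambda> * w) * \<Lambda> ^ 3"
        by (simp add: power_mult_distrib eval_nat_numeral mult_ac)
      hence "240 * p\<^sup>2 \<le> 729 * w ^ 3 * \<Lambda> * w" using par(1) by simp
      hence "\<epsilon> ^ 3 * (\<Lambda> * w) \<le> (9 * w) ^ 3 * (\<Lambda> * w)" unfolding \<epsilon>3[symmetric] by (simp add: mult.assoc power_mult_distrib)
      thus "\<epsilon> ^ 3 \<le> (9 * w) ^ 3" using \<Lambda>w by (simp only: mult_le_cancel_right_pos)
    qed (use par(9) in simp)
    define \<eta> where "\<eta> = l + w + \<epsilon> - y"
    have osc': "- 1 / 2 \<le> \<Lambda> * (l + w - y) * (y - l)"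
      using osc p unfolding par(12) p_def[symmetric] by linarith
    note vb = virial_bound[where g = g and h = h and l = l and w = w and \<Lambda> = \<Lambda> and y = y and \<epsilon> = \<epsilon> and I = "2 / D",
        OF par(13,9,1) dg dh[unfolded par(12)] I yl y(2) osc' \<epsilon>0 \<epsilon>3[unfolded p_def] \<epsilon>w pLw[unfolded p_def], folded \<eta>_def]
    have \<eta>: "\<epsilon> / 2 \<le> \<eta>" "(g y)\<^sup>2 * sqrt (w * \<eta>) \<le> 2920000000 * (2 / D)" using vb by auto
    have \<eta>0: "0 < \<eta>" using \<eta>(1) \<epsilon>0 by linarith
    define V where "V = p / (w * \<eta>)"
    have V0: "0 < V" unfolding V_def using p par(9) \<eta>0 by simp
    have Vcube: "V ^ 3 \<le> p * \<Lambda> / (30 * w\<^sup>2)"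
    proof -
      have "V \<le> p / (w * (\<epsilon> / 2))" unfolding V_def using p par(9) \<eta> \<eta>0 \<epsilon>0 by (intro divide_left_mono mult_left_mono) auto
      hence "V ^ 3 \<le> (p / (w * (\<epsilon> / 2))) ^ 3" using V0 by (intro power_mono) auto
      also have "\<dots> = 8 * p ^ 3 / (w ^ 3 * \<epsilon> ^ 3)" by (simp add: power_divide power_mult_distrib)
      also note \<epsilon>_cube
      also have "8 * p ^ 3 / (w ^ 3 * (240 * p\<^sup>2 / (\<Lambda> * w))) = p * \<Lambda> / (30 * w\<^sup>2)"
        using p par(9) by (simp add: field_simps eval_nat_numeral)
      finally show ?thesis .
    qed
    have e6: "(e\<^sup>2) ^ 3 = e ^ 6" by (simp flip: power_mult)
    have V: "V \<le> 16 * e\<^sup>2"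
    proof (cases "real n < 2 * m")
      case True
      show ?thesis
      proof (rule cube_mono_imp)
        have "p * \<Lambda> / (30 * w\<^sup>2) \<le> 13 / 2 * Y / (30 * w\<^sup>2)"
          using Xm by (intro divide_right_mono) (auto simp: mult.commute)
        also have "\<dots> = 13 / 240 * (\<Lambda>\<^sup>2 / X)"
        proof -
          have w2: "w\<^sup>2 = 4 * X * Y / \<Lambda>\<^sup>2" using par(1,10) by (simp add: field_simps)
          show ?thesis unfolding w2 using X0 par(1) by (simp add: field_simps)
        qed
        \<comment> \<open>\<open>Y\<close> has cancelled between \<open>Xm\<close> and
          \<open>w^2\<close>. The remaining \<open>\<Lambda>^2 / X\<close> is where the quantity
          \<open>S^3 / (n + 1)\<close> in the definition of \<open>E_bound\<close> comes
          from.\<close>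
        also have "\<dots> \<le> 13 / 240 * (64 * (S ^ 3 / (real n + 1)))"
        proof -
          have "\<Lambda>\<^sup>2 / X \<le> (4 * S\<^sup>2)\<^sup>2 / ((real n + 1) * S / 4)"
            using S2[OF True] par(1) S1 N X0 by (intro frac_le power_mono) auto
          also have "\<dots> = 64 * (S ^ 3 / (real n + 1))"
          proof -
            have "(4 * S\<^sup>2)\<^sup>2 / (k * S / 4) = 64 * (S ^ 3 / k)" if "k > 0" for k
              using that S1 by (simp add: field_simps eval_nat_numeral)
            thus ?thesis using N by simp
          qed
          finally show ?thesis by (intro mult_left_mono) auto
        qed
        also have "\<dots> \<le> 13 / 240 * (64 * e ^ 6)" using e by (intro mult_left_mono) auto
        also have "\<dots> \<le> 4096 * e ^ 6" by simp
        also have "\<dots> = (16 * e\<^sup>2) ^ 3" using e6 by (simp add: power_mult_distrib)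
        finally show "V ^ 3 \<le> (16 * e\<^sup>2) ^ 3" using Vcube by linarith
      qed simp
    next
      case False
      hence w1: "16 / 9 \<le> w" using wn by simp
      have w2: "1 \<le> w\<^sup>2" using w1 by simp
      show ?thesis
      \<comment> \<open>With \<open>r = l + w\<close>: close to \<open>r\<close> the distance
        \<open>1 - y\<close> is comparable to \<open>1 - r\<close>, and
        \<open>\<Lambda> (1 - r) (1 - l) = - \<Phi> 1 = a^2\<close>, which explains the quantity
        \<open>S^2\<close>. Farther left \<open>\<eta>\<close> is at least half of
        \<open>1 - y\<close>, so \<open>V\<close> is bounded outright.\<close>
      proof (cases "1 - y \<le> 2 * (1 - (l + w))")
        case True
        have "p = (1 + y) * (1 - y)" by (simp add: p_def power2_eq_square algebra_simps)
        also have "\<dots> \<le> 2 * (2 * (1 - (l + w)))" using True y y1 by (intro mult_mono) auto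
        finally have "p * \<Lambda> \<le> (4 * (1 - (l + w))) * \<Lambda>" using par(1) by (intro mult_right_mono) auto
        also have "\<dots> \<le> (4 * (1 - (l + w))) * \<Lambda> * (1 - l)"
        proof -
          have "1 \<le> 1 - l" using w1 par(14) by simp
          moreover have "0 \<le> (4 * (1 - (l + w))) * \<Lambda>" using par(1,14) by simp
          ultimately show ?thesis by (metis mult_left_mono mult.right_neutral)
        qed
        also have "\<dots> = - 4 * jacobi_Phi n a b 1" unfolding par(12) by (simp add: algebra_simps)
        also have "\<dots> = 4 * a\<^sup>2" by (simp add: jacobi_Phi_def)
        also have "\<dots> \<le> 4 * S\<^sup>2" using ab by (intro mult_left_mono power_mono) (auto simp: S_def)
        finally have "p * \<Lambda> \<le> 4 * S\<^sup>2" .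
        hence "p * \<Lambda> / (30 * w\<^sup>2) \<le> 4 * S\<^sup>2 / (30 * 1)" using w2 p par(1) by (intro frac_le) auto
        also have "\<dots> \<le> e ^ 6" using e(2) zero_le_power2[of S] by linarith
        also have "\<dots> \<le> (16 * e\<^sup>2) ^ 3" using e6 by (simp add: power_mult_distrib)
        finally have "V ^ 3 \<le> (16 * e\<^sup>2) ^ 3" using Vcube by linarith
        thus ?thesis by (rule cube_mono_imp) simp
      next
        case F: False
        have \<eta>y: "(1 - y) / 2 \<le> \<eta>" using F \<epsilon>0 unfolding \<eta>_def by (simp add: field_simps)
        have "V \<le> p / (1 * ((1 - y) / 2))"
          unfolding V_def using p \<eta>y w1 y \<eta>0 by (intro divide_left_mono mult_mono) auto
        also have "\<dots> = 2 * (1 + y)"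
        proof -
          have "p = (1 + y) * (1 - y)" by (simp add: p_def power2_eq_square algebra_simps)
          thus ?thesis using y by simp
        qed
        also have "\<dots> \<le> 16 * e\<^sup>2" using y e2 by simp
        finally show ?thesis .
      qed
    qed
    have sV: "sqrt V \<le> 4 * e"
      using V e by (intro real_le_lsqrt) (auto simp: power_mult_distrib V0 less_imp_le)
    have "sqrt p * (g y)\<^sup>2 = (g y)\<^sup>2 * sqrt (w * \<eta>) * sqrt V"
    proof -
      have "p = w * \<eta> * V" unfolding V_def using par(9) \<eta>0 by simp
      hence "sqrt p = sqrt (w * \<eta>) * sqrt V" by (simp add: real_sqrt_mult)
      thus ?thesis by simp
    qed
    also have "\<dots> \<le> (2920000000 * (2 / D)) * (4 * e)"
      by (rule mult_mono[OF \<eta>(2) sV]) (use D1(1) V0 in simp_all)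
    also have "\<dots> \<le> 28800000000 * e / D" using D1 e by (simp add: divide_right_mono)
    finally show ?thesis unfolding p_def .
  qed
qed

lemma sqrt_weight_bound_right:
  fixes n :: nat and a b e x :: real and g h :: "real \<Rightarrow> real"
  assumes ab: "a > 0" "b > 0"
  defines "D \<equiv> 2 * real n + a + b + 1" and "S \<equiv> a + b + 1"
  assumes dg: "\<And>x. -1 < x \<Longrightarrow> x < 1 \<Longrightarrow> (g has_real_derivative h x / (1 - x\<^sup>2)) (at x)"
    and dh: "\<And>x. -1 < x \<Longrightarrow> x < 1 \<Longrightarrow> (h has_real_derivative - (jacobi_Phi n a b x / (1 - x\<^sup>2)) * g x) (at x)"
    and cont: "continuous_on {-1..1} g" "continuous_on {-1..1} h" and g0: "g 1 = 0"
    and I: "((\<lambda>x. (g x)\<^sup>2) has_integral 2 / D) {-1..1}"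
    and g1: "\<And>x. -1 < x \<Longrightarrow> x < 1 \<Longrightarrow> (g x)\<^sup>2 \<le> 1"
    and e: "1 \<le> e" "S\<^sup>2 \<le> e ^ 6" "S ^ 3 / (real n + 1) \<le> e ^ 6"
    and x: "- ((a + b) / 2 * ((a - b) / 2) / ((D\<^sup>2 - 1) / 4)) \<le> x" "-1 < x" "x < 1"
  shows "sqrt (1 - x\<^sup>2) * (g x)\<^sup>2 \<le> 28800000000 * e / D"
proof -
  define c where "c = - ((a + b) / 2 * ((a - b) / 2) / ((D\<^sup>2 - 1) / 4))"
  define T where "T = (\<lambda>x. jacobi_Phi n a b x + (1 - x\<^sup>2) / 4 + 1 / 4)"
  have osc: "sqrt (1 - y\<^sup>2) * (g y)\<^sup>2 \<le> 28800000000 * e / D" if "c \<le> y" "-1 < y" "y < 1" "0 \<le> T y" for y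
    using that e unfolding D_def S_def c_def T_def
    by (intro sqrt_weight_bound_oscillatory[where h = h and n = n and a = a and b = b] ab dg dh I[unfolded D_def] g1) auto
  show ?thesis
  proof (cases "0 \<le> T x")
    case True
    thus ?thesis using osc x by (simp add: c_def)
  next
    case False
    have D1: "1 < D" using ab by (simp add: D_def)
    \<comment> \<open>Chord identity for a quadratic with leading coefficient
      \<open>- D^2 / 4\<close>. With \<open>T c > 0\<close> and \<open>T y = 0\<close> it forces
      \<open>T z \<le> 0\<close> for all \<open>z \<ge> y\<close>.\<close>
    have quad: "(z - c) * T y = (z - y) * T c + (y - c) * T z + D\<^sup>2 / 4 * ((z - c) * (z - y) * (y - c))" for y z
      unfolding T_def jacobi_Phi_def D_def[symmetric] by (simp add: field_simps power2_eq_square)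
    define \<Lambda> where "\<Lambda> = (D\<^sup>2 - 1) / 4"
    define m where "m = (a + b) / 2"
    define d where "d = (a - b) / 2"
    define X where "X = \<Lambda> - m\<^sup>2"
    define Y where "Y = \<Lambda> - d\<^sup>2"
    define w where "w = 2 * sqrt (X * Y) / \<Lambda>"
    define l where "l = - m * d / \<Lambda> - w / 2"
    note par = jacobi_parameters[OF ab, of n, folded D_def, folded \<Lambda>_def, folded m_def d_def, folded X_def Y_def,
      folded w_def, folded l_def]
    have cl: "c = l + w / 2" by (simp add: c_def l_def \<Lambda>_def m_def d_def)
    have Pc: "0 < jacobi_Phi n a b c"
      unfolding par(10) cl using par(1,7) by simp
    have c1: "-1 < c" unfolding cl using par(7,11) by linarith
    have cx: "c \<le> x" using x by (simp add: c_def)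
    have Tc: "0 < T c"
    proof -
      have "c < 1" "0 \<le> 1 - c\<^sup>2" using c1 cx x by (auto simp: abs_square_le_1 abs_le_iff)
      moreover have "0 < P + q / 4 + 1 / 4" if "0 < P" "0 \<le> q" for P q :: real using that by simp
      ultimately show ?thesis unfolding T_def using Pc by blast
    qed
    have contT: "continuous_on {c..x} T"
      unfolding T_def jacobi_Phi_def by (intro continuous_intros) auto
    \<comment> \<open>The point where \<open>T\<close> changes sign is still covered by
      \<open>osc\<close>, and everything from there to \<open>x\<close> is in the region of
      decrease.\<close>
    obtain y where y: "c \<le> y" "y \<le> x" "T y = 0"
      using IVT2'[of T x 0 c, OF _ _ cx contT] Tc False by auto
    have cy: "c < y" using y Tc by (cases "c = y") auto
    have "sqrt (1 - x\<^sup>2) * (g x)\<^sup>2 \<le> sqrt (1 - y\<^sup>2) * (g y)\<^sup>2"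
    proof (rule decreasing_beyond_turning_point[where h = h and \<Phi> = "jacobi_Phi n a b"])
      fix z assume z: "y \<le> z" "z < 1"
      have "0 \<le> (z - y) * T c" "0 \<le> D\<^sup>2 / 4 * ((z - c) * (z - y) * (y - c))"
        using z cy Tc by (auto intro!: mult_nonneg_nonneg)
      hence "(y - c) * T z \<le> 0" using quad[of z y] y(3) by simp
      thus "jacobi_Phi n a b z + (1 - z\<^sup>2) / 4 + 1 / 4 \<le> 0" using cy by (simp add: T_def mult_le_0_iff)
    qed (use y c1 cy x dg dh cont g0 in auto)
    also have "\<dots> \<le> 28800000000 * e / D" using y c1 cy x by (intro osc) auto
    finally show ?thesis .
  qed
qed

lemma jacobi_gsq_le_1:
  assumes "a > 0" "b > 0" "-1 < x" "x < 1"
  shows "jacobi_gsq n a b x \<le> 1"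
proof -
  have "(real n + 1) * (real n + a + b + 1) / ((real n + a + 1) * (real n + b + 1)) \<le> 1"
  proof -
    have "(real n + 1) * (real n + a + b + 1) \<le> (real n + a + 1) * (real n + b + 1)"
      using assms mult_pos_pos[OF assms(1,2)] by (simp add: algebra_simps)
    moreover have "0 < (real n + a + 1) * (real n + b + 1)" using assms by (intro mult_pos_pos) auto
    ultimately show ?thesis by (simp only: divide_le_eq_1_pos)
  qed
  hence "sqrt ((real n + 1) * (real n + a + b + 1) / ((real n + a + 1) * (real n + b + 1))) \<le> sqrt 1"
    by (rule real_sqrt_le_mono)
  thus ?thesis using jacobi_gsq_le[OF assms, of n] by (simp only: real_sqrt_one)
qed

text \<open>Left of the midpoint \<open>c\<close> of the zeros, the reflection of \<open>x\<close>
  to \<open>- x\<close> swaps \<open>a\<close> and \<open>b\<close>, negates \<open>c\<close> and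
  preserves all hypotheses; the chain rule turns \<open>jacobi_f1\<close> into its negative.\<close>

lemma sqrt_weight_jacobi_gsq_le:
  fixes n :: nat and a b e x :: real
  assumes ab: "a > 0" "b > 0" and x: "-1 < x" "x < 1"
    and e: "1 \<le> e" "(a + b + 1)\<^sup>2 \<le> e ^ 6" "(a + b + 1) ^ 3 / (real n + 1) \<le> e ^ 6"
  shows "sqrt (1 - x\<^sup>2) * jacobi_gsq n a b x \<le> 28800000000 * e / (2 * real n + a + b + 1)"
proof -
  have I: "((\<lambda>x. (jacobi_f n a b x)\<^sup>2) has_integral 2 / (2 * real n + a + b + 1)) {-1..1}"
    by (rule has_integral_eq[OF _ has_integral_jacobi_gsq[OF ab]]) (use ab in \<open>simp add: jacobi_f_squared\<close>)
  have g1: "(jacobi_f n a b z)\<^sup>2 \<le> 1" if "-1 < z" "z < 1" for z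
    using jacobi_gsq_le_1[OF ab that, of n] jacobi_f_squared[OF ab, of z n] that by simp
  have f2: "jacobi_gsq n a b x = (jacobi_f n a b x)\<^sup>2"
    using jacobi_f_squared[OF ab, of x n] x by simp
  define c where "c = - ((a + b) / 2 * ((a - b) / 2) / (((2 * real n + a + b + 1)\<^sup>2 - 1) / 4))"
  show ?thesis
  proof (cases "c \<le> x")
    case True
    show ?thesis unfolding f2
    proof (rule sqrt_weight_bound_right[where h = "jacobi_f1 n a b"])
      show "jacobi_f n a b 1 = 0" by (rule jacobi_f_end) simp
      show "- ((a + b) / 2 * ((a - b) / 2) / (((2 * real n + a + b + 1)\<^sup>2 - 1) / 4)) \<le> x"
        using True unfolding c_def .
    qed (rule ab x e I g1 DERIV_jacobi_f DERIV_jacobi_f1 continuous_jacobi_f | assumption)+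
  next
    case False
    let ?g = "\<lambda>x. jacobi_f n a b (- x)" and ?h = "\<lambda>x. - jacobi_f1 n a b (- x)"
    have sym: "2 * real n + b + a + 1 = 2 * real n + a + b + 1" "b + a = a + b" by auto
    have nx: "jacobi_gsq n a b x = (?g (- x))\<^sup>2" using f2 by simp
    have "sqrt (1 - (- x)\<^sup>2) * (?g (- x))\<^sup>2 \<le> 28800000000 * e / (2 * real n + b + a + 1)"
    proof (rule sqrt_weight_bound_right[where h = ?h])
      fix z :: real assume z: "-1 < z" "z < 1"
      hence z': "-1 < - z" "- z < 1" by auto
      have m: "((\<lambda>z. - z) has_real_derivative - 1) (at z)" by (auto intro!: derivative_eq_intros)
      show "(?g has_real_derivative ?h z / (1 - z\<^sup>2)) (at z)"
        using DERIV_chain2[where g = "\<lambda>z. - z" and x = z, OF DERIV_jacobi_f[OF z'] m, of n a b] by simp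
      show "(?h has_real_derivative - (jacobi_Phi n b a z / (1 - z\<^sup>2)) * ?g z) (at z)"
      proof -
        have P: "jacobi_Phi n a b (- z) = jacobi_Phi n b a z"
          unfolding jacobi_Phi_def sym by (simp add: algebra_simps)
        show ?thesis
          using DERIV_minus[OF DERIV_chain2[where g = "\<lambda>z. - z" and x = z, OF DERIV_jacobi_f1[OF z'] m, of n a b]]
          by (simp add: P)
      qed
      show "(?g z)\<^sup>2 \<le> 1" by (rule g1[OF z'])
    next
      have c: "continuous_on {-1..1} (\<lambda>x::real. - x)" "(\<lambda>x::real. - x) ` {-1..1} \<subseteq> {-1..1}"
        by (auto intro: continuous_on_minus continuous_on_id)
      show "continuous_on {-1..1} ?g"
        using continuous_on_compose2[OF continuous_jacobi_f(1)[OF ab] c] .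
      show "continuous_on {-1..1} ?h"
        using continuous_on_minus[OF continuous_on_compose2[OF continuous_jacobi_f(2)[OF ab] c]] .
      show "((\<lambda>x. (?g x)\<^sup>2) has_integral 2 / (2 * real n + b + a + 1)) {-1..1}"
        using has_integral_reflect_lemma_real[OF I] unfolding sym by simp
      have "c = - (- ((b + a) / 2 * ((b - a) / 2) / (((2 * real n + b + a + 1)\<^sup>2 - 1) / 4)))"
        unfolding c_def sym minus_divide_left mult_minus_right[symmetric] by simp
      thus "- ((b + a) / 2 * ((b - a) / 2) / (((2 * real n + b + a + 1)\<^sup>2 - 1) / 4)) \<le> - x"
        using False by simp
    qed (use ab x e in \<open>auto simp: jacobi_f_end sym\<close>)
    thus ?thesis unfolding nx sym by simp
  qed
qed

section \<open>Limits of the parameters\<close>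

lemma tendsto_jacobi_P:
  assumes "(f \<longlongrightarrow> a) F" "(g \<longlongrightarrow> b) F"
  shows "((\<lambda>t. jacobi_P n (f t) (g t) x) \<longlongrightarrow> jacobi_P n a b x) F"
  unfolding jacobi_P_def gbinomial_prod_rev by (intro tendsto_intros assms) auto

lemma tendsto_jacobi_nrm:
  assumes "(f \<longlongrightarrow> a) F" "(g \<longlongrightarrow> b) F" "a \<ge> 0" "b \<ge> 0"
  shows "((\<lambda>t. jacobi_nrm n (f t) (g t)) \<longlongrightarrow> jacobi_nrm n a b) F"
proof -
  have G: "((\<lambda>t. Gamma (h t)) \<longlongrightarrow> Gamma c) F" if "(h \<longlongrightarrow> c) F" "c > 0" for h :: "_ \<Rightarrow> real" and c
    using that nonpos_Ints_nonpos[of c] by (intro tendsto_Gamma) auto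
  have "Gamma (real n + a + 1) > 0" "Gamma (real n + b + 1) > 0"
    using assms by (auto intro!: Gamma_real_pos)
  hence pos: "Gamma (real n + a + 1) * Gamma (real n + b + 1) \<noteq> 0" by simp
  show ?thesis unfolding jacobi_nrm_def
    by (intro tendsto_divide tendsto_mult G tendsto_add tendsto_const assms pos) (use assms in auto)
qed

text \<open>At interior points the bases are positive, so \<open>powr\<close> is continuous even
  where an exponent tends to 0 and no convention for \<open>0^0\<close> enters.\<close>

lemma tendsto_jacobi_gsq:
  assumes "(f \<longlongrightarrow> a) F" "(g \<longlongrightarrow> b) F" "a \<ge> 0" "b \<ge> 0" "-1 < x" "x < 1"
  shows "((\<lambda>t. jacobi_gsq n (f t) (g t) x) \<longlongrightarrow> jacobi_gsq n a b x) F"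
  unfolding jacobi_gsq_def jacobi_weight_def
  by (intro tendsto_mult tendsto_power tendsto_jacobi_nrm tendsto_jacobi_P tendsto_powr tendsto_const assms)
    (use assms in auto)

lemma jacobi_g_squared:
  assumes "a \<ge> 0" "b \<ge> 0" "-1 < x" "x < 1"
  shows "(jacobi_g n a b x)\<^sup>2 = jacobi_gsq n a b x"
proof -
  have h: "(u powr (c / 2))\<^sup>2 = u powr c" for u c :: real
    by (simp add: power2_eq_square flip: powr_add)
  have "(sqrt (jacobi_nrm n a b))\<^sup>2 = jacobi_nrm n a b"
    using jacobi_nrm_pos[of a b n] assms by simp
  moreover have "rpow ((1 - x) / 2) (a / 2) = ((1 - x) / 2) powr (a / 2)"
    "rpow ((1 + x) / 2) (b / 2) = ((1 + x) / 2) powr (b / 2)"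
    using assms by (auto simp: rpow_def)
  ultimately show ?thesis
    unfolding jacobi_g_def jacobi_gsq_def jacobi_weight_def jacobi_nrm_def[symmetric]
    by (simp only: power_mult_distrib h mult.assoc)
qed

section \<open>Both branches for nonnegative parameters\<close>

lemma E_bound_eq:
  "E_bound k S = max 1 (max (S powr (1/6)) (S powr (1/4) / (real k + 1) powr (1/12)))"
  by (simp add: E_bound_def)

text \<open>The twelfth power clears all exponents in \<open>E_bound\<close>. With
  \<open>e = E_bound^2\<close> these are the hypotheses on \<open>e^6\<close> used above.\<close>

lemma E_bound_ge:
  assumes "S > 0"
  shows "1 \<le> E_bound k S" "S\<^sup>2 \<le> E_bound k S ^ 12" "S ^ 3 / (real k + 1) \<le> E_bound k S ^ 12"
proof -
  show "1 \<le> E_bound k S" by (simp add: E_bound_eq)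
  have pw: "(u powr c) ^ 12 = u powr (c * 12)" if "u > 0" for u c :: real
    using that by (simp flip: powr_realpow add: powr_powr)
  have "(S powr (1/6)) ^ 12 \<le> E_bound k S ^ 12" by (intro power_mono) (auto simp: E_bound_eq)
  moreover have "(S powr (1/6)) ^ 12 = S\<^sup>2"
    using pw[OF assms, of "1/6"] powr_realpow[OF assms, of 2] by simp
  ultimately show "S\<^sup>2 \<le> E_bound k S ^ 12" by simp
  have "(S powr (1/4) / (real k + 1) powr (1/12)) ^ 12 \<le> E_bound k S ^ 12"
    by (intro power_mono) (auto simp: E_bound_eq)
  moreover have "(S powr (1/4)) ^ 12 = S ^ 3"
    using pw[OF assms, of "1/4"] powr_realpow[OF assms, of 3] by simp
  moreover have "((real k + 1) powr (1/12)) ^ 12 = real k + 1" by (simp add: pw)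
  ultimately show "S ^ 3 / (real k + 1) \<le> E_bound k S ^ 12" by (simp only: power_divide)
qed

lemma T_bound_squared:
  assumes "a \<ge> 0" "b \<ge> 0"
  shows "(T_bound n a b)\<^sup>2 = sqrt ((real n + 1) * (real n + a + b + 1) / ((real n + a + 1) * (real n + b + 1)))"
proof -
  have "0 \<le> (real n + 1) * (real n + a + b + 1) / ((real n + a + 1) * (real n + b + 1))"
    using assms by (intro divide_nonneg_nonneg mult_nonneg_nonneg) auto
  thus ?thesis unfolding T_bound_def
    by (simp add: power2_eq_square powr_half_sqrt flip: powr_add)
qed

text \<open>Both parameters are shifted by the same \<open>t > 0\<close>, which makes them positive,
  and \<open>t\<close> tends to 0.\<close>

lemma jacobi_gsq_le_T_bound:
  assumes "a \<ge> 0" "b \<ge> 0" "-1 < x" "x < 1"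
  shows "jacobi_gsq n a b x \<le> (T_bound n a b)\<^sup>2"
  unfolding T_bound_squared[OF assms(1,2)]
proof (rule tendsto_le)
  have a: "((\<lambda>t. a + t) \<longlongrightarrow> a) (at_right 0)" and b: "((\<lambda>t. b + t) \<longlongrightarrow> b) (at_right 0)"
    by (auto intro!: tendsto_eq_intros)
  show "((\<lambda>t. jacobi_gsq n (a + t) (b + t) x) \<longlongrightarrow> jacobi_gsq n a b x) (at_right 0)"
    by (rule tendsto_jacobi_gsq[OF a b assms])
  show "((\<lambda>t. sqrt ((real n + 1) * (real n + (a + t) + (b + t) + 1) / ((real n + (a + t) + 1) * (real n + (b + t) + 1))))
      \<longlongrightarrow> sqrt ((real n + 1) * (real n + a + b + 1) / ((real n + a + 1) * (real n + b + 1)))) (at_right 0)"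
    by (intro tendsto_intros a b) (use assms in auto)
  show "\<forall>\<^sub>F t in at_right 0. jacobi_gsq n (a + t) (b + t) x
      \<le> sqrt ((real n + 1) * (real n + (a + t) + (b + t) + 1) / ((real n + (a + t) + 1) * (real n + (b + t) + 1)))"
    using eventually_at_right_less[of 0]
  proof eventually_elim
    case (elim t)
    show ?case by (rule jacobi_gsq_le) (use assms elim in auto)
  qed
qed auto

lemma sqrt_weight_jacobi_gsq_le_E_bound:
  assumes "a \<ge> 0" "b \<ge> 0" "-1 < x" "x < 1"
  shows "sqrt (1 - x\<^sup>2) * jacobi_gsq n a b x
    \<le> 28800000000 * (E_bound n (a + b + 1))\<^sup>2 / (2 * real n + a + b + 1)"
proof (rule tendsto_le)
  have a: "((\<lambda>t. a + t) \<longlongrightarrow> a) (at_right 0)" and b: "((\<lambda>t. b + t) \<longlongrightarrow> b) (at_right 0)"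
    by (auto intro!: tendsto_eq_intros)
  show "((\<lambda>t. sqrt (1 - x\<^sup>2) * jacobi_gsq n (a + t) (b + t) x) \<longlongrightarrow> sqrt (1 - x\<^sup>2) * jacobi_gsq n a b x) (at_right 0)"
    by (intro tendsto_mult tendsto_const tendsto_jacobi_gsq a b assms)
  show "((\<lambda>t. 28800000000 * (E_bound n ((a + t) + (b + t) + 1))\<^sup>2 / (2 * real n + (a + t) + (b + t) + 1))
     \<longlongrightarrow> 28800000000 * (E_bound n (a + b + 1))\<^sup>2 / (2 * real n + a + b + 1)) (at_right 0)"
    unfolding E_bound_eq by (intro tendsto_intros tendsto_max a b) (use assms in auto)
  show "\<forall>\<^sub>F t in at_right 0. sqrt (1 - x\<^sup>2) * jacobi_gsq n (a + t) (b + t) x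
      \<le> 28800000000 * (E_bound n ((a + t) + (b + t) + 1))\<^sup>2 / (2 * real n + (a + t) + (b + t) + 1)"
    using eventually_at_right_less[of 0]
  proof eventually_elim
    case (elim t)
    have e: "1 \<le> E_bound n (a + t + (b + t) + 1)" "(a + t + (b + t) + 1)\<^sup>2 \<le> E_bound n (a + t + (b + t) + 1) ^ 12"
      "(a + t + (b + t) + 1) ^ 3 / (real n + 1) \<le> E_bound n (a + t + (b + t) + 1) ^ 12"
      using assms elim by (intro E_bound_ge; simp)+
    show ?case
      by (rule sqrt_weight_jacobi_gsq_le) (use assms elim e in \<open>auto simp flip: power_mult\<close>)
  qed
qed auto

text \<open>The factor that vanishes at the end point makes \<open>jacobi_g\<close> zero unless its
  exponent is 0. In that case the normalization and \<open>T_bound\<close> are both 1, and the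
  polynomial takes a value of modulus 1.\<close>

lemma jacobi_g_end_le:
  assumes "a \<ge> 0" "b \<ge> 0" "x = 1 \<or> x = -1"
  shows "\<bar>jacobi_g n a b x\<bar> \<le> T_bound n a b"
proof -
  have T0: "0 \<le> T_bound n a b" by (simp add: T_bound_def)
  have r: "rpow 1 c = 1" "rpow 0 0 = 1" "c \<noteq> 0 \<Longrightarrow> rpow 0 c = 0" for c by (auto simp: rpow_def)
  have G: "Gamma (real n + 1) > 0" "Gamma (real n + a + 1) > 0" "Gamma (real n + b + 1) > 0"
    using assms by (auto intro!: Gamma_real_pos)
  from assms(3) show ?thesis
  proof
    assume x: "x = 1"
    show ?thesis
    proof (cases "a = 0")
      case True
      have "jacobi_P n a b 1 = 1" using jacobi_P_one[of a n b] True G by (simp add: Gamma_fact add.commute)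
      moreover have "T_bound n a b = 1" using True assms by (simp add: T_bound_def)
      ultimately show ?thesis using True x G by (simp add: jacobi_g_def r)
    next
      case False
      thus ?thesis using x T0 by (simp add: jacobi_g_def r)
    qed
  next
    assume x: "x = -1"
    show ?thesis
    proof (cases "b = 0")
      case True
      have "jacobi_P n a b (-1) = (\<Sum>s\<in>{n}. ((real n + a) gchoose (n - s)) * ((real n + b) gchoose s)
             * ((- 1 - 1) / 2) ^ s * ((- 1 + 1) / 2) ^ (n - s))"
        unfolding jacobi_P_def by (rule sum.mono_neutral_right) auto
      hence "jacobi_P n a b (-1) = (- 1) ^ n" using True by (simp flip: binomial_gbinomial)
      moreover have "T_bound n a b = 1" using True assms by (simp add: T_bound_def mult.commute)
      ultimately show ?thesis using True x G by (simp add: jacobi_g_def r abs_mult power_abs)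
    next
      case False
      thus ?thesis using x T0 by (simp add: jacobi_g_def r)
    qed
  qed
qed

theorem corollary9p1:
  fixes n :: nat and a b :: real
  assumes "a \<ge> 0" and "b \<ge> 0"
  shows "(\<forall>x::real. -1 < x \<and> x < 1 \<longrightarrow>
            (let D = 2 * real n + a + b + 1 in
              \<bar>jacobi_g n a b x\<bar>
                \<le> min (T_bound n a b)
                      (sqrt 2 * C_star * E_bound n (a + b + 1)
                        / (D powr (1/2) * (1 - x\<^sup>2) powr (1/4)))))
       \<and> \<bar>jacobi_g n a b 1\<bar> \<le> T_bound n a b
       \<and> \<bar>jacobi_g n a b (-1)\<bar> \<le> T_bound n a b"
proof (intro conjI allI impI)
  fix x :: real assume x: "-1 < x \<and> x < 1"
  define D where "D = 2 * real n + a + b + 1"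
  define E where "E = E_bound n (a + b + 1)"
  define R where "R = sqrt 2 * C_star * E / (D powr (1/2) * (1 - x\<^sup>2) powr (1/4))"
  have D: "D > 0" using assms by (simp add: D_def)
  have p: "1 - x\<^sup>2 > 0"
  proof -
    have "1 - x\<^sup>2 = (1 - x) * (1 + x)" by (simp add: power2_eq_square algebra_simps)
    thus ?thesis using x by simp
  qed
  have E: "1 \<le> E" unfolding E_def using assms by (intro E_bound_ge) auto
  have g2: "(jacobi_g n a b x)\<^sup>2 = jacobi_gsq n a b x" using jacobi_g_squared assms x by blast
  have "\<bar>jacobi_g n a b x\<bar> \<le> T_bound n a b"
    using jacobi_gsq_le_T_bound[OF assms, of x n] x unfolding g2[symmetric]
    by (intro power2_le_imp_le[of "\<bar>jacobi_g n a b x\<bar>"]) (auto simp: T_bound_def)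
  moreover have "\<bar>jacobi_g n a b x\<bar> \<le> R"
  proof (rule power2_le_imp_le)
    show "0 \<le> R" unfolding R_def C_star_def using E by simp
    \<comment> \<open>\<open>2 * (1.2 * 10^5)^2 = 28800000000\<close>, and the fourth root of
      \<open>1 - x^2\<close> becomes a square root.\<close>
    have R2: "R\<^sup>2 = 28800000000 * E\<^sup>2 / (D * sqrt (1 - x\<^sup>2))"
    proof -
      have 1: "(D powr (1/2))\<^sup>2 = D" using D by (simp add: powr_half_sqrt)
      have 2: "((1 - x\<^sup>2) powr (1/4))\<^sup>2 = sqrt (1 - x\<^sup>2)"
        using p by (simp add: power2_eq_square powr_half_sqrt flip: powr_add)
      show ?thesis
        unfolding R_def C_star_def power_divide power_mult_distrib 1 2 by (simp add: power_divide)
    qed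
    have "sqrt (1 - x\<^sup>2) * jacobi_gsq n a b x \<le> 28800000000 * E\<^sup>2 / D"
      unfolding E_def D_def by (rule sqrt_weight_jacobi_gsq_le_E_bound) (use assms x in auto)
    hence "jacobi_gsq n a b x \<le> 28800000000 * E\<^sup>2 / (D * sqrt (1 - x\<^sup>2))"
      using p D by (simp add: field_simps)
    thus "\<bar>jacobi_g n a b x\<bar>\<^sup>2 \<le> R\<^sup>2" unfolding R2 by (simp add: g2)
  qed
  ultimately show "let D = 2 * real n + a + b + 1 in \<bar>jacobi_g n a b x\<bar>
      \<le> min (T_bound n a b) (sqrt 2 * C_star * E_bound n (a + b + 1) / (D powr (1/2) * (1 - x\<^sup>2) powr (1/4)))"
    unfolding Let_def D_def[symmetric] E_def[symmetric] R_def[symmetric] by simp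
qed (use jacobi_g_end_le[OF assms] in auto)

end
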